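(* Let $N\ge 3$ be an integer, $s\in(0,1)$, and let $G$ be a Young function, $G(t)=\int_0^t g(\tau)\,d\tau$, such that for some constants $p^-,p^+$ $$1<p^-\le \frac{t g(t)}{G(t)}\le p^+<\infty\qquad\text{for all } t>0 .$$ Let $\Psi$ be a Young function satisfying the $\Delta_2$-condition with $$\lim_{|t|\to 0}\frac{\Psi(|t|)}{G(|t|)}=0\qquad\text{and}\qquad \Psi\prec\prec G_* .$$ Then the embedding $W^{s,G}_{rad}(\mathbb{R}^N)\hookrightarrow L^{\Psi}(\mathbb{R}^N)$ is compact.
   Context: A Young function is a map $G:[0,\infty)\to[0,\infty)$ of the form $G(t)=\int_0^t g(\tau)\,d\tau$ where $g:[0,\infty)\to[0,\infty)$ is right continuous, $g(0)=0$, $g(t)>0$ for $t>0$, $g$ is non-decreasing on $(0,\infty)$ and $\lim_{t\to\infty}g(t)=\infty$. A Young function $\Psi$ satisfies the $\Delta_2$-condition if there is $C>0$ with $\Psi(2t)\le C\Psi(t)$ for all $t\ge 0$. For $u:\mathbb{R}^N\to\mathbb{R}$ measurable let $D_su(x,y)=\frac{u(x)-u(y)}{|x-y|^s}$, $d\mu=\frac{dx\,dy}{|x-y|^N}$, $\Phi_{G,\mathbb{R}^N}(u)=\int_{\mathbb{R}^N}G(|u|)\,dx$, $\Phi_{s,G,\mathbb{R}^N}(u)=\iint_{\mathbb{R}^N\times\mathbb{R}^N}G(|D_su|)\,d\mu$. Then $L^G(\mathbb{R}^N)$ is the set of measurable $u$ with $\Phi_{G,\mathbb{R}^N}(\lambda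 u)<\infty$ for some $\lambda>0$, and $W^{s,G}(\mathbb{R}^N)$ is the set of $u\in L^G(\mathbb{R}^N)$ with $\Phi_{s,G,\mathbb{R}^N}(\lambda u)<\infty$ for some $\lambda>0$. Norms: $\|u\|_{L^G}=\inf\{\lambda>0:\Phi_{G,\mathbb{R}^N}(u/\lambda)\le1\}$, $[u]_{W^{s,G}}=\inf\{\lambda>0:\Phi_{s,G,\mathbb{R}^N}(u/\lambda)\le 1\}$, $\|u\|_{W^{s,G}}=\|u\|_{L^G}+[u]_{W^{s,G}}$. $L^\Psi(\mathbb{R}^N)$ is defined in the same way with $\Psi$ in place of $G$. $W^{s,G}_{rad}(\mathbb{R}^N)$ is the subspace of radially symmetric functions ($u(x)=u(y)$ whenever $|x|=|y|$) with the norm of $W^{s,G}(\mathbb{R}^N)$. Standing assumption for the definition of $G_*$: $\int_0^1\frac{G^{-1}(\tau)}{\tau^{(N+s)/N}}\,d\tau<\infty$ and $\int_1^{+\infty}\frac{G^{-1}(\tau)}{\tau^{(N+s)/N}}\,d\tau=\infty$. The Sobolev conjugate $G_*$ of $G$ is then defined by $G_*^{-1}(t)=\int_0^t\frac{G^{-1}(\tau)}{\tau^{(N+s)/N}}\,d\tau$ for $t>0$. For Young functions $A,B$, $A\prec\prec B$ means $\lim_{t\to\infty}\frac{A(\lambda t)}{B(t)}=0$ for every $\lambda>0$. *)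

theory Defs
  imports "HOL-Analysis.Analysis"
begin

section \<open>Young functions\<close>

text \<open>
  Young functions are total functions on the reals of which only the values on the
  half-line of nonnegative arguments matter.
\<close>

definition has_young_density :: "(real \<Rightarrow> real) \<Rightarrow> (real \<Rightarrow> real) \<Rightarrow> bool" where
  "has_young_density G g \<longleftrightarrow>
     (\<forall>t\<ge>0. continuous (at_right t) g) \<and>
     g 0 = 0 \<and>
     (\<forall>t>0. g t > 0) \<and>
     mono_on {0<..} g \<and>
     filterlim g at_top at_top \<and>
     (\<forall>t\<ge>0. G t = (LBINT \<tau>:{0..t}. g \<tau>))"

definition young_function :: "(real \<Rightarrow> real) \<Rightarrow> bool" where
  "young_function G \<longleftrightarrow> (\<exists>g. has_young_density G g)"

definition Delta2 :: "(real \<Rightarrow> real) \<Rightarrow> bool" where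
  "Delta2 \<Psi> \<longleftrightarrow> (\<exists>C>0. \<forall>t\<ge>0. \<Psi> (2 * t) \<le> C * \<Psi> t)"

definition essentially_slower :: "(real \<Rightarrow> real) \<Rightarrow> (real \<Rightarrow> real) \<Rightarrow> bool"
    (infix \<open>\<prec>\<prec>\<close> 50) where
  "A \<prec>\<prec> B \<longleftrightarrow> (\<forall>c>0. ((\<lambda>t. A (c * t) / B t) \<longlongrightarrow> 0) at_top)"


section \<open>The Sobolev conjugate\<close>

definition half_line_inv :: "(real \<Rightarrow> real) \<Rightarrow> real \<Rightarrow> real" where
  "half_line_inv G = the_inv_into {0..} G"

definition conj_integrand :: "nat \<Rightarrow> real \<Rightarrow> (real \<Rightarrow> real) \<Rightarrow> real \<Rightarrow> real" where
  "conj_integrand N s G \<tau> = half_line_inv G \<tau> / \<tau> powr ((real N + s) / real N)"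

definition sobolev_conj_admissible :: "nat \<Rightarrow> real \<Rightarrow> (real \<Rightarrow> real) \<Rightarrow> bool" where
  "sobolev_conj_admissible N s G \<longleftrightarrow>
     (\<integral>\<^sup>+\<tau>\<in>{0<..1}. ennreal (conj_integrand N s G \<tau>) \<partial>lborel) < \<infinity> \<and>
     (\<integral>\<^sup>+\<tau>\<in>{1..}. ennreal (conj_integrand N s G \<tau>) \<partial>lborel) = \<infinity>"

text \<open>
  Under the two integral conditions above, the integral function below is an increasing bijection
  of the closed half-line onto itself (with value 0 at 0), so that its inverse is well defined.
\<close>

definition sobolev_conj :: "nat \<Rightarrow> real \<Rightarrow> (real \<Rightarrow> real) \<Rightarrow> real \<Rightarrow> real" where
  "sobolev_conj N s G =
     half_line_inv (\<lambda>t. LBINT \<tau>:{0<..t}. conj_integrand N s G \<tau>)"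


section \<open>Orlicz and fractional Orlicz--Sobolev spaces\<close>

text \<open>
  The spaces are sets of functions rather than of almost-everywhere classes, so the Luxemburg
  functionals are seminorms on them. The modulars are integrals with respect to the
  (complete) Lebesgue measure, on the product space as well, so that Lebesgue measurable functions
  have measurable integrands. On the diagonal, a null set, the quotients take the value 0.
\<close>

definition modular :: "(real \<Rightarrow> real) \<Rightarrow> (real^'n \<Rightarrow> real) \<Rightarrow> ennreal" where
  "modular G u = (\<integral>\<^sup>+x. ennreal (G \<bar>u x\<bar>) \<partial>lebesgue)"

definition frac_quotient :: "real \<Rightarrow> (real^'n \<Rightarrow> real) \<Rightarrow> real^'n \<Rightarrow> real^'n \<Rightarrow> real" where
  "frac_quotient s u x y = (u x - u y) / norm (x - y) powr s"

definition frac_modular :: "real \<Rightarrow> (real \<Rightarrow> real) \<Rightarrow> (real^'n \<Rightarrow> real) \<Rightarrow> ennreal" where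
  "frac_modular s G u =
     (\<integral>\<^sup>+(x, y). ennreal (G \<bar>frac_quotient s u x y\<bar> / norm (x - y) ^ CARD('n)) \<partial>lebesgue)"

definition orlicz_space :: "(real \<Rightarrow> real) \<Rightarrow> (real^'n \<Rightarrow> real) set" where
  "orlicz_space G =
     {u \<in> borel_measurable lebesgue. \<exists>c>0. modular G (\<lambda>x. c * u x) < \<infinity>}"

definition frac_orlicz_sobolev :: "real \<Rightarrow> (real \<Rightarrow> real) \<Rightarrow> (real^'n \<Rightarrow> real) set" where
  "frac_orlicz_sobolev s G =
     {u \<in> orlicz_space G. \<exists>c>0. frac_modular s G (\<lambda>x. c * u x) < \<infinity>}"

text \<open>The infimum is over a nonempty set whenever the function lies in the corresponding space.\<close>

definition luxemburg :: "((real^'n \<Rightarrow> real) \<Rightarrow> ennreal) \<Rightarrow> (real^'n \<Rightarrow> real) \<Rightarrow> real" where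
  "luxemburg \<Phi> u = Inf {c. c > 0 \<and> \<Phi> (\<lambda>x. u x / c) \<le> 1}"

definition orlicz_norm :: "(real \<Rightarrow> real) \<Rightarrow> (real^'n \<Rightarrow> real) \<Rightarrow> real" where
  "orlicz_norm G = luxemburg (modular G)"

definition frac_seminorm :: "real \<Rightarrow> (real \<Rightarrow> real) \<Rightarrow> (real^'n \<Rightarrow> real) \<Rightarrow> real" where
  "frac_seminorm s G = luxemburg (frac_modular s G)"

definition frac_orlicz_sobolev_norm ::
    "real \<Rightarrow> (real \<Rightarrow> real) \<Rightarrow> (real^'n \<Rightarrow> real) \<Rightarrow> real" where
  "frac_orlicz_sobolev_norm s G u = orlicz_norm G u + frac_seminorm s G u"

definition frac_orlicz_sobolev_rad :: "real \<Rightarrow> (real \<Rightarrow> real) \<Rightarrow> (real^'n \<Rightarrow> real) set" where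
  "frac_orlicz_sobolev_rad s G =
     {u \<in> frac_orlicz_sobolev s G. \<forall>x y. norm x = norm y \<longrightarrow> u x = u y}"


section \<open>Compact embeddings\<close>

text \<open>
  The inclusion of the (semi)normed space \<open>X\<close> into \<open>Y\<close> is well defined, continuous, and maps
  bounded sequences to sequences with a subsequence converging in \<open>Y\<close>.
\<close>

definition compactly_embedded ::
    "'f::minus set \<Rightarrow> ('f \<Rightarrow> real) \<Rightarrow> 'f set \<Rightarrow> ('f \<Rightarrow> real) \<Rightarrow> bool" where
  "compactly_embedded X normX Y normY \<longleftrightarrow>
     X \<subseteq> Y \<and>
     (\<exists>C. \<forall>u\<in>X. normY u \<le> C * normX u) \<and>
     (\<forall>u :: nat \<Rightarrow> 'f. range u \<subseteq> X \<and> (\<exists>M. \<forall>k. normX (u k) \<le> M) \<longrightarrow>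
        (\<exists>v\<in>Y. \<exists>r. strict_mono r \<and> (\<lambda>k. normY (u (r k) - v)) \<longlonglongrightarrow> 0))"

end

theory Submission
  imports Defs "HOL-Library.Diagonal_Subsequence"
begin

text \<open>
  Write \<open>E x\<close> for the integral of \<open>G \<bar>D\<^sub>s u (x, y)\<bar> / \<bar>x - y\<bar> ^ N\<close> over \<open>y\<close>, so that the integral
  of \<open>E\<close> is the fractional modular. If \<open>\<bar>u\<bar> \<le> t'\<close> on at least half of the ball of radius \<open>r\<close> around a
  point \<open>x\<close> with \<open>\<bar>u x\<bar> \<ge> t > t'\<close>, then \<open>E x\<close> is at least a constant times
  \<open>G ((t - t') / r powr s)\<close>. This one inequality is used in three ways.

  First, with \<open>r\<close> chosen from the measure of the superlevel set at \<open>t'\<close>, it shows how far the level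
  has to be raised for this measure to be halved. Iterating gives the weak-type
  bound \<open>\<bar>{\<bar>u\<bar> > K H(\<tau>)}\<bar> \<le> 1 / \<tau>\<close> for \<open>H\<close> the inverse of \<open>G\<^sub>*\<close>.
  Second, the weak-type bound determines a radius for every point, and the inequality becomes
  the pointwise estimate \<open>G\<^sub>*(\<bar>u x\<bar> / 4 K) \<le> (2 / V) E x\<close>, which contains the Sobolev embedding.
  Third, a radial superlevel set of finite measure fills only a small part of any ball of fixed radius
  far from the origin, so that the superlevel sets of a bounded family of radial functions have
  uniformly small measure outside large balls.

  As \<open>\<Psi>\<close> is dominated by small multiples of \<open>G\<close> near 0 and of \<open>G\<^sub>*\<close> near infinity, only the measure of
  the sets \<open>{\<bar>u\<^sub>k - u\<^sub>l\<bar> > a}\<close> remains to be controlled: far away by the third point, and locally because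
  averages over small cubes approximate \<open>u\<^sub>k\<close> uniformly in \<open>k\<close>, whence a subsequence converges
  almost everywhere. Fatou's lemma passes to the limit.
\<close>

section \<open>Young functions and the Sobolev conjugate\<close>

text \<open>Strict monotonicity gives injectivity; the intermediate value theorem and divergence at
  infinity give surjectivity onto the half-line. Applied to \<open>G\<close> and to the inverse
  \<open>H\<close> of its Sobolev conjugate.\<close>

lemma half_line_inv_props:
  fixes H :: "real \<Rightarrow> real"
  assumes cont: "continuous_on {0..} H" and mono: "strict_mono_on {0..} H" and "H 0 = 0"
    and lim: "filterlim H at_top at_top"
  shows "t \<ge> 0 \<Longrightarrow> half_line_inv H t \<ge> 0"
    and "t \<ge> 0 \<Longrightarrow> H (half_line_inv H t) = t"
    and "x \<ge> 0 \<Longrightarrow> half_line_inv H (H x) = x"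
proof -
  have inj: "inj_on H {0..}"
    using mono by (rule strict_mono_on_imp_inj_on)
  have surj: "t \<in> H ` {0..}" if "t \<ge> 0" for t
  proof -
    obtain b where b: "b \<ge> 0" "H b \<ge> t"
      using eventually_conj[OF lim[THEN filterlim_at_top[THEN iffD1], rule_format, of t]
          eventually_ge_at_top[of 0]]
      by (metis (mono_tags, lifting) eventually_happens trivial_limit_at_top_linorder)
    then obtain x where "0 \<le> x" "H x = t"
      using IVT'[of H 0 t b] \<open>0 \<le> t\<close> \<open>H 0 = 0\<close> continuous_on_subset[OF cont, of "{0..b}"] by auto
    then show ?thesis by auto
  qed
  show "half_line_inv H t \<ge> 0" if "t \<ge> 0" for t
    using the_inv_into_into[OF inj surj[OF that] order_refl] by (auto simp: half_line_inv_def)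
  show "H (half_line_inv H t) = t" if "t \<ge> 0" for t
    using f_the_inv_into_f[OF inj surj[OF that]] by (simp add: half_line_inv_def)
  show "half_line_inv H (H x) = x" if "x \<ge> 0" for x
    using the_inv_into_f_f[OF inj] that by (simp add: half_line_inv_def)
qed

section \<open>Convexity, continuity and the inverse of a Young function\<close>

locale young =
  fixes G g :: "real \<Rightarrow> real"
  assumes density: "has_young_density G g"
begin

lemma g_pos: "t > 0 \<Longrightarrow> g t > 0"
  and g_zero: "g 0 = 0"
  and G_eq: "t \<ge> 0 \<Longrightarrow> G t = (LBINT \<tau>:{0..t}. g \<tau>)"
  using density by (auto simp: has_young_density_def)

text \<open>The definition provides monotonicity on the open half-line; \<open>g 0 = 0\<close> and
  positivity extend it to the endpoint.\<close>

lemma g_mono: "0 \<le> x \<Longrightarrow> x \<le> y \<Longrightarrow> g x \<le> g y"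
  using density g_pos[of y] g_zero
  by (cases "x = 0"; cases "y = 0") (auto simp: has_young_density_def mono_on_def less_imp_le)

lemma g_nonneg: "0 \<le> x \<Longrightarrow> 0 \<le> g x"
  using g_mono[of 0 x] g_zero by simp

lemma g_integrable: "0 \<le> a \<Longrightarrow> set_integrable lborel {a..b} g"
  unfolding set_integrable_def
proof (rule integrableI_bounded_set[where A = "{a..b}" and B = "g b"])
  assume a: "0 \<le> a"
  have "g \<in> borel_measurable (restrict_space borel {a..b})"
    using a by (intro borel_measurable_mono_on_fnc mono_onI g_mono) auto
  then show "(\<lambda>x. indicator {a..b} x *\<^sub>R g x) \<in> borel_measurable lborel"
    by (simp add: borel_measurable_restrict_space_iff)
  show "AE x in lborel. x \<in> {a..b} \<longrightarrow> norm (indicator {a..b} x *\<^sub>R g x) \<le> g b"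
    using a by (auto simp: g_nonneg g_mono intro!: AE_I2)
qed (auto simp: emeasure_lborel_Icc_eq)

lemma G_zero: "G 0 = 0"
proof -
  have "(\<lambda>x. indicator {0::real..0} x *\<^sub>R g x) = (\<lambda>_. 0)"
    using g_zero by (auto simp: indicator_def fun_eq_iff)
  then show ?thesis
    using G_eq[of 0] by (simp add: set_lebesgue_integral_def)
qed

lemma G_diff:
  assumes "0 \<le> a" "a \<le> b"
  shows "G b - G a = (LBINT \<tau>:{a<..b}. g \<tau>)"
proof -
  have "(LBINT \<tau>:{0..a} \<union> {a<..b}. g \<tau>) = (LBINT \<tau>:{0..a}. g \<tau>) + (LBINT \<tau>:{a<..b}. g \<tau>)"
    using assms by (intro set_integral_Un) (auto intro!: set_integrable_subset[OF g_integrable[of 0 b]])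
  moreover have "{0..a} \<union> {a<..b} = {0..b}"
    using assms by auto
  ultimately show ?thesis
    using assms by (simp add: G_eq)
qed

text \<open>A monotone density lies between its values at the endpoints. These bounds take the place
  of derivatives of \<open>G\<close>.\<close>

lemma G_diff_bounds:
  assumes "0 \<le> a" "a \<le> b"
  shows "(b - a) * g a \<le> G b - G a" "G b - G a \<le> (b - a) * g b"
proof -
  have i: "set_integrable lborel {a<..b} g"
    using assms by (auto intro!: set_integrable_subset[OF g_integrable[of a b]])
  have c: "set_integrable lborel {a<..b} (\<lambda>_. c::real)" for c
    by (rule set_integrable_subset[of _ "{a..b}"])
      (auto intro!: borel_integrable_atLeastAtMost' continuous_intros)
  have e: "(LBINT \<tau>:{a<..b}. c) = (b - a) * c" for c :: real
    using assms by (simp add: set_lebesgue_integral_def)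
  have "(LBINT \<tau>:{a<..b}. g a) \<le> (LBINT \<tau>:{a<..b}. g \<tau>)"
    using assms by (intro set_integral_mono i c) (auto intro: g_mono)
  then show "(b - a) * g a \<le> G b - G a"
    using assms by (simp add: e G_diff)
  have "(LBINT \<tau>:{a<..b}. g \<tau>) \<le> (LBINT \<tau>:{a<..b}. g b)"
    using assms by (intro set_integral_mono i c) (auto intro: g_mono)
  then show "G b - G a \<le> (b - a) * g b"
    using assms by (simp add: e G_diff)
qed

text \<open>The two endpoint bounds treat points to the right and to the left of \<open>x\<close>.
  Thus \<open>g x\<close> is the slope of a supporting line, whether or not \<open>G\<close> is
  differentiable at \<open>x\<close>.\<close>

lemma G_subgradient:
  assumes "0 \<le> x" "0 \<le> y"
  shows "G x + g x * (y - x) \<le> G y"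
  using G_diff_bounds[of x y] G_diff_bounds[of y x] assms
  by (cases "x \<le> y") (auto simp: algebra_simps)

lemma G_mono: "0 \<le> x \<Longrightarrow> x \<le> y \<Longrightarrow> G x \<le> G y"
  using G_diff_bounds(1)[of x y] g_nonneg[of x] mult_nonneg_nonneg[of "y - x" "g x"] by linarith

lemma G_nonneg: "0 \<le> x \<Longrightarrow> 0 \<le> G x"
  using G_mono[of 0 x] G_zero by simp

lemma G_pos:
  assumes "0 < x" shows "0 < G x"
proof -
  have "0 < (x - x / 2) * g (x / 2)"
    using assms g_pos[of "x/2"] by simp
  also have "\<dots> \<le> G x - G (x / 2)"
    using assms by (intro G_diff_bounds) auto
  finally show ?thesis
    using G_nonneg[of "x / 2"] assms by simp
qed

lemma G_strict_mono:
  assumes "0 \<le> x" "x < y" shows "G x < G y"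
proof (cases "x = 0")
  case True
  then show ?thesis using G_pos[of y] G_zero assms by simp
next
  case False
  then have "0 < (y - x) * g x"
    using assms g_pos[of x] by simp
  then show ?thesis
    using G_diff_bounds(1)[of x y] assms by simp
qed

text \<open>Add the supporting-line inequalities at the combination \<open>z\<close> with weights
  \<open>l\<close> and \<open>1 - l\<close>; the linear terms cancel.\<close>

lemma G_convex_comb:
  assumes "0 \<le> x" "0 \<le> y" "0 \<le> l" "l \<le> 1"
  shows "G (l * x + (1 - l) * y) \<le> l * G x + (1 - l) * G y"
proof -
  define z where "z = l * x + (1 - l) * y"
  have z: "0 \<le> z"
    using assms by (simp add: z_def)
  have "l * (G z + g z * (x - z)) + (1 - l) * (G z + g z * (y - z)) \<le> l * G x + (1 - l) * G y"
    using assms z by (intro add_mono mult_left_mono G_subgradient) auto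
  moreover have "l * (G z + g z * (x - z)) + (1 - l) * (G z + g z * (y - z)) = G z"
    by (simp add: z_def algebra_simps)
  ultimately show ?thesis
    by (simp add: z_def)
qed

lemma G_scale: "0 \<le> x \<Longrightarrow> 0 \<le> l \<Longrightarrow> l \<le> 1 \<Longrightarrow> G (l * x) \<le> l * G x"
  using G_convex_comb[of x 0 l] G_zero by simp

lemma G_mean:
  assumes "0 \<le> x" "0 \<le> y"
  shows "G ((x + y) / 2) \<le> (G x + G y) / 2"
  using G_convex_comb[of x y "1/2"] assms by (simp add: field_simps)

text \<open>With this, halved differences of functions with modulars at most 1 again have modulars
  at most 1.\<close>

lemma G_abs_half_diff: "G \<bar>(x - y) / 2\<bar> \<le> (G \<bar>x\<bar> + G \<bar>y\<bar>) / 2"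
proof -
  have "G \<bar>(x - y) / 2\<bar> \<le> G ((\<bar>x\<bar> + \<bar>y\<bar>) / 2)"
    by (intro G_mono) auto
  also have "\<dots> \<le> (G \<bar>x\<bar> + G \<bar>y\<bar>) / 2"
    by (intro G_mean) auto
  finally show ?thesis .
qed

text \<open>Within distance 1 of \<open>x\<close>, the increment of \<open>G\<close> from
  \<open>x\<close> is at most \<open>g (x + 1)\<close> times the distance.\<close>

lemma G_continuous_on: "continuous_on {0..} G"
proof -
  have "(G \<longlongrightarrow> G x) (at x within {0..})" if x: "x \<in> {0..}" for x
  proof -
    have "((\<lambda>y. G y - G x) \<longlongrightarrow> 0) (at x within {0..})"
    proof (rule Lim_null_comparison)
      have "\<forall>\<^sub>F y in at x within {0..}. y \<in> {0..} \<and> dist y x < 1"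
        unfolding eventually_at by (rule exI[of _ 1]) auto
      then show "\<forall>\<^sub>F y in at x within {0..}. norm (G y - G x) \<le> g (x + 1) * \<bar>y - x\<bar>"
      proof eventually_elim
        case (elim y)
        then have y: "0 \<le> y" "y \<le> x + 1" "0 \<le> x"
          using x by (auto simp: dist_real_def)
        show ?case
        proof (cases "x \<le> y")
          case True
          then have "G y - G x \<le> (y - x) * g y" "(y - x) * g y \<le> (y - x) * g (x + 1)"
            using y by (auto intro!: G_diff_bounds mult_left_mono g_mono)
          then show ?thesis
            using True y G_mono[of x y] by (simp add: mult.commute)
        next
          case False
          have "G x - G y \<le> (x - y) * g x"
            using False y by (intro G_diff_bounds) auto
          also have "\<dots> \<le> (x - y) * g (x + 1)"
            using False y by (intro mult_left_mono g_mono) auto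
          finally show ?thesis
            using False y G_mono[of y x] by (simp add: mult.commute)
        qed
      qed
      show "((\<lambda>y. g (x + 1) * \<bar>y - x\<bar>) \<longlongrightarrow> 0) (at x within {0..})"
        by (auto intro!: tendsto_eq_intros)
    qed
    then show ?thesis
      by (simp add: LIM_zero_iff)
  qed
  then show ?thesis
    by (simp add: continuous_on)
qed

lemma G_abs_continuous: "continuous_on UNIV (\<lambda>x. G \<bar>x\<bar>)"
  by (rule continuous_on_compose2[OF G_continuous_on]) (auto intro!: continuous_intros)

lemma G_abs_measurable [measurable]: "(\<lambda>x. G \<bar>x\<bar>) \<in> borel_measurable borel"
  by (rule borel_measurable_continuous_onI[OF G_abs_continuous])

text \<open>The supporting line at 1 has positive slope.\<close>

lemma G_at_top: "filterlim G at_top at_top"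
proof (rule filterlim_at_top_mono)
  have "filterlim (\<lambda>y::real. - 1 + y) at_top at_top"
    by (intro filterlim_tendsto_add_at_top[OF tendsto_const] filterlim_ident)
  then show "filterlim (\<lambda>y. g 1 * (y - 1)) at_top at_top"
    using g_pos[of 1] by (intro filterlim_tendsto_pos_mult_at_top[OF tendsto_const]) simp_all
  show "\<forall>\<^sub>F y in at_top. g 1 * (y - 1) \<le> G y"
    using eventually_ge_at_top[of 0]
  proof eventually_elim
    case (elim y)
    then show ?case
      using G_subgradient[of 1 y] G_nonneg[of 1] by simp
  qed
qed

abbreviation Ginv where "Ginv \<equiv> half_line_inv G"

lemma G_strict_mono_on: "strict_mono_on {0..} G"
  by (auto intro!: strict_mono_onI G_strict_mono)

lemma Ginv_nonneg: "0 \<le> t \<Longrightarrow> 0 \<le> Ginv t"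
  and G_Ginv: "0 \<le> t \<Longrightarrow> G (Ginv t) = t"
  using half_line_inv_props[OF G_continuous_on G_strict_mono_on G_zero G_at_top] by auto

lemma Ginv_le_iff:
  assumes "0 \<le> t" "0 \<le> x"
  shows "Ginv t \<le> x \<longleftrightarrow> t \<le> G x"
  by (metis G_Ginv G_mono G_strict_mono Ginv_nonneg assms linorder_not_less order_less_le)

lemma Ginv_mono: "0 \<le> x \<Longrightarrow> x \<le> y \<Longrightarrow> Ginv x \<le> Ginv y"
  by (subst Ginv_le_iff) (auto simp: Ginv_nonneg G_Ginv)

lemma Ginv_pos: "0 < t \<Longrightarrow> 0 < Ginv t"
  by (metis G_Ginv G_zero Ginv_nonneg order_le_less)

text \<open>\<open>G_scale\<close> with factor \<open>1 / k\<close>, read for the inverse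
  function.\<close>

lemma Ginv_scale:
  assumes "0 \<le> t" "1 \<le> k" shows "Ginv (k * t) \<le> k * Ginv t"
proof -
  have "G (1 / k * (k * Ginv t)) \<le> 1 / k * G (k * Ginv t)"
    using assms Ginv_nonneg[of t] by (intro G_scale) auto
  then have "k * t \<le> G (k * Ginv t)"
    using assms by (simp add: G_Ginv field_simps)
  then show ?thesis
    using assms Ginv_nonneg[of t] by (subst Ginv_le_iff) auto
qed

text \<open>Follows from the supporting line at 1. It serves to bound integrals over sets of finite
  measure by the modular.\<close>

lemma le_linear_G: "\<exists>C>0. \<forall>t\<ge>0. t \<le> 1 + C * G t"
proof (intro exI conjI allI impI)
  show "1 / g 1 > 0" using g_pos[of 1] by simp
  show "t \<le> 1 + 1 / g 1 * G t" if "t \<ge> 0" for t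
    using G_subgradient[of 1 t] G_nonneg[of 1] that g_pos[of 1] by (simp add: field_simps)
qed

end

section \<open>The Sobolev conjugate, studied through its inverse\<close>

locale young_sobolev = young +
  fixes N :: nat and s :: real
  assumes N_pos: "0 < N" and s_pos: "0 < s" and admissible: "sobolev_conj_admissible N s G"
begin

abbreviation (input) k where "k \<equiv> conj_integrand N s G"

text \<open>The inverse of the Sobolev conjugate.\<close>

definition H where "H t = (LBINT \<tau>:{0<..t}. k \<tau>)"

lemma sobolev_conj_eq: "sobolev_conj N s G = half_line_inv H"
  by (simp add: sobolev_conj_def H_def[abs_def])

lemma k_pos: "0 < \<tau> \<Longrightarrow> 0 < k \<tau>"
  by (simp add: conj_integrand_def Ginv_pos)

text \<open>\<open>Ginv\<close> is controlled only on the half-line, so it is first cut off there,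
  where monotonicity makes it measurable.\<close>

lemma k_measurable:
  assumes "0 \<le> a"
  shows "(\<lambda>x. indicator {a<..b} x *\<^sub>R k x) \<in> borel_measurable borel"
proof -
  have "Ginv \<in> borel_measurable (restrict_space borel {0<..})"
    by (intro borel_measurable_mono_on_fnc mono_onI Ginv_mono) auto
  then have [measurable]: "(\<lambda>x. indicator {0<..} x *\<^sub>R Ginv x) \<in> borel_measurable borel"
    by (simp add: borel_measurable_restrict_space_iff)
  have "(\<lambda>x. indicator {a<..b} x * ((indicator {0<..} x *\<^sub>R Ginv x) / x powr ((real N + s) / real N)))
      \<in> borel_measurable borel"
    by measurable
  also have "(\<lambda>x. indicator {a<..b} x * ((indicator {0<..} x *\<^sub>R Ginv x) / x powr ((real N + s) / real N)))
      = (\<lambda>x. indicator {a<..b} x *\<^sub>R k x)"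
    using assms by (auto simp: conj_integrand_def indicator_def fun_eq_iff)
  finally show ?thesis .
qed

lemma k_bounds:
  assumes "0 < a" "a \<le> \<tau>" "\<tau> \<le> b"
  shows "Ginv a / b powr (1 + s / N) \<le> k \<tau>" "k \<tau> \<le> Ginv b / a powr (1 + s / N)"
proof -
  have [simp]: "(real N + s) / real N = 1 + s / N"
    using N_pos by (simp add: field_simps)
  have p: "a powr (1 + s / N) \<le> \<tau> powr (1 + s / N)" "\<tau> powr (1 + s / N) \<le> b powr (1 + s / N)"
    using assms s_pos by (auto intro!: powr_mono2)
  show "Ginv a / b powr (1 + s / N) \<le> k \<tau>"
    unfolding conj_integrand_def using assms p
    by (auto intro!: frac_le Ginv_mono Ginv_nonneg)
  show "k \<tau> \<le> Ginv b / a powr (1 + s / N)"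
    unfolding conj_integrand_def using assms p
    by (auto intro!: frac_le Ginv_mono Ginv_nonneg)
qed

text \<open>Up to 1 this is the first half of admissibility; beyond 1 the integrand is bounded on
  bounded intervals.\<close>

lemma k_integrable: "0 \<le> a \<Longrightarrow> set_integrable lborel {a<..b} k"
proof (rule set_integrable_subset)
  have "set_integrable lborel {0<..1} k"
    unfolding set_integrable_def
  proof (rule integrableI_nonneg)
    show "(\<lambda>x. indicator {0<..1} x *\<^sub>R k x) \<in> borel_measurable lborel"
      using k_measurable by simp
    show "AE x in lborel. 0 \<le> indicator {0<..1} x *\<^sub>R k x"
      by (auto simp: indicator_def less_imp_le k_pos)
    have "(\<integral>\<^sup>+ x. ennreal (indicator {0<..1} x *\<^sub>R k x) \<partial>lborel)
        = (\<integral>\<^sup>+ \<tau>\<in>{0<..1}. ennreal (k \<tau>) \<partial>lborel)"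
      by (intro nn_integral_cong) (auto simp: indicator_def)
    then show "(\<integral>\<^sup>+ x. ennreal (indicator {0<..1} x *\<^sub>R k x) \<partial>lborel) < \<infinity>"
      using admissible by (simp add: sobolev_conj_admissible_def)
  qed
  moreover have "set_integrable lborel {1<..b} k"
    unfolding set_integrable_def
  proof (rule integrableI_bounded_set[where A = "{1..b}" and B = "Ginv b"])
    show "(\<lambda>x. indicator {1<..b} x *\<^sub>R k x) \<in> borel_measurable lborel"
      using k_measurable by simp
    have "norm (indicator {1<..b} x *\<^sub>R k x) \<le> Ginv b" if "x \<in> {1..b}" for x
      using k_bounds(2)[of 1 x b] k_pos[of x] that Ginv_nonneg[of b] by (auto simp: indicator_def)
    then show "AE x in lborel. x \<in> {1..b} \<longrightarrow> norm (indicator {1<..b} x *\<^sub>R k x) \<le> Ginv b"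
      by auto
  qed (auto simp: emeasure_lborel_Icc_eq)
  ultimately show "set_integrable lborel ({0<..1} \<union> {1<..b}) k"
    by (intro set_integrable_Un) auto
qed auto

lemma H_zero: "H 0 = 0"
  by (simp add: H_def set_lebesgue_integral_def)

lemma H_diff:
  assumes "0 \<le> a" "a \<le> b"
  shows "H b - H a = (LBINT \<tau>:{a<..b}. k \<tau>)"
proof -
  have "(LBINT \<tau>:{0<..a} \<union> {a<..b}. k \<tau>) = (LBINT \<tau>:{0<..a}. k \<tau>) + (LBINT \<tau>:{a<..b}. k \<tau>)"
    using assms by (intro set_integral_Un k_integrable) auto
  moreover have "{0<..a} \<union> {a<..b} = {0<..b}"
    using assms by auto
  ultimately show ?thesis
    by (simp add: H_def)
qed

lemma H_diff_ge:
  assumes "0 < a" "a \<le> b"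
  shows "(b - a) * (Ginv a / b powr (1 + s / N)) \<le> H b - H a"
proof -
  have "set_integrable lborel {a<..b} (\<lambda>_. c)" for c :: real
    by (rule set_integrable_subset[of _ "{a..b}"])
      (auto intro!: borel_integrable_atLeastAtMost' continuous_intros)
  then have "(LBINT \<tau>:{a<..b}. Ginv a / b powr (1 + s / N)) \<le> (LBINT \<tau>:{a<..b}. k \<tau>)"
    using assms by (intro set_integral_mono k_integrable k_bounds) auto
  then show ?thesis
    using assms by (simp add: H_diff set_lebesgue_integral_def)
qed

text \<open>On the interval from \<tau>/2 to \<tau> the integrand is comparable to its value at
  \<tau>, because \<open>Ginv\<close> at most doubles there. The left side is, up to a constant, the
  rise of level that halves the measure of a superlevel set; the rises will telescope in
  \<open>H\<close>.\<close>

lemma H_increment: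
  assumes "0 < \<tau>"
  shows "Ginv \<tau> * \<tau> powr (- (s / N)) \<le> 4 * (H \<tau> - H (\<tau> / 2))"
proof -
  have "Ginv \<tau> \<le> 2 * Ginv (\<tau> / 2)"
    using Ginv_scale[of "\<tau> / 2" 2] assms by simp
  then have "Ginv \<tau> * \<tau> powr (- (s / N)) \<le> 2 * Ginv (\<tau> / 2) * \<tau> powr (- (s / N))"
    by (intro mult_right_mono) auto
  also have "\<dots> = 4 * ((\<tau> - \<tau> / 2) * (Ginv (\<tau> / 2) / \<tau> powr (1 + s / N)))"
    using assms by (simp add: powr_add powr_minus field_simps)
  also have "\<dots> \<le> 4 * (H \<tau> - H (\<tau> / 2))"
    using assms by (intro mult_left_mono H_diff_ge) auto
  finally show ?thesis .
qed

lemma H_strict_mono: "strict_mono_on {0..} H"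
proof (rule strict_mono_onI)
  have *: "H a < H b" if "0 < a" "a < b" for a b
  proof -
    have "0 < (b - a) * (Ginv a / b powr (1 + s / N))"
      using that by (simp add: Ginv_pos)
    then show ?thesis using H_diff_ge[of a b] that by simp
  qed
  fix a b :: real assume ab: "a \<in> {0..}" "b \<in> {0..}" "a < b"
  have nonneg: "0 \<le> H x" if "0 \<le> x" for x
    unfolding H_def set_lebesgue_integral_def
    by (rule Bochner_Integration.integral_nonneg) (auto simp: indicator_def less_imp_le k_pos)
  \<comment> \<open>\<open>H_diff_ge\<close> needs a positive left endpoint; for
    \<open>a = 0\<close> the point \<open>b / 2\<close> is inserted.\<close>
  show "H a < H b"
    using *[of "b/2" b] nonneg[of "b/2"] *[of a b] ab H_zero by (cases "a = 0") auto
qed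

lemma H_continuous_on: "continuous_on {0..} H"
proof -
  \<comment> \<open>Setting the integrand to 0 off the open half-line allows integration over closed
    intervals, where the indefinite integral is known to be continuous.\<close>
  define k' where "k' x = indicator {0<..} x * k x" for x
  have "continuous_on {0..b} H" if "0 \<le> b" for b
  proof -
    have i: "set_integrable lborel {0..t} k'" "H t = (LBINT x:{0..t}. k' x)" if "0 \<le> t" for t
    proof -
      have *: "(\<lambda>x. indicator {0..t} x *\<^sub>R k' x) = (\<lambda>x. indicator {0<..t} x *\<^sub>R k x)"
        by (auto simp: k'_def indicator_def fun_eq_iff)
      show "set_integrable lborel {0..t} k'"
        using k_integrable[of 0 t] unfolding set_integrable_def * by simp
      show "H t = (LBINT x:{0..t}. k' x)"
        unfolding H_def set_lebesgue_integral_def * ..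
    qed
    have "continuous_on {0..b} (\<lambda>t. integral {0..t} k')"
      by (rule indefinite_integral_continuous_1) (rule set_borel_integral_eq_integral(1)[OF i(1)[OF that]])
    then show ?thesis
      by (rule continuous_on_cong[THEN iffD1, rotated -1])
        (auto simp: i(2) set_borel_integral_eq_integral(2)[OF i(1)])
  qed
  note * = this
  show ?thesis
    unfolding continuous_on_def
  proof
    fix x :: real assume x: "x \<in> {0..}"
    have "(H \<longlongrightarrow> H x) (at x within {0..x+1})"
      using *[of "x + 1"] x by (auto simp: continuous_on_def)
    moreover have "at x within {0..x+1} = at x within {0..}"
      by (rule at_within_nhd[where S = "{..<x+1}"]) auto
    ultimately show "(H \<longlongrightarrow> H x) (at x within {0..})" by simp
  qed
qed

text \<open>If \<open>H\<close> were bounded, monotone convergence would make the integral over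
  \<open>{1..}\<close> finite, against the second half of admissibility.\<close>

lemma H_at_top: "filterlim H at_top at_top"
proof -
  have mono: "H a \<le> H b" if "0 \<le> a" "a \<le> b" for a b
    using strict_mono_onD[OF H_strict_mono, of a b] that by (cases "a = b") auto
  have "\<exists>n::nat. B \<le> H n" for B
  proof (rule ccontr)
    assume "\<nexists>n. B \<le> H (real n)"
    then have bd: "H (real n) \<le> B" for n by (meson linear)
    have "(\<integral>\<^sup>+\<tau>\<in>{1..}. ennreal (k \<tau>) \<partial>lborel)
        \<le> (\<integral>\<^sup>+\<tau>. (SUP n. ennreal (indicator {0<..real n} \<tau> * k \<tau>)) \<partial>lborel)"
    proof (intro nn_integral_mono)
      fix \<tau> :: real
      obtain n :: nat where n: "\<tau> \<le> n" using real_arch_simple by blast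
      show "ennreal (k \<tau>) * indicator {1..} \<tau> \<le> (SUP n. ennreal (indicator {0<..real n} \<tau> * k \<tau>))"
        by (rule SUP_upper2[of n]) (use n in \<open>auto simp: indicator_def\<close>)
    qed
    also have "\<dots> = (SUP n. \<integral>\<^sup>+\<tau>. ennreal (indicator {0<..real n} \<tau> * k \<tau>) \<partial>lborel)"
    proof (rule nn_integral_monotone_convergence_SUP)
      show "incseq (\<lambda>n \<tau>. ennreal (indicator {0<..real n} \<tau> * k \<tau>))"
        by (auto simp: incseq_def le_fun_def indicator_def intro!: ennreal_leI less_imp_le[OF k_pos])
      show "(\<lambda>\<tau>. ennreal (indicator {0<..real n} \<tau> * k \<tau>)) \<in> borel_measurable lborel" for n
        using k_integrable[of 0 n] by (auto simp: set_integrable_def dest: borel_measurable_integrable)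
    qed
    also have "\<dots> \<le> ennreal B"
    proof (rule SUP_least)
      fix n :: nat
      have "(\<integral>\<^sup>+\<tau>. ennreal (indicator {0<..real n} \<tau> * k \<tau>) \<partial>lborel) = ennreal (H n)"
        using k_integrable[of 0 n] unfolding H_def set_lebesgue_integral_def set_integrable_def
        by (subst nn_integral_eq_integral) (auto simp: indicator_def less_imp_le k_pos)
      then show "(\<integral>\<^sup>+\<tau>. ennreal (indicator {0<..real n} \<tau> * k \<tau>) \<partial>lborel) \<le> ennreal B"
        using bd[of n] by (simp add: ennreal_leI)
    qed
    finally show False
      using admissible by (simp add: sobolev_conj_admissible_def top_unique)
  qed
  then show ?thesis
    unfolding filterlim_at_top eventually_at_top_linorder
    by (meson mono of_nat_0_le_iff order_trans)
qed

abbreviation Gs where "Gs \<equiv> sobolev_conj N s G"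

lemma Gs_nonneg: "0 \<le> t \<Longrightarrow> 0 \<le> Gs t"
  and H_Gs: "0 \<le> t \<Longrightarrow> H (Gs t) = t"
  and Gs_H: "0 \<le> x \<Longrightarrow> Gs (H x) = x"
  using half_line_inv_props[OF H_continuous_on H_strict_mono H_zero H_at_top]
  by (auto simp: sobolev_conj_eq)

lemma H_mono: "0 \<le> x \<Longrightarrow> x \<le> y \<Longrightarrow> H x \<le> H y"
  using strict_mono_onD[OF H_strict_mono, of x y] by (cases "x = y") auto

lemma H_nonneg: "0 \<le> x \<Longrightarrow> 0 \<le> H x"
  using H_mono[of 0 x] H_zero by simp

lemma Gs_pos: "0 < t \<Longrightarrow> 0 < Gs t"
  by (metis H_Gs H_zero Gs_nonneg order_le_less)

end

section \<open>Invariance of Lebesgue measure and Tonelli\<close>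

lemma sigma_finite_measure_balls:
  fixes M :: "'a::euclidean_space measure"
  assumes "sets M = sets borel" "\<And>x r. 0 < r \<Longrightarrow> emeasure M (ball x r) < \<infinity>"
  shows "sigma_finite_measure M"
proof (rule sigma_finite_measure.intro, intro exI conjI)
  have "\<exists>n. x \<in> ball 0 (real (Suc n))" for x :: 'a
  proof -
    obtain n where "norm x < real n" using reals_Archimedean2 by blast
    then show ?thesis by (intro exI[of _ n]) (simp add: dist_norm)
  qed
  then show "(\<Union>n::nat. ball 0 (real (Suc n))) = space M"
    using sets_eq_imp_space_eq[OF assms(1)] by auto
  show "countable (range (\<lambda>n::nat. ball (0::'a) (real (Suc n))))" by simp
  show "range (\<lambda>n::nat. ball 0 (real (Suc n))) \<subseteq> sets M" by (auto simp: assms)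
  show "\<forall>a\<in>range (\<lambda>n::nat. ball 0 (real (Suc n))). emeasure M a \<noteq> \<infinity>"
    using assms(2)[of "real (Suc _)" 0] by (auto simp: less_top)
qed

text \<open>
  Christensen's argument: by Fubini the integral over \<open>y\<close> of the density of \<open>U\<close> in a small
  ball around \<open>y\<close> is the measure of \<open>U\<close>, and for open \<open>U\<close> this density tends to 1 at the
  points of \<open>U\<close>.
\<close>

lemma emeasure_open_le_if_balls:
  fixes M1 M2 :: "'a::euclidean_space measure" and v :: "real \<Rightarrow> real"
  assumes sets: "sets M1 = sets borel" "sets M2 = sets borel"
    and v: "\<And>r. 0 < r \<Longrightarrow> 0 < v r"
    and M1: "\<And>x r. 0 < r \<Longrightarrow> emeasure M1 (ball x r) = ennreal (v r)"
    and M2: "\<And>x r. 0 < r \<Longrightarrow> emeasure M2 (ball x r) = ennreal (v r)"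
    and U: "open U"
  shows "emeasure M1 U \<le> emeasure M2 U"
proof -
  interpret M1: sigma_finite_measure M1
    by (rule sigma_finite_measure_balls) (auto simp: sets M1)
  interpret M2: sigma_finite_measure M2
    by (rule sigma_finite_measure_balls) (auto simp: sets M2)
  interpret P: pair_sigma_finite M1 M2 ..
  note [measurable_cong] = sets
  have [measurable]: "U \<in> sets borel" using U by simp
  define r where "r n = 1 / real (Suc n)" for n
  have r: "0 < r n" for n by (simp add: r_def)
  define d where "d n y = emeasure M2 (U \<inter> ball y (r n)) / ennreal (v (r n))" for n y
  have dm: "emeasure M2 (U \<inter> ball y \<rho>) = (\<integral>\<^sup>+x. indicator U x * indicator {x. dist x y < \<rho>} x \<partial>M2)" for y \<rho>
  proof -
    have "emeasure M2 (U \<inter> ball y \<rho>) = (\<integral>\<^sup>+x. indicator (U \<inter> ball y \<rho>) x \<partial>M2)"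
      by (simp add: sets)
    also have "\<dots> = (\<integral>\<^sup>+x. indicator U x * indicator {x. dist x y < \<rho>} x \<partial>M2)"
      by (intro nn_integral_cong) (auto simp: indicator_def dist_commute)
    finally show ?thesis .
  qed
  have dm': "(\<lambda>y. emeasure M2 (U \<inter> ball y \<rho>)) \<in> borel_measurable M1" for \<rho>
    unfolding dm indicator_def by measurable
  have int: "(\<integral>\<^sup>+y. emeasure M2 (U \<inter> ball y \<rho>) \<partial>M1) = ennreal (v \<rho>) * emeasure M2 U" if "0 < \<rho>" for \<rho>
  proof -
    have "(\<integral>\<^sup>+y. emeasure M2 (U \<inter> ball y \<rho>) \<partial>M1)
        = (\<integral>\<^sup>+y. \<integral>\<^sup>+x. indicator U x * indicator {x. dist x y < \<rho>} x \<partial>M2 \<partial>M1)"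
      by (simp add: dm)
    also have "\<dots> = (\<integral>\<^sup>+x. \<integral>\<^sup>+y. indicator U x * indicator {x. dist x y < \<rho>} x \<partial>M1 \<partial>M2)"
    proof (rule P.Fubini'[symmetric])
      show "(\<lambda>(y, x). indicator U x * indicator {x. dist x y < \<rho>} x :: ennreal) \<in> borel_measurable (M1 \<Otimes>\<^sub>M M2)"
        unfolding indicator_def by measurable
    qed
    also have "\<dots> = (\<integral>\<^sup>+x. ennreal (v \<rho>) * indicator U x \<partial>M2)"
    proof (intro nn_integral_cong)
      fix x
      have "(\<integral>\<^sup>+y. indicator U x * indicator {x. dist x y < \<rho>} x \<partial>M1)
          = (\<integral>\<^sup>+y. indicator U x * indicator (ball x \<rho>) y \<partial>M1)"
        by (intro nn_integral_cong) (auto simp: indicator_def)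
      also have "\<dots> = ennreal (v \<rho>) * indicator U x"
        by (subst nn_integral_cmult) (auto simp: sets M1 that mult.commute intro!: borel_measurable_indicator)
      finally show "(\<integral>\<^sup>+y. indicator U x * indicator {x. dist x y < \<rho>} x \<partial>M1) = ennreal (v \<rho>) * indicator U x" .
    qed
    also have "\<dots> = ennreal (v \<rho>) * emeasure M2 U"
      by (subst nn_integral_cmult) (auto simp: sets)
    finally show ?thesis .
  qed
  have "indicator U y \<le> liminf (\<lambda>n. d n y)" for y
  proof (cases "y \<in> U")
    case True
    then obtain e where e: "0 < e" "ball y e \<subseteq> U"
      using U by (auto simp: open_contains_ball)
    have "\<forall>\<^sub>F n in sequentially. r n < e"
      using order_tendstoD(2)[OF LIMSEQ_inverse_real_of_nat e(1)] by (simp add: r_def inverse_eq_divide)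
    then have "\<forall>\<^sub>F n in sequentially. 1 \<le> d n y"
    proof eventually_elim
      case (elim n)
      then have "U \<inter> ball y (r n) = ball y (r n)" using e by auto
      then show ?case
        using v[OF r[of n]] by (simp add: d_def M2 r)
    qed
    then show ?thesis
      using True by (auto intro: Liminf_bounded)
  qed auto
  then have "(\<integral>\<^sup>+y. indicator U y \<partial>M1) \<le> (\<integral>\<^sup>+y. liminf (\<lambda>n. d n y) \<partial>M1)"
    by (intro nn_integral_mono) auto
  \<comment> \<open>Fatou's lemma. By \<open>int\<close> every integral on the right is the
    \<open>M2\<close>-measure of \<open>U\<close>.\<close>
  also have "\<dots> \<le> liminf (\<lambda>n. \<integral>\<^sup>+y. d n y \<partial>M1)"
    unfolding d_def
    by (intro nn_integral_liminf measurable_compose[OF dm', of "\<lambda>z. z / _"]) measurable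
  also have "(\<lambda>n. \<integral>\<^sup>+y. d n y \<partial>M1) = (\<lambda>n. emeasure M2 U)"
  proof
    fix n
    have "(\<integral>\<^sup>+y. d n y \<partial>M1) = ennreal (v (r n)) * emeasure M2 U / ennreal (v (r n))"
      unfolding d_def by (subst nn_integral_divide) (auto simp: dm' int r)
    also have "\<dots> = emeasure M2 U"
      using v[OF r[of n]]
      by (metis ennreal_mult_divide_eq ennreal_neq_top ennreal_eq_0_iff mult.commute not_le)
    finally show "(\<integral>\<^sup>+y. d n y \<partial>M1) = emeasure M2 U" .
  qed
  finally show ?thesis
    by (simp add: sets Liminf_const)
qed

section \<open>Orthogonal invariance of Lebesgue measure\<close>

lemma orthogonal_transformation_vimage_ball:
  fixes f :: "'a::euclidean_space \<Rightarrow> 'a"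
  assumes f: "orthogonal_transformation f"
  shows "f -` ball (f x) r = ball x r"
proof -
  have "dist (f x) (f y) = dist x y" for y
    using f by (simp add: orthogonal_transformation_isometry)
  then show ?thesis by auto
qed

lemma orthogonal_transformation_measurable:
  fixes f :: "'a::euclidean_space \<Rightarrow> 'a"
  assumes "orthogonal_transformation f"
  shows "f \<in> borel_measurable borel"
  by (intro borel_measurable_continuous_onI linear_continuous_on
      orthogonal_transformation_linear[OF assms, unfolded linear_conv_bounded_linear])

text \<open>The image measure agrees with Lebesgue measure on balls, since preimages of balls are
  balls of the same radius. Comparing in both directions gives agreement on open sets, in particular
  on boxes, which determine \<open>lborel\<close>.\<close>

lemma lborel_distr_orthogonal_transformation:
  fixes f :: "'a::euclidean_space \<Rightarrow> 'a"
  assumes f: "orthogonal_transformation f"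
  shows "distr lborel borel f = lborel"
proof -
  note m [measurable] = orthogonal_transformation_measurable[OF f]
  have balls: "emeasure (distr lborel borel f) (ball x r) = emeasure lborel (ball x r)" for x r
  proof -
    obtain z where z: "x = f z"
      using orthogonal_transformation_surj[OF f] by auto
    show ?thesis
      by (cases "0 < r")
        (simp_all add: emeasure_distr z orthogonal_transformation_vimage_ball[OF f] emeasure_ball ball_empty)
  qed
  have eq: "emeasure (distr lborel borel f) U = emeasure lborel U" if "open U" for U
    by (intro antisym emeasure_open_le_if_balls[OF _ _ _ _ _ that,
          of _ _ "\<lambda>r. unit_ball_vol (real DIM('a)) * r ^ DIM('a)"])
      (auto simp: balls emeasure_ball)
  show ?thesis
  proof (rule lborel_eqI[symmetric])
    fix l u :: 'a assume "\<And>b. b \<in> Basis \<Longrightarrow> l \<bullet> b \<le> u \<bullet> b"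
    then show "emeasure (distr lborel borel f) (box l u) = ennreal (\<Prod>b\<in>Basis. (u - l) \<bullet> b)"
      by (subst eq) (auto simp: emeasure_lborel_box)
  qed simp
qed

text \<open>Write \<open>S\<close> as a Borel set together with a subset of a Borel null set, and
  pull back both pieces.\<close>

lemma emeasure_lebesgue_vimage_orthogonal_transformation:
  fixes f :: "'a::euclidean_space \<Rightarrow> 'a"
  assumes f: "orthogonal_transformation f" and S: "S \<in> sets lebesgue"
  shows "f -` S \<in> sets lebesgue" "emeasure lebesgue (f -` S) = emeasure lebesgue S"
proof -
  note m [measurable] = orthogonal_transformation_measurable[OF f]
  have eq: "emeasure lborel (f -` A) = emeasure lborel A" if "A \<in> sets borel" for A
    using emeasure_distr[of f lborel borel A] that
    by (simp add: lborel_distr_orthogonal_transformation[OF f])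
  obtain A N N' where *: "S = A \<union> N" "N \<subseteq> N'" "N' \<in> null_sets lborel" "A \<in> sets lborel"
    using S by (rule sets_completionE)
  have "f -` N' \<in> null_sets lborel"
    using * eq[of N'] measurable_sets_borel[OF m, of N'] by (auto simp: null_sets_def)
  then have n: "f -` N \<in> null_sets lebesgue" "N \<in> null_sets lebesgue"
    using * by (auto intro: null_sets_completion_subset[OF vimage_mono] null_sets_completion_subset
        null_sets_completionI)
  have A: "A \<in> sets lebesgue" "f -` A \<in> sets lebesgue"
    using * measurable_sets_borel[OF m, of A] by auto
  have f': "f -` S = f -` A \<union> f -` N" using * by auto
  show "f -` S \<in> sets lebesgue"
    unfolding f' using A n by auto
  show "emeasure lebesgue (f -` S) = emeasure lebesgue S"
    unfolding f' *(1) using A n * eq[of A] measurable_sets_borel[OF m, of A]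
    by (simp add: emeasure_Un_null_set)
qed

section \<open>Measurability and Tonelli for the completed measure\<close>

lemma measurable_lebesgue_AE:
  assumes f: "f \<in> lebesgue \<rightarrow>\<^sub>M M" and ae: "AE x in lebesgue. f x = g x" and sp: "space M = UNIV"
  shows "g \<in> lebesgue \<rightarrow>\<^sub>M M"
proof (rule measurableI)
  obtain N where N: "{x. f x \<noteq> g x} \<subseteq> N" "N \<in> null_sets lebesgue"
    using ae unfolding eventually_ae_filter by auto
  have eq: "g x = f x" if "x \<notin> N" for x
    using N(1) that by (metis (mono_tags, lifting) mem_Collect_eq subsetD)
  fix A assume "A \<in> sets M"
  then have "f -` A - N \<in> sets lebesgue"
    using measurable_sets[OF f] N by auto
  moreover have "g -` A \<inter> N \<in> null_sets lebesgue"
    by (rule null_sets_completion_subset[OF _ N(2)]) auto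
  moreover have "g -` A = (f -` A - N) \<union> (g -` A \<inter> N)"
    by (auto simp: eq)
  ultimately show "g -` A \<inter> space lebesgue \<in> sets lebesgue"
    by (metis Int_UNIV_right null_setsD2 sets.Un space_completion space_lborel space_borel)
qed (simp add: sp)

text \<open>Needed when \<open>u\<close> is modified on a null set: the points of the product with a
  coordinate in that set are again null.\<close>

lemma AE_lebesgue_pair:
  fixes P :: "'a::euclidean_space \<Rightarrow> bool"
  assumes "AE x in lebesgue. P x"
  shows "AE p in (lebesgue :: ('a \<times> 'a) measure). P (fst p) \<and> P (snd p)"
proof -
  have "AE x in lborel. P x"
    using assms by (simp add: AE_completion_iff)
  then obtain N where N: "{x. \<not> P x} \<subseteq> N" "N \<in> null_sets lborel"
    unfolding eventually_ae_filter by auto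
  then have [measurable]: "N \<in> sets borel" by auto
  have "AE p in lborel \<Otimes>\<^sub>M lborel. fst p \<notin> N \<and> snd p \<notin> N"
  proof (rule lborel_pair.AE_pair_measure)
    have "Measurable.pred (lborel \<Otimes>\<^sub>M lborel) (\<lambda>p. fst p \<notin> N \<and> snd p \<notin> N)"
      by measurable
    then show "{p \<in> space (lborel \<Otimes>\<^sub>M lborel). fst p \<notin> N \<and> snd p \<notin> N} \<in> sets (lborel \<Otimes>\<^sub>M lborel)"
      by (rule predE)
    show "AE x in lborel. AE y in lborel. fst (x, y) \<notin> N \<and> snd (x, y) \<notin> N"
      using AE_not_in[OF N(2)] by eventually_elim (simp add: AE_not_in[OF N(2)])
  qed
  then have "AE p in lborel. fst p \<notin> N \<and> snd p \<notin> N"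
    by (simp only: lborel_prod)
  then show ?thesis
    using N(1) by (intro AE_completion) auto
qed

text \<open>Lebesgue measure on the product is the completion of the product of Borel measures, so
  Tonelli is applied to a Borel representative \<open>u'\<close> of \<open>u\<close>. The change
  affects a null set of pairs, and for almost every \<open>x\<close> it leaves the inner integral
  unchanged.\<close>

lemma
  fixes u :: "'a::euclidean_space \<Rightarrow> real" and F :: "real \<Rightarrow> real \<Rightarrow> 'a \<Rightarrow> 'a \<Rightarrow> ennreal"
  assumes u: "u \<in> borel_measurable lebesgue"
    and F [measurable]: "(\<lambda>(a, b, x, y). F a b x y) \<in> borel_measurable (borel \<Otimes>\<^sub>M borel \<Otimes>\<^sub>M borel \<Otimes>\<^sub>M borel)"
  shows lebesgue_pair_measurable: "(\<lambda>(x, y). F (u x) (u y) x y) \<in> borel_measurable lebesgue"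
    and lebesgue_pair_inner_measurable:
      "(\<lambda>x. \<integral>\<^sup>+y. F (u x) (u y) x y \<partial>lebesgue) \<in> borel_measurable lebesgue"
    and lebesgue_pair_Tonelli:
      "(\<integral>\<^sup>+(x, y). F (u x) (u y) x y \<partial>lebesgue) = (\<integral>\<^sup>+x. \<integral>\<^sup>+y. F (u x) (u y) x y \<partial>lebesgue \<partial>lebesgue)"
proof -
  obtain u' where u' [measurable]: "u' \<in> borel_measurable borel" and "AE x in lborel. u x = u' x"
    using completion_ex_borel_measurable_real[OF u] by auto
  then have ae: "AE x in lebesgue. u x = u' x"
    by (simp add: AE_completion_iff)
  let ?f = "\<lambda>(x, y). F (u x) (u y) x y" and ?f' = "\<lambda>(x, y). F (u' x) (u' y) x y"
  have "(\<lambda>p. (\<lambda>(a, b, x, y). F a b x y) (u' (fst p), u' (snd p), fst p, snd p))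
      \<in> borel_measurable (lborel \<Otimes>\<^sub>M lborel)"
    by (rule measurable_compose[OF _ F]) measurable
  then have m [measurable]: "?f' \<in> borel_measurable (lborel \<Otimes>\<^sub>M lborel)"
    by (simp add: case_prod_beta)
  then have m': "?f' \<in> borel_measurable lborel"
    by (simp add: lborel_prod)
  have aef: "AE p in lebesgue. ?f' p = ?f p"
    using AE_lebesgue_pair[OF ae] by eventually_elim (auto simp: case_prod_beta)
  show "?f \<in> borel_measurable lebesgue"
    by (rule measurable_lebesgue_AE[OF measurable_completion[OF m'] aef]) simp
  have aei: "AE x in lebesgue. (\<integral>\<^sup>+y. F (u' x) (u' y) x y \<partial>lebesgue) = (\<integral>\<^sup>+y. F (u x) (u y) x y \<partial>lebesgue)"
    using ae
  proof eventually_elim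
    case (elim x)
    show ?case
      by (rule nn_integral_cong_AE) (use ae in eventually_elim, auto simp: elim)
  qed
  have "(\<lambda>x. \<integral>\<^sup>+y. F (u' x) (u' y) x y \<partial>lebesgue) \<in> borel_measurable lborel"
    unfolding nn_integral_completion by measurable
  then have im: "(\<lambda>x. \<integral>\<^sup>+y. F (u' x) (u' y) x y \<partial>lebesgue) \<in> borel_measurable lebesgue"
    by (rule measurable_completion)
  show "(\<lambda>x. \<integral>\<^sup>+y. F (u x) (u y) x y \<partial>lebesgue) \<in> borel_measurable lebesgue"
    by (rule measurable_lebesgue_AE[OF im aei]) simp
  have "(\<integral>\<^sup>+p. ?f p \<partial>lebesgue) = (\<integral>\<^sup>+p. ?f' p \<partial>lebesgue)"
    using aef by (intro nn_integral_cong_AE) auto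
  also have "\<dots> = (\<integral>\<^sup>+p. ?f' p \<partial>(lborel \<Otimes>\<^sub>M lborel))"
    by (simp add: nn_integral_completion lborel_prod)
  also have "\<dots> = (\<integral>\<^sup>+x. \<integral>\<^sup>+y. F (u' x) (u' y) x y \<partial>lborel \<partial>lborel)"
    using lborel.nn_integral_fst[OF m] by simp
  also have "\<dots> = (\<integral>\<^sup>+x. \<integral>\<^sup>+y. F (u' x) (u' y) x y \<partial>lebesgue \<partial>lebesgue)"
    by (simp add: nn_integral_completion)
  also have "\<dots> = (\<integral>\<^sup>+x. \<integral>\<^sup>+y. F (u x) (u y) x y \<partial>lebesgue \<partial>lebesgue)"
    using aei by (intro nn_integral_cong_AE) auto
  finally show "(\<integral>\<^sup>+(x, y). F (u x) (u y) x y \<partial>lebesgue) = (\<integral>\<^sup>+x. \<integral>\<^sup>+y. F (u x) (u y) x y \<partial>lebesgue \<partial>lebesgue)" .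
qed

section \<open>Level sets and the pointwise Sobolev estimate\<close>

definition energy :: "real \<Rightarrow> (real \<Rightarrow> real) \<Rightarrow> (real^'n \<Rightarrow> real) \<Rightarrow> real^'n \<Rightarrow> ennreal" where
  "energy s G u x =
     (\<integral>\<^sup>+y. ennreal (G \<bar>frac_quotient s u x y\<bar> / norm (x - y) ^ CARD('n)) \<partial>lebesgue)"

context young
begin

lemma
  fixes u :: "real^'n \<Rightarrow> real"
  assumes u: "u \<in> borel_measurable lebesgue"
  shows frac_modular_measurable:
      "(\<lambda>(x, y). ennreal (G \<bar>frac_quotient s u x y\<bar> / norm (x - y) ^ CARD('n)))
         \<in> borel_measurable lebesgue"
    and energy_measurable: "energy s G u \<in> borel_measurable lebesgue"
    and frac_modular_eq: "frac_modular s G u = (\<integral>\<^sup>+x. energy s G u x \<partial>lebesgue)"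
proof -
  let ?F = "\<lambda>(a::real) b (x::real^'n) y. ennreal (G \<bar>(a - b) / norm (x - y) powr s\<bar> / norm (x - y) ^ CARD('n))"
  have F: "(\<lambda>(a, b, x, y). ?F a b x y) \<in> borel_measurable (borel \<Otimes>\<^sub>M borel \<Otimes>\<^sub>M borel \<Otimes>\<^sub>M borel)"
    by measurable
  note t = lebesgue_pair_measurable[OF u F] lebesgue_pair_inner_measurable[OF u F]
    lebesgue_pair_Tonelli[OF u F]
  show "(\<lambda>(x, y). ennreal (G \<bar>frac_quotient s u x y\<bar> / norm (x - y) ^ CARD('n)))
         \<in> borel_measurable lebesgue"
    using t(1) by (simp add: frac_quotient_def)
  show "energy s G u \<in> borel_measurable lebesgue"
    using t(2) by (simp add: energy_def[abs_def] frac_quotient_def)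
  show "frac_modular s G u = (\<integral>\<^sup>+x. energy s G u x \<partial>lebesgue)"
    using t(3) by (simp add: energy_def frac_modular_def frac_quotient_def)
qed

lemma modular_measurable:
  assumes "u \<in> borel_measurable lebesgue"
  shows "(\<lambda>x. ennreal (G \<bar>u x\<bar>)) \<in> borel_measurable lebesgue"
  using measurable_compose[OF assms G_abs_measurable] by simp

lemma level_measurable:
  fixes u :: "real^'n \<Rightarrow> real"
  assumes u: "u \<in> borel_measurable lebesgue"
  shows "{x. a < \<bar>u x\<bar>} \<in> sets lebesgue"
  using borel_measurable_less[OF borel_measurable_const borel_measurable_abs[OF u], of a] by simp

text \<open>Chebyshev's inequality for the increasing function \<open>G\<close>.\<close>

lemma emeasure_level_le:
  fixes u :: "real^'n \<Rightarrow> real"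
  assumes u: "u \<in> borel_measurable lebesgue" and "0 \<le> a"
  shows "ennreal (G a) * emeasure lebesgue {x. a < \<bar>u x\<bar>} \<le> modular G u"
proof -
  have "ennreal (G a) * emeasure lebesgue {x. a < \<bar>u x\<bar>}
      = (\<integral>\<^sup>+x. ennreal (G a) * indicator {x. a < \<bar>u x\<bar>} x \<partial>lebesgue)"
    by (simp add: nn_integral_cmult_indicator level_measurable[OF u])
  also have "\<dots> \<le> modular G u"
    unfolding modular_def
    using \<open>0 \<le> a\<close> by (intro nn_integral_mono) (auto simp: indicator_def intro!: ennreal_leI G_mono)
  finally show ?thesis .
qed

text \<open>On the part of the ball where \<open>u\<close> is at most \<open>t'\<close> in modulus,
  the difference of values is at least \<open>t - t'\<close> and the distance is below
  \<open>r\<close>. The integrand is therefore at least \<open>G ((t - t') / r powr s)\<close>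
  divided by the power of \<open>r\<close> in the volume, and this part has at least half the volume
  of the ball.\<close>

lemma energy_ge:
  fixes u :: "real^'n \<Rightarrow> real"
  assumes u: "u \<in> borel_measurable lebesgue" and "0 < r" "0 < s" "t' < t" "t \<le> \<bar>u x\<bar>"
    and small: "emeasure lebesgue (ball x r \<inter> {y. t' < \<bar>u y\<bar>})
        \<le> ennreal (unit_ball_vol (real CARD('n)) * r ^ CARD('n) / 2)"
  shows "ennreal (unit_ball_vol (real CARD('n)) / 2 * G ((t - t') / r powr s)) \<le> energy s G u x"
proof -
  define V where "V = unit_ball_vol (real CARD('n))"
  define A where "A = {y. t' < \<bar>u y\<bar>}"
  define h where "h = V * r ^ CARD('n) / 2"
  have V: "0 < V" by (simp add: V_def)
  have h: "0 \<le> h" using V \<open>0 < r\<close> by (simp add: h_def)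
  have A: "A \<in> sets lebesgue"
    unfolding A_def by (rule level_measurable[OF u])
  have "emeasure lebesgue (ball x r) = ennreal h + ennreal h"
    using h \<open>0 < r\<close> by (simp add: emeasure_ball ennreal_plus[symmetric] h_def V_def del: ennreal_plus)
  also have "emeasure lebesgue (ball x r) = emeasure lebesgue (ball x r \<inter> A) + emeasure lebesgue (ball x r - A)"
  proof -
    have "emeasure lebesgue ((ball x r \<inter> A) \<union> (ball x r - A))
        = emeasure lebesgue (ball x r \<inter> A) + emeasure lebesgue (ball x r - A)"
      using A by (intro plus_emeasure[symmetric]) auto
    then show ?thesis by (simp add: Int_Diff_Un)
  qed
  finally have "ennreal h + ennreal h = emeasure lebesgue (ball x r \<inter> A) + emeasure lebesgue (ball x r - A)" ..
  also have "\<dots> \<le> ennreal h + emeasure lebesgue (ball x r - A)"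
    using small by (intro add_right_mono) (simp add: A_def h_def V_def)
  \<comment> \<open>The ball has measure \<open>h + h\<close> and its bad part at most
    \<open>h\<close>; the finite \<open>h\<close> cancels.\<close>
  finally have D: "ennreal h \<le> emeasure lebesgue (ball x r - A)"
    by (simp add: ennreal_add_left_cancel_le)
  let ?c = "G ((t - t') / r powr s) / r ^ CARD('n)"
  have c: "0 \<le> ?c"
    using assms by (intro divide_nonneg_nonneg G_nonneg) auto
  have "V / 2 * G ((t - t') / r powr s) = ?c * h"
    using \<open>0 < r\<close> by (simp add: h_def)
  then have "ennreal (V / 2 * G ((t - t') / r powr s)) = ennreal ?c * ennreal h"
    using ennreal_mult[OF c h] by simp
  also have "\<dots> \<le> ennreal ?c * emeasure lebesgue (ball x r - A)"
    by (intro mult_left_mono D) simp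
  also have "\<dots> = (\<integral>\<^sup>+y. ennreal ?c * indicator (ball x r - A) y \<partial>lebesgue)"
    by (rule nn_integral_cmult_indicator[symmetric]) (use A in auto)
  also have "\<dots> \<le> energy s G u x"
    unfolding energy_def
  proof (intro nn_integral_mono)
    fix y
    show "ennreal ?c * indicator (ball x r - A) y
        \<le> ennreal (G \<bar>frac_quotient s u x y\<bar> / norm (x - y) ^ CARD('n))"
    proof (cases "y \<in> ball x r - A")
      case True
      then have y: "norm (x - y) < r" "\<bar>u y\<bar> \<le> t'"
        by (auto simp: A_def dist_norm)
      \<comment> \<open>The values at \<open>x\<close> and \<open>y\<close> differ in modulus, hence
        \<open>y\<close> is not \<open>x\<close> and the kernel has a positive denominator.\<close>
      then have xy: "0 < norm (x - y)" using assms by auto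
      have "t - t' \<le> \<bar>u x - u y\<bar>" using y assms by linarith
      then have "(t - t') / r powr s \<le> \<bar>u x - u y\<bar> / norm (x - y) powr s"
        using y xy assms by (intro frac_le powr_mono2) auto
      also have "\<dots> = \<bar>frac_quotient s u x y\<bar>"
        by (simp add: frac_quotient_def abs_divide)
      finally have "?c \<le> G \<bar>frac_quotient s u x y\<bar> / norm (x - y) ^ CARD('n)"
        using y xy assms by (intro frac_le G_mono power_mono G_nonneg) auto
      then show ?thesis using True by (simp add: ennreal_leI)
    qed auto
  qed
  finally show ?thesis by (simp add: V_def)
qed

end

section \<open>Weak-type bound and pointwise Sobolev estimate\<close>

locale young_frac_sobolev = young_sobolev G g "CARD('n::finite)" s
  for G g s and dim :: "'n::finite itself"
begin

definition V where "V = unit_ball_vol (real CARD('n))"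

text \<open>The radius of the ball of volume \<open>2 / \<tau>\<close>.\<close>

definition rad where "rad \<tau> = (2 / (V * \<tau>)) powr (1 / real CARD('n))"

text \<open>The factor 4 comes from \<open>H_increment\<close>, the maximum from
  \<open>Ginv_scale\<close>, and the last factor from the constant in
  \<open>rad_powr\<close>.\<close>

definition K where "K = 4 * max 1 (4 / V) * (2 / V) powr (s / real CARD('n))"

lemma V_pos: "0 < V"
  by (simp add: V_def)

lemma K_pos: "0 < K"
  using V_pos by (simp add: K_def)

lemma rad_pos: "0 < \<tau> \<Longrightarrow> 0 < rad \<tau>"
  using V_pos by (simp add: rad_def)

lemma rad_power: "0 < \<tau> \<Longrightarrow> V * rad \<tau> ^ CARD('n) / 2 = 1 / \<tau>"
  using V_pos by (simp add: rad_def powr_power)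

lemma rad_powr: "0 < \<tau> \<Longrightarrow> rad \<tau> powr s = (2 / V) powr (s / real CARD('n)) * \<tau> powr (- (s / real CARD('n)))"
  using V_pos by (simp add: rad_def powr_powr powr_divide powr_mult powr_minus field_simps)

context
  fixes u :: "real^'n \<Rightarrow> real"
  assumes u: "u \<in> borel_measurable lebesgue"
    and fin: "modular G u < \<infinity>" and frac: "frac_modular s G u \<le> 1"
begin

abbreviation (input) \<mu> where "\<mu> t \<equiv> emeasure lebesgue {x. t < \<bar>u x\<bar>}"

lemma level_antimono: "t \<le> t' \<Longrightarrow> \<mu> t' \<le> \<mu> t"
  by (intro emeasure_mono level_measurable u) auto

text \<open>A set of measure at most 1/\<tau> fills at most half of any ball of volume 2/\<tau>,
  wherever it is centred.\<close>

lemma energy_ge_level: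
  assumes "0 < \<tau>" "\<mu> t' \<le> ennreal (1 / \<tau>)" "t' < t" "t \<le> \<bar>u x\<bar>"
  shows "ennreal (V / 2 * G ((t - t') / rad \<tau> powr s)) \<le> energy s G u x"
  unfolding V_def
proof (rule energy_ge[OF u])
  have "emeasure lebesgue (ball x (rad \<tau>) \<inter> {y. t' < \<bar>u y\<bar>}) \<le> \<mu> t'"
    by (intro emeasure_mono level_measurable u) auto
  also have "\<dots> \<le> ennreal (unit_ball_vol (real CARD('n)) * rad \<tau> ^ CARD('n) / 2)"
    using assms rad_power[of \<tau>] by (simp add: V_def)
  finally show "emeasure lebesgue (ball x (rad \<tau>) \<inter> {y. t' < \<bar>u y\<bar>})
      \<le> ennreal (unit_ball_vol (real CARD('n)) * rad \<tau> ^ CARD('n) / 2)" .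
qed (use assms s_pos rad_pos in auto)

text \<open>Raising the level by \<open>d\<close> makes the energy at least 2\<tau> on the new
  superlevel set. As the total energy is at most 1, this set has measure at most 1/(2\<tau>). By
  \<open>H_increment\<close> the rise \<open>d\<close> is within the stated one.\<close>

lemma level_step:
  assumes "0 < \<tau>" "\<mu> t' \<le> ennreal (1 / \<tau>)"
  shows "\<mu> (t' + K * (H \<tau> - H (\<tau> / 2))) \<le> ennreal (1 / (2 * \<tau>))"
proof -
  \<comment> \<open>Chosen to solve
    \<open>V / 2 * G (d / rad \<tau> powr s) = 2 * \<tau>\<close>.\<close>
  define d where "d = rad \<tau> powr s * Ginv (4 / V * \<tau>)"
  have pos: "0 < 4 / V * \<tau>" using V_pos assms by simp
  have d: "0 < d"
    using rad_pos[OF assms(1)] Ginv_pos[OF pos] by (simp add: d_def)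
  have "Ginv (4 / V * \<tau>) \<le> Ginv (max 1 (4 / V) * \<tau>)"
    using pos assms by (intro Ginv_mono mult_right_mono) auto
  also have "\<dots> \<le> max 1 (4 / V) * Ginv \<tau>"
    using assms by (intro Ginv_scale) auto
  finally have "d \<le> rad \<tau> powr s * (max 1 (4 / V) * Ginv \<tau>)"
    unfolding d_def by (intro mult_left_mono) auto
  also have "\<dots> = max 1 (4 / V) * (2 / V) powr (s / real CARD('n))
      * (Ginv \<tau> * \<tau> powr (- (s / real CARD('n))))"
    using assms by (simp add: rad_powr)
  also have "\<dots> \<le> max 1 (4 / V) * (2 / V) powr (s / real CARD('n)) * (4 * (H \<tau> - H (\<tau> / 2)))"
    using assms by (intro mult_left_mono H_increment) auto
  finally have dK: "d \<le> K * (H \<tau> - H (\<tau> / 2))"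
    by (simp add: K_def algebra_simps)
  have "ennreal (2 * \<tau>) * \<mu> (t' + d) = (\<integral>\<^sup>+x. ennreal (2 * \<tau>) * indicator {x. t' + d < \<bar>u x\<bar>} x \<partial>lebesgue)"
    by (simp add: nn_integral_cmult_indicator level_measurable u)
  also have "\<dots> \<le> (\<integral>\<^sup>+x. energy s G u x \<partial>lebesgue)"
  proof (intro nn_integral_mono)
    fix x
    have "V / 2 * G ((t' + d - t') / rad \<tau> powr s) = 2 * \<tau>"
      using rad_pos[OF assms(1)] pos V_pos by (simp add: d_def G_Ginv)
    then show "ennreal (2 * \<tau>) * indicator {x. t' + d < \<bar>u x\<bar>} x \<le> energy s G u x"
      using energy_ge_level[OF assms, of "t' + d" x] d by (auto simp: indicator_def)
  qed
  also have "\<dots> \<le> 1"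
    using frac by (simp add: frac_modular_eq[OF u])
  finally have *: "ennreal (2 * \<tau>) * \<mu> (t' + d) \<le> 1" .
  have "\<mu> (t' + d) = ennreal (1 / (2 * \<tau>)) * (ennreal (2 * \<tau>) * \<mu> (t' + d))"
    using assms by (simp add: mult.assoc[symmetric] ennreal_mult[symmetric])
  also have "\<dots> \<le> ennreal (1 / (2 * \<tau>)) * 1"
    by (intro mult_left_mono *) simp
  finally have "\<mu> (t' + d) \<le> ennreal (1 / (2 * \<tau>))" by simp
  moreover have "\<mu> (t' + K * (H \<tau> - H (\<tau> / 2))) \<le> \<mu> (t' + d)"
    using dK by (intro emeasure_mono level_measurable u) auto
  ultimately show ?thesis by (rule order_trans[rotated])
qed

text \<open>Each step doubles \<tau>, and the increments of \<open>H\<close> over consecutive dyadic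
  intervals telescope.\<close>

lemma level_iterate:
  assumes "0 < \<tau>" "\<mu> t \<le> ennreal (1 / \<tau>)"
  shows "\<mu> (t + K * H (2 ^ n * \<tau> / 2)) \<le> ennreal (1 / (2 ^ n * \<tau>))"
proof (induction n)
  case 0
  have "\<mu> (t + K * H (2 ^ 0 * \<tau> / 2)) \<le> \<mu> t"
    using K_pos H_nonneg[of "\<tau> / 2"] assms by (intro level_antimono) simp
  then show ?case using assms by simp
next
  case (Suc n)
  have "\<mu> (t + K * H (2 ^ n * \<tau> / 2) + K * (H (2 ^ n * \<tau>) - H (2 ^ n * \<tau> / 2)))
      \<le> ennreal (1 / (2 * (2 ^ n * \<tau>)))"
    using assms by (intro level_step Suc.IH) auto
  then show ?case by (simp add: algebra_simps)
qed

text \<open>Superlevel sets at positive levels have finite measure, so the iteration can start at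
  \<tau>/2^n for large \<open>n\<close> and reach \<tau> after \<open>n\<close> doublings. The size
  of the modular affects only \<open>n\<close>, not the bound.\<close>

lemma level_bound:
  assumes "0 < \<tau>" "0 < t"
  shows "\<mu> (t + K * H \<tau>) \<le> ennreal (1 / \<tau>)"
proof -
  have "ennreal (G t) * \<mu> t < \<infinity>"
    using emeasure_level_le[OF u, of t] fin assms by (auto intro: le_less_trans)
  then have "\<mu> t \<noteq> \<infinity>"
    using G_pos[of t] assms by (auto simp: ennreal_mult_top)
  then obtain m where m: "\<mu> t = ennreal m" "0 \<le> m"
    by (cases "\<mu> t") auto
  obtain n where n: "m * \<tau> < 2 ^ n"
    using real_arch_pow[of 2 "m * \<tau>"] by auto
  have "\<mu> (t + K * H (2 ^ n * (\<tau> / 2 ^ n) / 2)) \<le> ennreal (1 / (2 ^ n * (\<tau> / 2 ^ n)))"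
    using assms n m by (intro level_iterate) (auto simp: field_simps intro!: ennreal_leI)
  moreover have "\<mu> (t + K * H \<tau>) \<le> \<mu> (t + K * H (\<tau> / 2))"
    using assms K_pos H_mono[of "\<tau> / 2" \<tau>] by (intro level_antimono) simp
  ultimately show ?thesis by simp
qed

text \<open>With \<open>T\<close> and \<tau> as in the proof, \<open>H \<tau> = T\<close>, and the
  weak-type bound says that the level \<open>2 * K * T\<close> is exceeded on measure at most
  1/\<tau>. As \<open>u x\<close> has modulus \<open>4 * K * T\<close>, the remaining gap forces
  energy at least \<open>V / 2 * \<tau>\<close> at \<open>x\<close>.\<close>

lemma energy_ge_sobolev_conj:
  "ennreal (V / 2 * Gs (\<bar>u x\<bar> / (4 * K))) \<le> energy s G u x"
proof (cases "u x = 0")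
  case True
  then show ?thesis using Gs_H[of 0] by (simp add: H_zero)
next
  case False
  define T where "T = \<bar>u x\<bar> / (4 * K)"
  define \<tau> where "\<tau> = Gs T"
  have T: "0 < T" using False K_pos by (simp add: T_def)
  have \<tau>: "0 < \<tau>" "H \<tau> = T" using T by (auto simp: \<tau>_def Gs_pos H_Gs)
  have lev: "\<mu> (K * T + K * H \<tau>) \<le> ennreal (1 / \<tau>)"
    using T K_pos \<tau>(1) by (intro level_bound) auto
  have ux: "\<bar>u x\<bar> = 4 * K * T" using K_pos by (simp add: T_def)
  have "ennreal (V / 2 * G ((4 * K * T - (K * T + K * H \<tau>)) / rad \<tau> powr s)) \<le> energy s G u x"
    using T K_pos \<tau> ux by (intro energy_ge_level[OF \<tau>(1) lev]) auto
  moreover have "\<tau> \<le> G ((4 * K * T - (K * T + K * H \<tau>)) / rad \<tau> powr s)"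
  \<comment> \<open>Since \<open>K\<close> was built from the constants of \<open>rad_powr\<close>
    and \<open>H_increment\<close>, the product of \<open>Ginv \<tau>\<close> and
    \<open>rad \<tau> powr s\<close> is at most \<open>K * T\<close>, which is below the gap
    \<open>2 * K * T\<close>.\<close>
  proof -
    have "Ginv \<tau> * \<tau> powr (- (s / real CARD('n))) \<le> 4 * T"
      using H_increment[OF \<tau>(1)] H_nonneg[of "\<tau> / 2"] \<tau> by simp
    then have "(2 / V) powr (s / real CARD('n)) * (Ginv \<tau> * \<tau> powr (- (s / real CARD('n))))
        \<le> (2 / V) powr (s / real CARD('n)) * (4 * T)"
      by (intro mult_left_mono) auto
    also have "\<dots> \<le> K * T"
    proof -
      have "1 * ((2 / V) powr (s / real CARD('n)) * (4 * T))
          \<le> max 1 (4 / V) * ((2 / V) powr (s / real CARD('n)) * (4 * T))"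
        using T by (intro mult_right_mono) auto
      then show ?thesis by (simp add: K_def algebra_simps)
    qed
    also have "\<dots> \<le> 4 * K * T - (K * T + K * H \<tau>)"
      using T K_pos \<tau> by simp
    finally have "Ginv \<tau> * rad \<tau> powr s \<le> 4 * K * T - (K * T + K * H \<tau>)"
      by (simp add: rad_powr \<tau>(1) algebra_simps)
    then have "Ginv \<tau> \<le> (4 * K * T - (K * T + K * H \<tau>)) / rad \<tau> powr s"
      using rad_pos[OF \<tau>(1)] by (simp add: pos_le_divide_eq)
    then have "G (Ginv \<tau>) \<le> G ((4 * K * T - (K * T + K * H \<tau>)) / rad \<tau> powr s)"
      using \<tau> by (intro G_mono Ginv_nonneg) auto
    then show ?thesis using \<tau> by (simp add: G_Ginv)
  qed
  then have "V / 2 * \<tau> \<le> V / 2 * G ((4 * K * T - (K * T + K * H \<tau>)) / rad \<tau> powr s)"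
    using V_pos by (intro mult_left_mono) auto
  ultimately show ?thesis
    unfolding \<tau>_def[symmetric] T_def[symmetric] by (meson ennreal_leI order_trans)
qed

end

end

section \<open>Radial functions far from the origin\<close>

text \<open>The unit sphere is connected with more than one point, hence infinite. Fix
  \<open>k\<close> points on it; scaling by \<open>norm x\<close> multiplies their mutual distances
  by \<open>norm x\<close>.\<close>

lemma disjoint_balls_on_spheres:
  assumes "2 \<le> DIM('a::euclidean_space)" "0 < r"
  obtains R where "0 < R"
    "\<And>x::'a. R \<le> norm x \<Longrightarrow> \<exists>Y::'a set. finite Y \<and> card Y = k \<and> (\<forall>y\<in>Y. norm y = norm x) \<and>
       disjoint_family_on (\<lambda>y. ball y r) Y"
proof -
  obtain b :: 'a where b: "b \<in> Basis" using nonempty_Basis by blast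
  have "infinite (sphere (0::'a) 1)"
  proof
    assume "finite (sphere (0::'a) 1)"
    then have "sphere (0::'a) 1 = {} \<or> (\<exists>a. sphere (0::'a) 1 = {a})"
      using connected_finite_iff_sing[OF connected_sphere[OF assms(1), of 0 1]] by auto
    moreover have "b \<in> sphere 0 1" "- b \<in> sphere 0 1"
      using b by auto
    moreover have "b \<noteq> - b"
    proof
      assume "b = - b"
      then have "b \<bullet> b = - (b \<bullet> b)" by (metis inner_minus_left)
      then show False using b by simp
    qed
    ultimately show False by (elim disjE exE) auto
  qed
  then obtain B where B: "finite B" "card B = k" "B \<subseteq> sphere (0::'a) 1"
    using infinite_arbitrarily_large[of "sphere (0::'a) 1" k] by auto
  obtain \<delta> where \<delta>: "0 < \<delta>" "\<And>y z. y \<in> B \<Longrightarrow> z \<in> B \<Longrightarrow> y \<noteq> z \<Longrightarrow> \<delta> \<le> dist y z"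
  proof -
    \<comment> \<open>The extra element 1 keeps the set of distances nonempty when \<open>B\<close>
      has at most one point.\<close>
    define D where "D = insert 1 ((\<lambda>p. dist (fst p) (snd p)) ` (B \<times> B - Id))"
    have fin: "finite D" using B(1) by (simp add: D_def)
    have "0 < Min D"
      using fin by (subst Min_gr_iff) (auto simp: D_def)
    moreover have "Min D \<le> dist y z" if "y \<in> B" "z \<in> B" "y \<noteq> z" for y z
      by (rule Min_le[OF fin]) (use that in \<open>force simp: D_def\<close>)
    ultimately show ?thesis by (rule that)
  qed
  show ?thesis
  proof
    \<comment> \<open>Beyond this radius, \<delta>-separated directions give centres at distance at
      least \<open>2 * r\<close>.\<close>
    show "0 < 2 * r / \<delta>" using \<delta> assms by simp
    fix x :: 'a assume x: "2 * r / \<delta> \<le> norm x"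
    have "0 < 2 * r / \<delta>" using \<delta> assms by simp
    then have nx: "0 < norm x" using x by linarith
    let ?Y = "(\<lambda>y. norm x *\<^sub>R y) ` B"
    have inj: "inj_on (\<lambda>y. norm x *\<^sub>R y) B" using nx by (auto intro: inj_onI)
    have "disjoint_family_on (\<lambda>y. ball y r) ?Y"
      unfolding disjoint_family_on_def
    proof (intro ballI impI)
      fix y' z' assume "y' \<in> ?Y" "z' \<in> ?Y" "y' \<noteq> z'"
      then obtain y z where yz: "y \<in> B" "z \<in> B" "y \<noteq> z" "y' = norm x *\<^sub>R y" "z' = norm x *\<^sub>R z"
        by auto
      have "2 * r \<le> norm x * \<delta>" using x \<delta> by (simp add: pos_divide_le_eq)
      also have "\<dots> \<le> norm x * dist y z" using \<delta>(2) yz nx by (intro mult_left_mono) auto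
      also have "\<dots> = dist y' z'"
      proof -
        have "y' - z' = norm x *\<^sub>R (y - z)" by (simp add: yz scaleR_right_diff_distrib)
        then show ?thesis by (simp add: dist_norm)
      qed
      finally have *: "2 * r \<le> dist y' z'" .
      show "ball y' r \<inter> ball z' r = {}"
      proof (rule ccontr)
        assume "ball y' r \<inter> ball z' r \<noteq> {}"
        then obtain p where "dist y' p < r" "dist z' p < r" by auto
        then show False using * dist_triangle2[of y' z' p] by linarith
      qed
    qed
    moreover have "\<forall>y\<in>?Y. norm y = norm x"
    proof
      fix y assume "y \<in> ?Y"
      then obtain z where "z \<in> B" "y = norm x *\<^sub>R z" by blast
      moreover then have "norm z = 1" using B(3) by auto
      ultimately show "norm y = norm x" by simp
    qed
    moreover have "finite ?Y" "card ?Y = k" using B inj by (simp_all add: card_image)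
    ultimately show "\<exists>Y::'a set. finite Y \<and> card Y = k \<and> (\<forall>y\<in>Y. norm y = norm x) \<and>
       disjoint_family_on (\<lambda>y. ball y r) Y"
      by - (intro exI[of _ ?Y] conjI; assumption)
  qed
qed

text \<open>An orthogonal map taking \<open>x\<close> to \<open>y\<close> carries one ball to the
  other and leaves the radial set \<open>A\<close> invariant.\<close>

lemma emeasure_ball_Int_radial:
  fixes A :: "(real^'n) set"
  assumes A: "A \<in> sets lebesgue" and radial: "\<And>x y. norm x = norm y \<Longrightarrow> x \<in> A \<longleftrightarrow> y \<in> A"
    and "norm x = norm y"
  shows "emeasure lebesgue (ball x r \<inter> A) = emeasure lebesgue (ball y r \<inter> A)"
proof -
  obtain f where f: "orthogonal_transformation f" "f x = y"
    using orthogonal_transformation_exists[OF assms(3)] by blast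
  have "f -` A = A"
    using radial orthogonal_transformation_norm[OF f(1)] by auto
  then have "f -` (ball y r \<inter> A) = ball x r \<inter> A"
    using orthogonal_transformation_vimage_ball[OF f(1), of x r] f(2) by auto
  moreover have "ball y r \<inter> A \<in> sets lebesgue" using A by auto
  ultimately show ?thesis
    using emeasure_lebesgue_vimage_orthogonal_transformation(2)[OF f(1), of "ball y r \<inter> A"] by argo
qed

context young
begin

text \<open>
  A radial superlevel set of finite measure meets each of many disjoint rotated copies of a ball
  far from the origin in the same small measure, so that the local energy is large at the points of
  a higher superlevel set.
\<close>

lemma radial_tail:
  assumes "2 \<le> CARD('n::finite)" "0 < s" "0 < a" "0 < \<epsilon>"
  obtains R where "\<And>u :: real^'n \<Rightarrow> real. u \<in> borel_measurable lebesgue \<Longrightarrow>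
    (\<And>x y. norm x = norm y \<Longrightarrow> u x = u y) \<Longrightarrow> modular G u \<le> 1 \<Longrightarrow> frac_modular s G u \<le> 1 \<Longrightarrow>
    emeasure lebesgue ({x. a < \<bar>u x\<bar>} - ball 0 R) \<le> ennreal \<epsilon>"
proof -
  define V where "V = unit_ball_vol (real CARD('n))"
  have V: "0 < V" by (simp add: V_def)
  \<comment> \<open>Chosen so that \<open>V / 2 * G L = 1 / \<epsilon>\<close>, the energy wanted on
    the tail; \<open>r\<close> below then gives the quotient \<open>L\<close> to a gap of
    \<open>a / 2\<close>.\<close>
  define L where "L = Ginv (2 / (V * \<epsilon>))"
  have L: "0 < L" using V assms by (simp add: L_def Ginv_pos)
  define r where "r = (a / (2 * L)) powr (1 / s)"
  have r: "0 < r" "a / 2 / r powr s = L"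
  proof -
    show "0 < r" using L assms by (simp add: r_def)
    have "r powr s = a / (2 * L)" using L assms by (simp add: r_def powr_powr)
    then show "a / 2 / r powr s = L" using L assms by simp
  qed
  \<comment> \<open>The level set at \<open>a / 2\<close> has measure at most
    \<open>1 / G (a / 2)\<close> by Chebyshev. With this many disjoint copies, the common share is
    less than half a ball.\<close>
  obtain k :: nat where k: "2 / (G (a / 2) * (V * r ^ CARD('n))) < k"
    using reals_Archimedean2 by blast
  have Ga: "0 < G (a / 2)" using assms by (simp add: G_pos)
  have c: "0 < G (a / 2) * (V * r ^ CARD('n))" using Ga V r by simp
  have "0 < 2 / (G (a / 2) * (V * r ^ CARD('n)))" using c by simp
  then have k0: "0 < k" using k by linarith
  obtain R where R: "0 < R" "\<And>x::real^'n. R \<le> norm x \<Longrightarrow> \<exists>Y::(real^'n) set. finite Y \<and> card Y = k \<and>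
      (\<forall>y\<in>Y. norm y = norm x) \<and> disjoint_family_on (\<lambda>y. ball y r) Y"
  proof -
    have "2 \<le> DIM(real^'n)" using assms by simp
    then show ?thesis
      by (rule disjoint_balls_on_spheres[OF _ r(1), of k]) (rule that)
  qed
  show ?thesis
  proof
    fix u :: "real^'n \<Rightarrow> real"
    assume u: "u \<in> borel_measurable lebesgue" and rad: "\<And>x y. norm x = norm y \<Longrightarrow> u x = u y"
      and mod: "modular G u \<le> 1" and frac: "frac_modular s G u \<le> 1"
    define A where "A = {x. a / 2 < \<bar>u x\<bar>}"
    have A: "A \<in> sets lebesgue" unfolding A_def by (rule level_measurable[OF u])
    have small: "emeasure lebesgue (ball x r \<inter> A) \<le> ennreal (V * r ^ CARD('n) / 2)" if x: "R \<le> norm x" for x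
    proof -
      from R(2)[OF x] obtain Y :: "(real^'n) set" where Y': "finite Y \<and> card Y = k \<and>
          (\<forall>y\<in>Y. norm y = norm x) \<and> disjoint_family_on (\<lambda>y. ball y r) Y" ..
      then have Y: "finite Y" "card Y = k" "\<And>y. y \<in> Y \<Longrightarrow> norm y = norm x"
          "disjoint_family_on (\<lambda>y. ball y r) Y" by simp_all
      let ?m = "emeasure lebesgue (ball x r \<inter> A)"
      have "of_nat k * ?m = (\<Sum>y\<in>Y. emeasure lebesgue (ball y r \<inter> A))"
      proof -
        have "emeasure lebesgue (ball y r \<inter> A) = ?m" if "y \<in> Y" for y
          by (rule emeasure_ball_Int_radial[OF A _ Y(3)[OF that]]) (metis A_def mem_Collect_eq rad)
        then show ?thesis by (simp add: Y)
      qed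
      also have "\<dots> = emeasure lebesgue (\<Union>y\<in>Y. ball y r \<inter> A)"
        using Y A by (intro sum_emeasure) (auto simp: disjoint_family_on_def)
      also have "\<dots> \<le> emeasure lebesgue A"
        using A by (intro emeasure_mono) auto
      finally have 1: "of_nat k * ?m \<le> emeasure lebesgue A" .
      have 3: "ennreal (G (a / 2)) * emeasure lebesgue A \<le> 1"
        unfolding A_def using assms
        by (intro order_trans[OF emeasure_level_le[OF u, of "a / 2"] mod]) simp
      have "ennreal (G (a / 2)) * (of_nat k * ?m) \<le> 1"
        by (rule order_trans[OF mult_left_mono[OF 1] 3]) simp
      then have 2: "ennreal (G (a / 2) * real k) * ?m \<le> 1"
        using Ga by (subst ennreal_mult) (simp_all add: ennreal_of_nat_eq_real_of_nat mult.assoc)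
      have "?m = ennreal (1 / (G (a / 2) * real k)) * (ennreal (G (a / 2) * real k) * ?m)"
        using Ga k0 by (simp add: mult.assoc[symmetric] ennreal_mult[symmetric])
      also have "\<dots> \<le> ennreal (1 / (G (a / 2) * real k))"
        using mult_left_mono[OF 2, of "ennreal (1 / (G (a / 2) * real k))"] by simp
      also have "\<dots> \<le> ennreal (V * r ^ CARD('n) / 2)"
      proof (intro ennreal_leI)
        have "2 < real k * (G (a / 2) * (V * r ^ CARD('n)))"
          using k c by (simp add: pos_divide_less_eq)
        then show "1 / (G (a / 2) * real k) \<le> V * r ^ CARD('n) / 2"
          using Ga k0 by (simp add: field_simps)
      qed
      finally show ?thesis .
    qed
    let ?T = "{x. a < \<bar>u x\<bar>} - ball 0 R"
    have T: "?T \<in> sets lebesgue" using level_measurable[OF u, of a] by auto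
    \<comment> \<open>Chebyshev's inequality for the energy, whose total is at most 1.\<close>
    have "ennreal (1 / \<epsilon>) * emeasure lebesgue ?T = (\<integral>\<^sup>+x. ennreal (1 / \<epsilon>) * indicator ?T x \<partial>lebesgue)"
      by (rule nn_integral_cmult_indicator[symmetric, OF T])
    also have "\<dots> \<le> (\<integral>\<^sup>+x. energy s G u x \<partial>lebesgue)"
    proof (intro nn_integral_mono)
      fix x
      show "ennreal (1 / \<epsilon>) * indicator ?T x \<le> energy s G u x"
      proof (cases "x \<in> ?T")
        case True
        have "ennreal (V / 2 * G ((a - a / 2) / r powr s)) \<le> energy s G u x"
          unfolding V_def
        proof (rule energy_ge[OF u r(1) assms(2)])
          show "emeasure lebesgue (ball x r \<inter> {y. a / 2 < \<bar>u y\<bar>})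
              \<le> ennreal (unit_ball_vol (real CARD('n)) * r ^ CARD('n) / 2)"
            using small[of x] True unfolding A_def V_def by simp
        qed (use True assms in auto)
        moreover have "V / 2 * G ((a - a / 2) / r powr s) = 1 / \<epsilon>"
          using r V assms by (simp add: L_def G_Ginv)
        ultimately show ?thesis using True by simp
      qed auto
    qed
    also have "\<dots> \<le> 1" using frac by (simp add: frac_modular_eq[OF u])
    finally have *: "ennreal (1 / \<epsilon>) * emeasure lebesgue ?T \<le> 1" .
    have "emeasure lebesgue ?T = ennreal \<epsilon> * (ennreal (1 / \<epsilon>) * emeasure lebesgue ?T)"
      using assms by (simp add: mult.assoc[symmetric] ennreal_mult[symmetric])
    also have "\<dots> \<le> ennreal \<epsilon>"
      using mult_left_mono[OF *, of "ennreal \<epsilon>"] by simp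
    finally show "emeasure lebesgue ?T \<le> ennreal \<epsilon>" .
  qed
qed

end

section \<open>Local compactness\<close>

text \<open>Cantor's diagonal argument over an enumeration of the countable index type, with
  Bolzano-Weierstrass at each stage.\<close>

lemma convergent_diagonal_subseq:
  fixes a :: "'p::countable \<Rightarrow> nat \<Rightarrow> real"
  assumes "\<And>p. bounded (range (a p))"
  obtains r :: "nat \<Rightarrow> nat" where "strict_mono r" "\<And>p. convergent (\<lambda>k. a p (r k))"
proof -
  interpret subseqs "\<lambda>n s. convergent (\<lambda>k. a (from_nat n) (s k))"
  proof
    fix n and s :: "nat \<Rightarrow> nat"
    have "bounded (range (\<lambda>k. a (from_nat n) (s k)))"
      by (rule bounded_subset[OF assms[of "from_nat n"]]) auto
    then obtain l r where "strict_mono r" "((\<lambda>k. a (from_nat n) (s k)) \<circ> r) \<longlonglongrightarrow> l"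
      using bounded_imp_convergent_subsequence by blast
    then show "\<exists>r'. strict_mono r' \<and> convergent (\<lambda>k. a (from_nat n) ((s \<circ> r') k))"
      by (auto simp: convergent_def o_def)
  qed
  show ?thesis
  proof
    show "strict_mono diagseq" by (rule subseq_diagseq)
    fix p :: 'p
    \<comment> \<open>The diagonal sequence is treated only from index \<open>Suc (to_nat p)\<close>
      on, which suffices for convergence.\<close>
    have "convergent (\<lambda>k. a (from_nat (to_nat p)) ((diagseq \<circ> (+) (Suc (to_nat p))) k))"
    proof (rule diagseq_holds)
      fix r s :: "nat \<Rightarrow> nat" and n
      assume "strict_mono r" "convergent (\<lambda>k. a (from_nat n) (s k))"
      then show "convergent (\<lambda>k. a (from_nat n) ((s \<circ> r) k))"
        using convergent_subseq_convergent by (fastforce simp: o_def)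
    qed
    then have "convergent (\<lambda>k. a p (diagseq (k + Suc (to_nat p))))"
      by (simp add: o_def add.commute)
    then show "convergent (\<lambda>k. a p (diagseq k))"
      using convergent_ignore_initial_segment[of "\<lambda>k. a p (diagseq k)" "Suc (to_nat p)"] by simp
  qed
qed

section \<open>Tilings by small cubes and approximation by tile means\<close>

text \<open>The map \<open>c\<close> sends a point to the label of its tile. Labels without points
  are allowed, so the size bounds are stated for tiles of the form \<open>c x\<close>.\<close>

locale tiling =
  fixes c :: "real^'n \<Rightarrow> 'z::countable" and d :: real
  assumes tile_sets: "{y. c y = z} \<in> sets borel"
    and tile_finite: "emeasure lborel {y. c y = c x} < \<infinity>"
    and tile_measure: "(d / real CARD('n)) ^ CARD('n) \<le> measure lborel {y. c y = c x}"
    and tile_diam: "c y = c x \<Longrightarrow> norm (x - y) \<le> d"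
    and d_pos: "0 < d"
begin

lemma tile_sets': "{y. c y = z} \<in> sets lebesgue"
  using tile_sets by simp

lemma tile_measurable: "c \<in> borel \<rightarrow>\<^sub>M count_space UNIV"
  using tile_sets by (subst measurable_count_space_eq2_countable) (auto simp: vimage_def)

lemma nn_integral_tile: "(\<integral>\<^sup>+y. ennreal (indicator {y. c y = z} y) \<partial>lebesgue) = emeasure lborel {y. c y = z}"
  using tile_sets[of z] by (simp add: ennreal_indicator nn_integral_completion)

lemma tile_measure_pos: "0 < measure lborel {y. c y = c x}"
proof -
  have "0 < (d / real CARD('n)) ^ CARD('n)" using d_pos by simp
  then show ?thesis using tile_measure[of x] by linarith
qed

end

text \<open>Half-open cubes of side \<open>d\<close> divided by the dimension, labelled by integer
  parts. The sum norm bounds the diameter by \<open>d\<close>, and the inscribed open box bounds the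
  volume from below.\<close>

lemma tiling_exists:
  assumes "0 < d"
  shows "\<exists>c :: real^'n \<Rightarrow> 'n \<Rightarrow> int. tiling c d"
proof -
  define M where "M = real CARD('n) / d"
  have M: "0 < M" using assms by (simp add: M_def)
  define c :: "real^'n \<Rightarrow> 'n \<Rightarrow> int" where "c x i = \<lfloor>M * x $ i\<rfloor>" for x i
  have meas: "{y. c y = z} \<in> sets borel" for z
  proof -
    have "{y. c y = z} = (\<Inter>i. {y. c y i = z i})" by (auto simp: fun_eq_iff)
    also have "\<dots> = (\<Inter>i. {y. real_of_int (z i) \<le> M * y $ i \<and> M * y $ i < real_of_int (z i) + 1})"
      by (simp add: c_def floor_eq_iff)
    also have "\<dots> \<in> sets borel"
      by (intro sets.finite_INT) (auto intro!: borel_measurable_pred_less pred_sets2 borel_open borel_closed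
          sets.Int simp: Collect_conj_eq closed_Collect_le open_Collect_less continuous_intros)
    finally show ?thesis .
  qed
  have norm: "norm (x - y) \<le> d" if "c y = c x" for x y :: "real^'n"
  proof -
    have "\<bar>(x - y) $ i\<bar> \<le> 1 / M" for i
    proof -
      have "\<lfloor>M * y $ i\<rfloor> = \<lfloor>M * x $ i\<rfloor>" using that by (metis c_def)
      then have "\<bar>M * (x - y) $ i\<bar> \<le> 1"
        by (simp add: algebra_simps) linarith
      then have "M * \<bar>(x - y) $ i\<bar> \<le> 1" using M by (simp only: abs_mult abs_of_pos)
      then show ?thesis using M by (simp add: field_simps)
    qed
    then have "(\<Sum>i\<in>UNIV. \<bar>(x - y) $ i\<bar>) \<le> (\<Sum>i\<in>(UNIV::'n set). 1 / M)" by (intro sum_mono) auto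
    also have "\<dots> = d" using assms by (simp add: M_def)
    finally show ?thesis using norm_le_l1_cart[of "x - y"] by linarith
  qed
  have sub: "{y. c y = c x} \<subseteq> cball x d" for x
    using norm by (auto simp: dist_norm)
  have fin: "emeasure lborel {y. c y = c x} < \<infinity>" for x
    using emeasure_mono[OF sub[of x], of lborel] emeasure_lborel_cball_finite[of x d]
    by (auto intro: le_less_trans)
  have low: "(d / real CARD('n)) ^ CARD('n) \<le> measure lborel {y. c y = c x}" for x
  proof -
    let ?a = "(\<chi> i. real_of_int (c x i) / M) :: real^'n" and ?b = "(\<chi> i. real_of_int (c x i + 1) / M) :: real^'n"
    have "box ?a ?b \<subseteq> {y. c y = c x}"
    proof
      fix y assume "y \<in> box ?a ?b"
      then have "\<And>i. real_of_int (c x i) \<le> M * y $ i \<and> M * y $ i < real_of_int (c x i) + 1"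
        using M by (auto simp: mem_box_cart field_simps less_imp_le)
      then have "c y i = c x i" for i
        unfolding c_def[of y] by (simp add: floor_eq_iff)
      then show "y \<in> {y. c y = c x}" by (simp add: fun_eq_iff)
    qed
    then have "measure lborel (box ?a ?b) \<le> measure lborel {y. c y = c x}"
      using meas[of "c x"] fin[of x] by (intro measure_mono_fmeasurable) (auto simp: fmeasurable_def)
    moreover have "measure lborel (box ?a ?b) = (\<Prod>i\<in>(UNIV::'n set). 1 / M)"
    proof -
      have "?a \<in> cbox ?a ?b" using M by (simp add: mem_box_cart divide_right_mono)
      then have "measure lborel (cbox ?a ?b) = (\<Prod>i\<in>UNIV. ?b $ i - ?a $ i)"
        by (intro content_cbox_cart) auto
      moreover have "?b $ i - ?a $ i = 1 / M" for i
        by (simp add: diff_divide_distrib[symmetric])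
      moreover have "measure lborel (box ?a ?b) = measure lborel (cbox ?a ?b)"
        by (simp only: measure_lborel_box_eq measure_lborel_cbox_eq)
      ultimately show ?thesis by (simp only:)
    qed
    ultimately show ?thesis by (simp add: M_def)
  qed
  show ?thesis
    using meas fin low norm assms by (intro exI[of _ c]) (unfold_locales, auto)
qed

text \<open>On an empty tile the mean is 0.\<close>

definition tile_mean :: "(real^'n \<Rightarrow> 'z) \<Rightarrow> (real^'n \<Rightarrow> real) \<Rightarrow> 'z \<Rightarrow> real" where
  "tile_mean c u z = (LINT y:{y. c y = z}|lebesgue. u y) / measure lebesgue {y. c y = z}"

context young
begin

definition C where "C = (SOME C. 0 < C \<and> (\<forall>t\<ge>0. t \<le> 1 + C * G t))"

lemma C_pos: "0 < C" and le_C_G: "0 \<le> t \<Longrightarrow> t \<le> 1 + C * G t"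
  using someI_ex[OF le_linear_G] unfolding C_def by blast+

context
  fixes u :: "real^'n \<Rightarrow> real"
  assumes u [measurable]: "u \<in> borel_measurable lebesgue"
    and mod: "modular G u \<le> 1"
begin

text \<open>Integrate the bound of \<open>le_C_G\<close> against \<open>v\<close>; since
  \<open>v\<close> is at most 1, the second term is at most \<open>C\<close> times the modular. The
  weights in use are indicators of tiles and one integrable weight on the whole space.\<close>

lemma nn_integral_weighted_le:
  assumes v [measurable]: "v \<in> borel_measurable lebesgue" and "\<And>x. 0 \<le> v x" "\<And>x. v x \<le> 1"
  shows "(\<integral>\<^sup>+x. ennreal (v x * \<bar>u x\<bar>) \<partial>lebesgue) \<le> (\<integral>\<^sup>+x. ennreal (v x) \<partial>lebesgue) + ennreal C"
proof -
  note [measurable] = modular_measurable[OF u]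
  have "(\<integral>\<^sup>+x. ennreal (v x * \<bar>u x\<bar>) \<partial>lebesgue)
      \<le> (\<integral>\<^sup>+x. ennreal (v x) + ennreal C * ennreal (G \<bar>u x\<bar>) \<partial>lebesgue)"
  proof (intro nn_integral_mono)
    fix x
    have G: "0 \<le> G \<bar>u x\<bar>" by (simp add: G_nonneg)
    have "v x * \<bar>u x\<bar> \<le> v x * (1 + C * G \<bar>u x\<bar>)"
      using assms by (intro mult_left_mono le_C_G) auto
    also have "\<dots> = v x + v x * (C * G \<bar>u x\<bar>)" by (simp add: algebra_simps)
    also have "\<dots> \<le> v x + 1 * (C * G \<bar>u x\<bar>)"
      using assms C_pos G by (intro add_left_mono mult_right_mono) auto
    finally have "ennreal (v x * \<bar>u x\<bar>) \<le> ennreal (v x + C * G \<bar>u x\<bar>)"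
      by (simp add: ennreal_leI)
    also have "\<dots> = ennreal (v x) + ennreal C * ennreal (G \<bar>u x\<bar>)"
      using assms C_pos G by (simp add: ennreal_plus ennreal_mult)
    finally show "ennreal (v x * \<bar>u x\<bar>) \<le> ennreal (v x) + ennreal C * ennreal (G \<bar>u x\<bar>)" .
  qed
  also have "\<dots> = (\<integral>\<^sup>+x. ennreal (v x) \<partial>lebesgue) + ennreal C * modular G u"
    unfolding modular_def by (subst nn_integral_add) (auto simp: nn_integral_cmult)
  also have "\<dots> \<le> (\<integral>\<^sup>+x. ennreal (v x) \<partial>lebesgue) + ennreal C * 1"
    using mod by (intro add_left_mono mult_left_mono) auto
  finally show ?thesis by simp
qed

lemma weighted_integrable:
  assumes v [measurable]: "v \<in> borel_measurable lebesgue" and "\<And>x. 0 \<le> v x" "\<And>x. v x \<le> 1"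
    and "(\<integral>\<^sup>+x. ennreal (v x) \<partial>lebesgue) < \<infinity>"
  shows "integrable lebesgue (\<lambda>x. v x * u x)"
proof (rule integrableI_bounded)
  have "(\<integral>\<^sup>+x. ennreal (norm (v x * u x)) \<partial>lebesgue) = (\<integral>\<^sup>+x. ennreal (v x * \<bar>u x\<bar>) \<partial>lebesgue)"
    using assms by (simp add: abs_mult)
  also have "\<dots> \<le> (\<integral>\<^sup>+x. ennreal (v x) \<partial>lebesgue) + ennreal C"
    by (rule nn_integral_weighted_le[OF assms(1-3)])
  also have "\<dots> < \<infinity>" using assms by simp
  finally show "(\<integral>\<^sup>+x. ennreal (norm (v x * u x)) \<partial>lebesgue) < \<infinity>" .
qed simp

end

end

locale young_tiling = young G g + tiling c d
  for G g and c :: "real^'n \<Rightarrow> 'z::countable" and d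
begin

context
  fixes u :: "real^'n \<Rightarrow> real"
  assumes u [measurable]: "u \<in> borel_measurable lebesgue"
    and mod: "modular G u \<le> 1"
begin

lemma tile_integrable: "set_integrable lebesgue {y. c y = c x} u"
  unfolding set_integrable_def real_scaleR_def
  using tile_sets'[of "c x"] tile_finite[of x]
  by (intro weighted_integrable[OF u mod]) (auto simp: nn_integral_tile)

text \<open>The bound depends on the mesh but neither on \<open>u\<close> nor on the tile, as the
  extraction of convergent means requires.\<close>

lemma tile_mean_le: "\<bar>tile_mean c u (c x)\<bar> \<le> 1 + C / (d / real CARD('n)) ^ CARD('n)"
proof -
  let ?m = "measure lborel {y. c y = c x}"
  have em: "emeasure lborel {y. c y = c x} = ennreal ?m"
    using tile_finite[of x] by (intro emeasure_eq_ennreal_measure) auto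
  have "ennreal \<bar>LINT y:{y. c y = c x}|lebesgue. u y\<bar>
      \<le> (\<integral>\<^sup>+y. ennreal (norm (indicator {y. c y = c x} y *\<^sub>R u y)) \<partial>lebesgue)"
    unfolding set_lebesgue_integral_def real_norm_def[symmetric]
    by (rule integral_norm_bound_ennreal) (rule tile_integrable[unfolded set_integrable_def])
  also have "\<dots> = (\<integral>\<^sup>+y. ennreal (indicator {y. c y = c x} y * \<bar>u y\<bar>) \<partial>lebesgue)"
    by (simp add: abs_mult)
  also have "\<dots> \<le> emeasure lborel {y. c y = c x} + ennreal C"
    unfolding nn_integral_tile[symmetric]
    using tile_sets'[of "c x"] by (intro nn_integral_weighted_le[OF u mod]) auto
  also have "\<dots> = ennreal (?m + C)"
    using C_pos by (simp add: em ennreal_plus)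
  finally have "\<bar>LINT y:{y. c y = c x}|lebesgue. u y\<bar> \<le> ?m + C"
    using C_pos by (subst (asm) ennreal_le_iff) auto
  then have "\<bar>tile_mean c u (c x)\<bar> \<le> (?m + C) / ?m"
    using tile_sets[of "c x"] by (simp add: tile_mean_def divide_right_mono)
  also have "\<dots> = 1 + C / ?m"
    using tile_measure_pos[of x] by (simp add: add_divide_distrib)
  also have "\<dots> \<le> 1 + C / (d / real CARD('n)) ^ CARD('n)"
    using C_pos tile_measure[of x] d_pos by (intro add_left_mono frac_le) auto
  finally show ?thesis .
qed

text \<open>Average the difference of \<open>u x\<close> and \<open>u y\<close> over the tile of
  \<open>x\<close>. Dividing by \<open>d powr s\<close> and using \<open>le_C_G\<close> bounds it by
  1 plus \<open>C\<close> times a value of \<open>G\<close>, and this value is at most the energy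
  integrand times a power of \<open>d\<close> since the tile has diameter at most \<open>d\<close>.
  That power is absorbed by the volume of the tile, so the factor \<open>d powr s\<close> survives
  in both terms.\<close>

lemma oscillation_le:
  assumes "0 < s"
  shows "ennreal \<bar>u x - tile_mean c u (c x)\<bar>
    \<le> ennreal (d powr s) + ennreal (d powr s * C * real CARD('n) ^ CARD('n)) * energy s G u x"
proof -
  let ?Q = "{y. c y = c x}" and ?m = "measure lborel {y. c y = c x}" and ?N = "CARD('n)"
  let ?e = "\<lambda>y. ennreal (G \<bar>frac_quotient s u x y\<bar> / norm (x - y) ^ ?N)"
  have em: "emeasure lborel ?Q = ennreal ?m"
    using tile_finite[of x] by (intro emeasure_eq_ennreal_measure) auto
  have Q [measurable]: "?Q \<in> sets lebesgue" by (rule tile_sets')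
  have i1: "integrable lebesgue (\<lambda>y. indicator ?Q y * u x)"
    using Q tile_finite[of x] tile_sets[of "c x"] by (intro integrable_mult_left) simp
  note i2 = tile_integrable[of x, unfolded set_integrable_def real_scaleR_def]
  have "(LINT y|lebesgue. indicator ?Q y * (u x - u y)) = ?m * (u x - tile_mean c u (c x))"
  proof -
    have "(LINT y|lebesgue. indicator ?Q y * (u x - u y))
        = (LINT y|lebesgue. indicator ?Q y * u x) - (LINT y|lebesgue. indicator ?Q y * u y)"
      using Bochner_Integration.integral_diff[OF i1 i2] by (simp add: algebra_simps)
    also have "\<dots> = ?m * u x - ?m * tile_mean c u (c x)"
      using tile_measure_pos[of x] tile_sets[of "c x"]
      by (simp add: tile_mean_def set_lebesgue_integral_def)
    finally show ?thesis by (simp add: algebra_simps)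
  qed
  moreover have "integrable lebesgue (\<lambda>y. indicator ?Q y * (u x - u y))"
    using Bochner_Integration.integrable_diff[OF i1 i2] by (simp add: algebra_simps)
  ultimately have "ennreal (norm (?m * (u x - tile_mean c u (c x))))
      \<le> (\<integral>\<^sup>+y. ennreal (norm (indicator ?Q y * (u x - u y))) \<partial>lebesgue)"
    using integral_norm_bound_ennreal[of lebesgue "\<lambda>y. indicator ?Q y * (u x - u y)"] by simp
  also have "\<dots> \<le> (\<integral>\<^sup>+y. ennreal (d powr s) * indicator ?Q y + ennreal (d powr s * C * d ^ ?N) * ?e y \<partial>lebesgue)"
  proof (intro nn_integral_mono)
    fix y
    show "ennreal (norm (indicator ?Q y * (u x - u y)))
        \<le> ennreal (d powr s) * indicator ?Q y + ennreal (d powr s * C * d ^ ?N) * ?e y"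
    \<comment> \<open>Off the tile and at \<open>y = x\<close> the left side is 0.\<close>
    proof (cases "y \<in> ?Q \<and> y \<noteq> x")
      case True
      then have xy: "0 < norm (x - y)" "norm (x - y) \<le> d" using tile_diam by auto
      have "\<bar>u x - u y\<bar> / d powr s \<le> \<bar>u x - u y\<bar> / norm (x - y) powr s"
        using xy assms by (intro frac_le powr_mono2) auto
      also have "\<dots> = \<bar>frac_quotient s u x y\<bar>"
        by (simp add: frac_quotient_def abs_divide)
      finally have "G (\<bar>u x - u y\<bar> / d powr s) \<le> G \<bar>frac_quotient s u x y\<bar>"
        by (intro G_mono) auto
      moreover have "1 * G \<bar>frac_quotient s u x y\<bar> \<le> (d ^ ?N / norm (x - y) ^ ?N) * G \<bar>frac_quotient s u x y\<bar>"
        using xy by (intro mult_right_mono G_nonneg) (auto simp: power_mono)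
      ultimately have g: "G (\<bar>u x - u y\<bar> / d powr s)
          \<le> d ^ ?N * (G \<bar>frac_quotient s u x y\<bar> / norm (x - y) ^ ?N)" by simp
      have "\<bar>u x - u y\<bar> / d powr s \<le> 1 + C * G (\<bar>u x - u y\<bar> / d powr s)"
        by (intro le_C_G) auto
      also have "\<dots> \<le> 1 + C * (d ^ ?N * (G \<bar>frac_quotient s u x y\<bar> / norm (x - y) ^ ?N))"
        using C_pos g by (intro add_left_mono mult_left_mono) auto
      finally have le: "\<bar>u x - u y\<bar> / d powr s
          \<le> 1 + C * (d ^ ?N * (G \<bar>frac_quotient s u x y\<bar> / norm (x - y) ^ ?N))" .
      have "\<bar>u x - u y\<bar>
          \<le> d powr s + (d powr s * C * d ^ ?N) * (G \<bar>frac_quotient s u x y\<bar> / norm (x - y) ^ ?N)"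
      proof -
        have *: "0 < d powr s" using d_pos by simp
        show ?thesis using le
          unfolding pos_divide_le_eq[OF *] by (simp only: algebra_simps)
      qed
      then have "ennreal \<bar>u x - u y\<bar>
          \<le> ennreal (d powr s + (d powr s * C * d ^ ?N) * (G \<bar>frac_quotient s u x y\<bar> / norm (x - y) ^ ?N))"
        by (rule ennreal_leI)
      also have "\<dots> = ennreal (d powr s) + ennreal (d powr s * C * d ^ ?N) * ?e y"
      proof -
        have "0 \<le> G \<bar>frac_quotient s u x y\<bar> / norm (x - y) ^ ?N"
          by (intro divide_nonneg_nonneg G_nonneg) auto
        moreover have "0 \<le> d powr s * C * d ^ ?N" using C_pos d_pos by simp
        moreover have "0 \<le> d powr s" by simp
        ultimately show ?thesis
          by (simp only: ennreal_plus ennreal_mult mult_nonneg_nonneg)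
      qed
      finally show ?thesis using True by simp
    qed auto
  qed
  also have "\<dots> = ennreal (d powr s) * emeasure lborel ?Q + ennreal (d powr s * C * d ^ ?N) * energy s G u x"
  proof -
    have [measurable]: "?e \<in> borel_measurable lebesgue"
    proof -
      have [measurable]: "(\<lambda>y. norm (x - y)) \<in> borel_measurable lebesgue"
        by (rule measurable_completion) measurable
      have [measurable]: "(\<lambda>y. norm (x - y) powr s) \<in> borel_measurable lebesgue"
        by (rule measurable_completion) measurable
      have "(\<lambda>y. frac_quotient s u x y) \<in> borel_measurable lebesgue"
        unfolding frac_quotient_def by measurable
      note measurable_compose[OF this G_abs_measurable, measurable]
      show ?thesis by measurable
    qed
    show ?thesis
      using tile_sets[of "c x"] unfolding energy_def
      by (subst nn_integral_add) (auto simp: nn_integral_cmult nn_integral_cmult_indicator)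
  qed
  finally have "ennreal (norm (?m * (u x - tile_mean c u (c x))))
      \<le> ennreal (d powr s) * emeasure lborel ?Q + ennreal (d powr s * C * d ^ ?N) * energy s G u x" .
  moreover have "norm (?m * (u x - tile_mean c u (c x))) = ?m * \<bar>u x - tile_mean c u (c x)\<bar>"
    by (simp add: abs_mult)
  moreover have "ennreal (d powr s) * emeasure lborel ?Q = ennreal (d powr s * ?m)"
    unfolding em by (rule ennreal_mult[symmetric]) auto
  ultimately have *: "ennreal (?m * \<bar>u x - tile_mean c u (c x)\<bar>)
      \<le> ennreal (d powr s * ?m) + ennreal (d powr s * C * d ^ ?N) * energy s G u x"
    by (simp only:)
  have "ennreal \<bar>u x - tile_mean c u (c x)\<bar> = ennreal (1 / ?m) * ennreal (?m * \<bar>u x - tile_mean c u (c x)\<bar>)"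
    using tile_measure_pos[of x] by (subst ennreal_mult[symmetric]) auto
  also have "\<dots> \<le> ennreal (1 / ?m) * (ennreal (d powr s * ?m) + ennreal (d powr s * C * d ^ ?N) * energy s G u x)"
    by (intro mult_left_mono *) simp
  also have "\<dots> = ennreal (d powr s) + ennreal (d powr s * C * (d ^ ?N / ?m)) * energy s G u x"
  proof -
    have "ennreal (1 / ?m) * ennreal (d powr s * ?m) = ennreal (d powr s)"
      using tile_measure_pos[of x] by (subst ennreal_mult[symmetric]) auto
    moreover have "ennreal (1 / ?m) * ennreal (d powr s * C * d ^ ?N) = ennreal (d powr s * C * (d ^ ?N / ?m))"
      using tile_measure_pos[of x] C_pos d_pos by (subst ennreal_mult[symmetric]) auto
    ultimately show ?thesis by (simp only: distrib_left mult.assoc[symmetric])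
  qed
  also have "\<dots> \<le> ennreal (d powr s) + ennreal (d powr s * C * real ?N ^ ?N) * energy s G u x"
  proof (intro add_left_mono mult_right_mono ennreal_leI mult_left_mono)
    have "d ^ ?N = real ?N ^ ?N * (d / real ?N) ^ ?N" by (simp add: power_divide)
    also have "\<dots> \<le> real ?N ^ ?N * ?m" by (intro mult_left_mono tile_measure) simp
    finally show "d ^ ?N / ?m \<le> real ?N ^ ?N"
      using tile_measure_pos[of x] by (simp add: pos_divide_le_eq)
  qed (use C_pos in auto)
  finally show ?thesis .
qed

text \<open>The previous estimate integrated against \<open>w\<close>, with \<open>w\<close> at most
  1 and total energy at most 1. For integrable \<open>w\<close> the right side vanishes with the
  mesh, uniformly in \<open>u\<close>.\<close>

lemma weighted_oscillation_le:
  fixes w :: "real^'n \<Rightarrow> real"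
  assumes "0 < s" and frac: "frac_modular s G u \<le> 1"
    and w [measurable]: "w \<in> borel_measurable lebesgue" and w01: "\<And>x. 0 \<le> w x" "\<And>x. w x \<le> 1"
  shows "(\<integral>\<^sup>+x. ennreal (w x * \<bar>u x - tile_mean c u (c x)\<bar>) \<partial>lebesgue)
    \<le> ennreal (d powr s) * ((\<integral>\<^sup>+x. ennreal (w x) \<partial>lebesgue) + ennreal (C * real CARD('n) ^ CARD('n)))"
proof -
  let ?K = "d powr s * C * real CARD('n) ^ CARD('n)"
  note [measurable] = energy_measurable[OF u, of s]
  have "(\<integral>\<^sup>+x. ennreal (w x * \<bar>u x - tile_mean c u (c x)\<bar>) \<partial>lebesgue)
      \<le> (\<integral>\<^sup>+x. ennreal (d powr s) * ennreal (w x) + ennreal ?K * energy s G u x \<partial>lebesgue)"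
  proof (intro nn_integral_mono)
    fix x
    have "ennreal (w x * \<bar>u x - tile_mean c u (c x)\<bar>) = ennreal (w x) * ennreal \<bar>u x - tile_mean c u (c x)\<bar>"
      using w01 by (intro ennreal_mult) auto
    also have "\<dots> \<le> ennreal (w x) * (ennreal (d powr s) + ennreal ?K * energy s G u x)"
      by (intro mult_left_mono oscillation_le assms) simp
    also have "\<dots> = ennreal (d powr s) * ennreal (w x) + ennreal (w x) * (ennreal ?K * energy s G u x)"
      by (simp only: distrib_left mult.commute)
    also have "\<dots> \<le> ennreal (d powr s) * ennreal (w x) + 1 * (ennreal ?K * energy s G u x)"
      using w01 by (intro add_left_mono mult_right_mono) (auto simp: ennreal_le_1)
    finally show "ennreal (w x * \<bar>u x - tile_mean c u (c x)\<bar>)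
        \<le> ennreal (d powr s) * ennreal (w x) + ennreal ?K * energy s G u x"
      by (simp only: mult_1_left)
  qed
  also have "\<dots> = ennreal (d powr s) * (\<integral>\<^sup>+x. ennreal (w x) \<partial>lebesgue) + ennreal ?K * frac_modular s G u"
    unfolding frac_modular_eq[OF u] by (subst nn_integral_add) (auto simp: nn_integral_cmult)
  also have "\<dots> \<le> ennreal (d powr s) * (\<integral>\<^sup>+x. ennreal (w x) \<partial>lebesgue) + ennreal ?K * 1"
    by (intro add_left_mono mult_left_mono frac) simp
  also have "ennreal ?K * 1 = ennreal (d powr s) * ennreal (C * real CARD('n) ^ CARD('n))"
    using C_pos by (subst ennreal_mult[symmetric]) (auto simp: mult.assoc)
  finally show ?thesis by (simp only: distrib_left)
qed

end

end

section \<open>Extraction of an almost everywhere convergent subsequence\<close>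

context young
begin

text \<open>The tile means for meshes 1/(m+1) are countably many bounded sequences, made convergent
  together by a diagonal subsequence. Tile means approximate the functions uniformly in weighted
  mean, so the subsequence is Cauchy in weighted \<open>L1\<close>; a further one is Cauchy almost
  everywhere, and the positive weight is divided out.\<close>

lemma AE_convergent_subseq:
  fixes u :: "nat \<Rightarrow> real^'n \<Rightarrow> real"
  assumes "0 < s"
    and u [measurable]: "\<And>k. u k \<in> borel_measurable lebesgue"
    and mod: "\<And>k. modular G (u k) \<le> 1" and frac: "\<And>k. frac_modular s G (u k) \<le> 1"
  obtains r :: "nat \<Rightarrow> nat" where "strict_mono r" "AE x in lebesgue. convergent (\<lambda>k. u (r k) x)"
proof -
  let ?N = "CARD('n)"
  \<comment> \<open>A positive integrable weight replaces exhaustion by bounded sets.\<close>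
  obtain w :: "real^'n \<Rightarrow> real" where w': "w \<in> borel_measurable lborel" and
      w0: "\<And>x. 0 < w x" and w1: "\<And>x. w x \<le> 1" and wi: "integrable lborel w"
    using sigma_finite_measure.obtain_positive_integrable_function[OF sigma_finite_lborel] by metis
  have w [measurable]: "w \<in> borel_measurable lebesgue"
    using w' by (rule measurable_completion)
  have w0': "0 \<le> w x" for x using w0[of x] by simp
  have W: "(\<integral>\<^sup>+x. ennreal (w x) \<partial>lebesgue) = ennreal (integral\<^sup>L lborel w)"
    using nn_integral_eq_integral[OF wi] w0' by (simp add: nn_integral_completion)
  define b where "b = integral\<^sup>L lborel w + C * real ?N ^ ?N"
  have b: "(\<integral>\<^sup>+x. ennreal (w x) \<partial>lebesgue) + ennreal (C * real ?N ^ ?N) = ennreal b"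
    unfolding W b_def using C_pos w0' by (intro ennreal_plus[symmetric]) auto
  have b0: "0 \<le> b" unfolding b_def using C_pos w0' by (intro add_nonneg_nonneg) auto
  define d where "d m = 1 / real (Suc m)" for m
  have d0: "0 < d m" for m by (simp add: d_def)
  have "\<exists>c :: real^'n \<Rightarrow> 'n \<Rightarrow> int. tiling c (d m)" for m
    by (rule tiling_exists[OF d0])
  then obtain c :: "nat \<Rightarrow> real^'n \<Rightarrow> 'n \<Rightarrow> int" where c: "\<And>m. tiling (c m) (d m)"
    by metis
  have yt: "young_tiling G g (c m) (d m)" for m
    using young_axioms c by (intro young_tiling.intro)
  \<comment> \<open>The index is a pair of a mesh number and a tile label, hence countable.\<close>
  define a where "a p k = tile_mean (c (fst p)) (u k) (snd p)" for p :: "nat \<times> ('n \<Rightarrow> int)" and k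
  define B where "B m = 1 + C / (d m / real ?N) ^ ?N" for m
  have a_bound: "\<bar>a (m, c m x) k\<bar> \<le> B m" for m k x
    unfolding a_def B_def fst_conv snd_conv by (rule young_tiling.tile_mean_le[OF yt u mod])
  have "bounded (range (a p))" for p
  proof (cases "\<exists>x. c (fst p) x = snd p")
    case True
    then obtain x where "p = (fst p, c (fst p) x)" by (metis prod.collapse)
    then have "\<bar>a p k\<bar> \<le> B (fst p)" for k by (metis a_bound)
    then show ?thesis by (auto simp: bounded_iff)
  next
    case False
    then have "{y. c (fst p) y = snd p} = {}" by auto
    then have "a p k = 0" for k by (simp add: a_def tile_mean_def)
    then show ?thesis by (auto simp: bounded_iff)
  qed
  then obtain r1 where r1: "strict_mono r1" "\<And>p. convergent (\<lambda>k. a p (r1 k))"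
    by (rule convergent_diagonal_subseq[of a]) auto
  define \<alpha> where "\<alpha> p = lim (\<lambda>k. a p (r1 k))" for p
  have lim: "(\<lambda>k. a p (r1 k)) \<longlonglongrightarrow> \<alpha> p" for p
    using r1(2)[of p] by (simp add: \<alpha>_def convergent_LIMSEQ_iff)
  have tm: "(\<lambda>x. h (c m x)) \<in> borel_measurable lebesgue" for h :: "('n \<Rightarrow> int) \<Rightarrow> real" and m
  proof -
    have "(\<lambda>x. h (c m x)) \<in> borel_measurable borel"
      by (rule measurable_compose[OF tiling.tile_measurable[OF c]]) simp
    then show ?thesis by (intro measurable_completion) simp
  qed
  note am [measurable] = tm[of "\<lambda>z. a (_, z) _" _] and \<alpha>m [measurable] = tm[of "\<lambda>z. \<alpha> (_, z)" _]
  define E where "E m k = (\<integral>\<^sup>+x. ennreal (w x * \<bar>a (m, c m x) (r1 k) - \<alpha> (m, c m x)\<bar>) \<partial>lebesgue)" for m k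
  have E: "E m \<longlonglongrightarrow> 0" for m
  \<comment> \<open>For a fixed mesh the means converge on every tile, with \<open>2 * B m\<close>
    times the weight as dominating function.\<close>
  proof -
    have "(\<lambda>k. \<integral>\<^sup>+x. ennreal (w x * \<bar>a (m, c m x) (r1 k) - \<alpha> (m, c m x)\<bar>) \<partial>lebesgue)
        \<longlonglongrightarrow> (\<integral>\<^sup>+x. 0 \<partial>(lebesgue :: (real^'n) measure))"
    proof (rule nn_integral_dominated_convergence[where w = "\<lambda>x. ennreal (2 * B m) * ennreal (w x)"])
      show "(\<lambda>x. ennreal (w x * \<bar>a (m, c m x) (r1 k) - \<alpha> (m, c m x)\<bar>)) \<in> borel_measurable lebesgue" for k
        by measurable
      show "(\<lambda>x. ennreal (2 * B m) * ennreal (w x)) \<in> borel_measurable lebesgue" by measurable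
      show "AE x in lebesgue. ennreal (w x * \<bar>a (m, c m x) (r1 k) - \<alpha> (m, c m x)\<bar>)
          \<le> ennreal (2 * B m) * ennreal (w x)" for k
      proof (intro AE_I2)
        fix x
        have "\<bar>\<alpha> (m, c m x)\<bar> \<le> B m"
          by (rule LIMSEQ_le_const2[OF tendsto_rabs[OF lim]]) (auto intro: a_bound)
        then have le: "\<bar>a (m, c m x) (r1 k) - \<alpha> (m, c m x)\<bar> \<le> 2 * B m"
          using a_bound[of m x "r1 k"] by linarith
        then have "w x * \<bar>a (m, c m x) (r1 k) - \<alpha> (m, c m x)\<bar> \<le> w x * (2 * B m)"
          using w0' by (intro mult_left_mono) auto
        then have "ennreal (w x * \<bar>a (m, c m x) (r1 k) - \<alpha> (m, c m x)\<bar>) \<le> ennreal (2 * B m * w x)"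
          by (intro ennreal_leI) (simp add: mult.commute)
        also have "\<dots> = ennreal (2 * B m) * ennreal (w x)"
          using w0' le by (intro ennreal_mult) auto
        finally show "ennreal (w x * \<bar>a (m, c m x) (r1 k) - \<alpha> (m, c m x)\<bar>)
          \<le> ennreal (2 * B m) * ennreal (w x)" .
      qed
      show "(\<integral>\<^sup>+x. ennreal (2 * B m) * ennreal (w x) \<partial>lebesgue) < \<infinity>"
        by (simp add: nn_integral_cmult W ennreal_mult_less_top)
      show "AE x in lebesgue. (\<lambda>k. ennreal (w x * \<bar>a (m, c m x) (r1 k) - \<alpha> (m, c m x)\<bar>)) \<longlonglongrightarrow> 0"
      proof (intro AE_I2)
        fix x
        have "(\<lambda>k. w x * \<bar>a (m, c m x) (r1 k) - \<alpha> (m, c m x)\<bar>) \<longlonglongrightarrow> w x * \<bar>\<alpha> (m, c m x) - \<alpha> (m, c m x)\<bar>"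
          by (intro tendsto_intros lim)
        from tendsto_ennrealI[OF this]
        show "(\<lambda>k. ennreal (w x * \<bar>a (m, c m x) (r1 k) - \<alpha> (m, c m x)\<bar>)) \<longlonglongrightarrow> 0" by simp
      qed
    qed simp
    then show ?thesis by (simp add: E_def[abs_def])
  qed
  define F where "F m k = (\<integral>\<^sup>+x. ennreal (w x * \<bar>u (r1 k) x - \<alpha> (m, c m x)\<bar>) \<partial>lebesgue)" for m k
  have F: "F m k \<le> ennreal (d m powr s * b) + E m k" for m k
  proof -
    have "F m k \<le> (\<integral>\<^sup>+x. ennreal (w x * \<bar>u (r1 k) x - a (m, c m x) (r1 k)\<bar>)
        + ennreal (w x * \<bar>a (m, c m x) (r1 k) - \<alpha> (m, c m x)\<bar>) \<partial>lebesgue)"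
      unfolding F_def
    proof (intro nn_integral_mono)
      fix x
      have "w x * \<bar>u (r1 k) x - \<alpha> (m, c m x)\<bar>
          \<le> w x * (\<bar>u (r1 k) x - a (m, c m x) (r1 k)\<bar> + \<bar>a (m, c m x) (r1 k) - \<alpha> (m, c m x)\<bar>)"
        using w0' by (intro mult_left_mono) auto
      then have "ennreal (w x * \<bar>u (r1 k) x - \<alpha> (m, c m x)\<bar>)
          \<le> ennreal (w x * \<bar>u (r1 k) x - a (m, c m x) (r1 k)\<bar> + w x * \<bar>a (m, c m x) (r1 k) - \<alpha> (m, c m x)\<bar>)"
        by (intro ennreal_leI) (simp only: distrib_left)
      also have "\<dots> = ennreal (w x * \<bar>u (r1 k) x - a (m, c m x) (r1 k)\<bar>)
          + ennreal (w x * \<bar>a (m, c m x) (r1 k) - \<alpha> (m, c m x)\<bar>)"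
        using w0' by (intro ennreal_plus) auto
      finally show "ennreal (w x * \<bar>u (r1 k) x - \<alpha> (m, c m x)\<bar>)
          \<le> ennreal (w x * \<bar>u (r1 k) x - a (m, c m x) (r1 k)\<bar>)
          + ennreal (w x * \<bar>a (m, c m x) (r1 k) - \<alpha> (m, c m x)\<bar>)" .
    qed
    also have "\<dots> = (\<integral>\<^sup>+x. ennreal (w x * \<bar>u (r1 k) x - a (m, c m x) (r1 k)\<bar>) \<partial>lebesgue) + E m k"
      unfolding E_def by (rule nn_integral_add) measurable
    also have "(\<integral>\<^sup>+x. ennreal (w x * \<bar>u (r1 k) x - a (m, c m x) (r1 k)\<bar>) \<partial>lebesgue) \<le> ennreal (d m powr s * b)"
    proof -
      have "(\<integral>\<^sup>+x. ennreal (w x * \<bar>u (r1 k) x - tile_mean (c m) (u (r1 k)) (c m x)\<bar>) \<partial>lebesgue)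
          \<le> ennreal (d m powr s) * ennreal b"
        unfolding b[symmetric]
        by (rule young_tiling.weighted_oscillation_le[OF yt u mod assms(1) frac w w0' w1])
      then show ?thesis
        using b0 by (simp add: a_def ennreal_mult)
    qed
    finally show ?thesis by (simp add: add_right_mono)
  qed
  have int: "integrable lebesgue (\<lambda>x. w x * u k x)" for k
    by (rule weighted_integrable[OF u mod w w0' w1]) (simp add: W)
  have "\<exists>n. \<forall>i\<ge>n. \<forall>j\<ge>n. (LINT x|lebesgue. norm (w x * u (r1 i) x - w x * u (r1 j) x)) < e" if e: "0 < e" for e
  proof -
    have "(\<lambda>m. d m powr s * b) \<longlonglongrightarrow> 0 powr s * b"
    proof (intro tendsto_intros tendsto_powr2)
      show "d \<longlonglongrightarrow> 0"
        using LIMSEQ_inverse_real_of_nat by (simp add: d_def[abs_def] inverse_eq_divide)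
    qed (use \<open>0 < s\<close> d0 in \<open>auto simp: less_imp_le\<close>)
    \<comment> \<open>The mesh is fixed first, independently of \<open>k\<close>; only then is
      \<open>k\<close> taken so large that the means on this mesh are near their limits.\<close>
    then have "\<forall>\<^sub>F m in sequentially. d m powr s * b < e / 4"
      using e by (intro order_tendstoD(2)) auto
    then obtain m where m: "d m powr s * b < e / 4" by (auto simp: eventually_sequentially)
    have "\<forall>\<^sub>F k in sequentially. E m k < ennreal (e / 4)"
      using e by (intro order_tendstoD(2)[OF E]) auto
    then obtain n where n: "\<And>k. n \<le> k \<Longrightarrow> E m k < ennreal (e / 4)" by (auto simp: eventually_sequentially)
    have Fe: "F m k < ennreal (e / 2)" if "n \<le> k" for k
    proof -
      have "F m k \<le> ennreal (d m powr s * b) + E m k" by (rule F)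
      also have "\<dots> < ennreal (e / 4) + ennreal (e / 4)"
        using m n[OF that] e b0 by (intro add_strict_mono) (auto simp: ennreal_less_iff)
      also have "\<dots> = ennreal (e / 2)"
        using e by (simp add: ennreal_plus[symmetric] del: ennreal_plus)
      finally show ?thesis .
    qed
    have "(LINT x|lebesgue. norm (w x * u (r1 i) x - w x * u (r1 j) x)) < e" if "n \<le> i" "n \<le> j" for i j
    proof -
      have "ennreal (LINT x|lebesgue. norm (w x * u (r1 i) x - w x * u (r1 j) x))
          = (\<integral>\<^sup>+x. ennreal (norm (w x * u (r1 i) x - w x * u (r1 j) x)) \<partial>lebesgue)"
        by (intro nn_integral_eq_integral[symmetric] integrable_norm Bochner_Integration.integrable_diff int) auto
      also have "\<dots> \<le> (\<integral>\<^sup>+x. ennreal (w x * \<bar>u (r1 i) x - \<alpha> (m, c m x)\<bar>)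
          + ennreal (w x * \<bar>u (r1 j) x - \<alpha> (m, c m x)\<bar>) \<partial>lebesgue)"
      proof (intro nn_integral_mono)
        fix x
        have "norm (w x * u (r1 i) x - w x * u (r1 j) x) = w x * \<bar>u (r1 i) x - u (r1 j) x\<bar>"
          using w0'[of x] by (simp add: right_diff_distrib[symmetric] abs_mult)
        also have "\<dots> \<le> w x * (\<bar>u (r1 i) x - \<alpha> (m, c m x)\<bar> + \<bar>u (r1 j) x - \<alpha> (m, c m x)\<bar>)"
          using w0' by (intro mult_left_mono) auto
        finally have "ennreal (norm (w x * u (r1 i) x - w x * u (r1 j) x))
            \<le> ennreal (w x * \<bar>u (r1 i) x - \<alpha> (m, c m x)\<bar> + w x * \<bar>u (r1 j) x - \<alpha> (m, c m x)\<bar>)"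
          by (intro ennreal_leI) (simp only: distrib_left)
        also have "\<dots> = ennreal (w x * \<bar>u (r1 i) x - \<alpha> (m, c m x)\<bar>) + ennreal (w x * \<bar>u (r1 j) x - \<alpha> (m, c m x)\<bar>)"
          using w0' by (intro ennreal_plus) auto
        finally show "ennreal (norm (w x * u (r1 i) x - w x * u (r1 j) x))
            \<le> ennreal (w x * \<bar>u (r1 i) x - \<alpha> (m, c m x)\<bar>) + ennreal (w x * \<bar>u (r1 j) x - \<alpha> (m, c m x)\<bar>)" .
      qed
      also have "\<dots> = F m i + F m j"
        unfolding F_def by (rule nn_integral_add) measurable
      also have "\<dots> < ennreal (e / 2) + ennreal (e / 2)"
        using Fe that by (intro add_strict_mono)
      also have "\<dots> = ennreal e"
        using e by (simp add: ennreal_plus[symmetric] del: ennreal_plus)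
      finally show ?thesis
        using e by (subst (asm) ennreal_less_iff) auto
    qed
    then show ?thesis by blast
  qed
  then obtain r2 where r2: "strict_mono r2" "AE x in lebesgue. Cauchy (\<lambda>i. w x * u (r1 (r2 i)) x)"
    using cauchy_L1_AE_cauchy_subseq[of lebesgue "\<lambda>i x. w x * u (r1 i) x"] int by blast
  show ?thesis
  proof
    show "strict_mono (r1 \<circ> r2)" by (rule strict_mono_o[OF r1(1) r2(1)])
    show "AE x in lebesgue. convergent (\<lambda>k. u ((r1 \<circ> r2) k) x)"
      using r2(2)
    proof eventually_elim
      case (elim x)
      moreover have "w x \<noteq> 0" using w0[of x] by simp
      ultimately show ?case
        by (simp add: Cauchy_convergent_iff convergent_mult_const_iff)
    qed
  qed
qed

end

section \<open>Modulars, Luxemburg norms, and the embedding\<close>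

lemma luxemburg_nonneg:
  assumes "0 < c" "\<Phi> (\<lambda>x. u x / c) \<le> 1"
  shows "0 \<le> luxemburg \<Phi> u"
  unfolding luxemburg_def using assms by (intro cInf_greatest) auto

lemma luxemburg_le:
  assumes "0 < c" "\<Phi> (\<lambda>x. u x / c) \<le> 1"
  shows "luxemburg \<Phi> u \<le> c"
  unfolding luxemburg_def using assms by (intro cInf_lower bdd_belowI[of _ 0]) auto

text \<open>The witness \<open>b\<close> makes the infimum one of a nonempty set, so some admissible
  \<open>a\<close> lies below \<open>c\<close>; dividing by \<open>c\<close> instead of
  \<open>a\<close> only shrinks the function.\<close>

lemma luxemburg_less_imp:
  assumes shrink: "\<And>v l. 0 \<le> l \<Longrightarrow> l \<le> 1 \<Longrightarrow> \<Phi> (\<lambda>x. l * v x) \<le> \<Phi> v"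
    and ne: "0 < b" "\<Phi> (\<lambda>x. u x / b) \<le> 1" and c: "luxemburg \<Phi> u < c"
  shows "\<Phi> (\<lambda>x. u x / c) \<le> 1"
proof -
  obtain a where a: "0 < a" "\<Phi> (\<lambda>x. u x / a) \<le> 1" "a < c"
    using c ne unfolding luxemburg_def by (subst (asm) cInf_less_iff) (auto intro!: bdd_belowI[of _ 0])
  have "\<Phi> (\<lambda>x. a / c * (u x / a)) \<le> \<Phi> (\<lambda>x. u x / a)"
    using a by (intro shrink) auto
  then show ?thesis using a by simp
qed

text \<open>A finite modular \<open>m\<close> is brought to at most 1 by the factor
  \<open>1 / max 1 m\<close>; the maximum keeps the factor in the range where \<open>scale\<close>
  applies.\<close>

lemma ex_scale_le_one:
  assumes scale: "\<And>l. 0 \<le> l \<Longrightarrow> l \<le> 1 \<Longrightarrow> \<Phi> (\<lambda>x. l * (c * u x)) \<le> ennreal l * \<Phi> (\<lambda>x. c * u x)"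
    and c: "0 < c" "\<Phi> (\<lambda>x. c * u x) < \<infinity>"
  shows "\<exists>b>0. \<Phi> (\<lambda>x. u x / b) \<le> (1::ennreal)"
proof -
  obtain m where m: "\<Phi> (\<lambda>x. c * u x) = ennreal m" "0 \<le> m"
    using c by (cases "\<Phi> (\<lambda>x. c * u x)") auto
  define l where "l = 1 / max 1 m"
  have l: "0 < l" "l \<le> 1" by (auto simp: l_def)
  have "\<Phi> (\<lambda>x. l * (c * u x)) \<le> ennreal l * ennreal m"
    using scale[of l] l m by simp
  also have "\<dots> = ennreal (l * m)" using l m by (simp add: ennreal_mult)
  also have "\<dots> \<le> 1" using m by (simp add: l_def field_simps max_def)
  finally have "\<Phi> (\<lambda>x. u x / (1 / (l * c))) \<le> 1" by (simp add: mult.assoc mult.commute mult.left_commute)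
  then show ?thesis using l c by (intro exI[of _ "1 / (l * c)"]) simp
qed

text \<open>Iterated doubling. It will turn smallness of the modular into smallness of the
  norm.\<close>

lemma Delta2_power:
  assumes "Delta2 \<Psi>"
  obtains D where "0 < D" "\<And>t. 0 \<le> t \<Longrightarrow> \<Psi> (2 ^ j * t) \<le> D * \<Psi> t"
proof -
  obtain C where C: "0 < C" "\<And>t. 0 \<le> t \<Longrightarrow> \<Psi> (2 * t) \<le> C * \<Psi> t"
    using assms by (auto simp: Delta2_def)
  have "\<Psi> (2 ^ j * t) \<le> C ^ j * \<Psi> t" if "0 \<le> t" for t
  proof (induction j)
    case (Suc j)
    have "\<Psi> (2 * (2 ^ j * t)) \<le> C * \<Psi> (2 ^ j * t)" using that by (intro C) simp
    also have "\<dots> \<le> C * (C ^ j * \<Psi> t)" using C Suc by (intro mult_left_mono) auto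
    finally show ?case by (simp add: mult.assoc)
  qed simp
  then show ?thesis using C(1) by (intro that[of "C ^ j"]) auto
qed

section \<open>Convexity of the modulars\<close>

context young
begin

lemma modular_shrink:
  assumes "0 \<le> l" "l \<le> 1"
  shows "modular G (\<lambda>x. l * v x) \<le> modular G v"
  unfolding modular_def
  using assms by (intro nn_integral_mono ennreal_leI G_mono) (auto simp: abs_mult intro: mult_left_le_one_le)

lemma frac_quotient_mult: "frac_quotient s (\<lambda>x. l * v x) x y = l * frac_quotient s v x y"
  by (simp add: frac_quotient_def algebra_simps diff_divide_distrib)

lemma frac_modular_shrink:
  assumes "0 \<le> l" "l \<le> 1"
  shows "frac_modular s G (\<lambda>x. l * v x) \<le> frac_modular s G v"
  unfolding frac_modular_def frac_quotient_mult using assms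
  by (intro nn_integral_mono) (auto simp: abs_mult intro!: ennreal_leI divide_right_mono G_mono mult_left_le_one_le)

lemma modular_scale:
  assumes "v \<in> borel_measurable lebesgue" "0 \<le> l" "l \<le> 1"
  shows "modular G (\<lambda>x. l * v x) \<le> ennreal l * modular G v"
proof -
  have "modular G (\<lambda>x. l * v x) \<le> (\<integral>\<^sup>+x. ennreal l * ennreal (G \<bar>v x\<bar>) \<partial>lebesgue)"
    unfolding modular_def
    using assms by (intro nn_integral_mono)
      (auto simp: abs_mult ennreal_mult[symmetric] G_nonneg intro!: ennreal_leI G_scale)
  then show ?thesis
    using modular_measurable[OF assms(1)] by (simp add: modular_def nn_integral_cmult)
qed

lemma frac_modular_scale:
  fixes v :: "real^'n \<Rightarrow> real"
  assumes "v \<in> borel_measurable lebesgue" "0 \<le> l" "l \<le> 1"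
  shows "frac_modular s G (\<lambda>x. l * v x) \<le> ennreal l * frac_modular s G v"
proof -
  have "frac_modular s G (\<lambda>x. l * v x)
      \<le> (\<integral>\<^sup>+p. ennreal l * (case p of (x, y) \<Rightarrow> ennreal (G \<bar>frac_quotient s v x y\<bar> / norm (x - y) ^ CARD('n))) \<partial>lebesgue)"
    unfolding frac_modular_def frac_quotient_mult
  proof (intro nn_integral_mono, clarify)
    fix x y :: "real^'n"
    have "G \<bar>l * frac_quotient s v x y\<bar> / norm (x - y) ^ CARD('n)
        \<le> l * G \<bar>frac_quotient s v x y\<bar> / norm (x - y) ^ CARD('n)"
      using assms by (intro divide_right_mono) (auto simp: abs_mult intro!: G_scale)
    then show "ennreal (G \<bar>l * frac_quotient s v x y\<bar> / norm (x - y) ^ CARD('n))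
        \<le> ennreal l * ennreal (G \<bar>frac_quotient s v x y\<bar> / norm (x - y) ^ CARD('n))"
      using assms by (simp add: ennreal_mult[symmetric] G_nonneg ennreal_leI)
  qed
  also have "\<dots> = ennreal l * frac_modular s G v"
    unfolding frac_modular_def by (rule nn_integral_cmult[OF frac_modular_measurable[OF assms(1)]])
  finally show ?thesis .
qed

lemma orlicz_space_ex:
  assumes "u \<in> orlicz_space G"
  shows "u \<in> borel_measurable lebesgue" "\<exists>b>0. modular G (\<lambda>x. u x / b) \<le> 1"
proof -
  show u: "u \<in> borel_measurable lebesgue" using assms by (simp add: orlicz_space_def)
  obtain c where c: "0 < c" "modular G (\<lambda>x. c * u x) < \<infinity>" using assms by (auto simp: orlicz_space_def)
  show "\<exists>b>0. modular G (\<lambda>x. u x / b) \<le> 1"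
    using u by (intro ex_scale_le_one[of "modular G" c u, OF modular_scale c]) auto
qed

text \<open>Both Luxemburg functionals are nonnegative, so a sum below \<open>c\<close> puts each of
  them strictly below \<open>c\<close>.\<close>

lemma
  assumes u: "u \<in> frac_orlicz_sobolev s G"
  shows frac_orlicz_sobolev_norm_nonneg: "0 \<le> frac_orlicz_sobolev_norm s G u"
    and norm_less_imp_modular_le: "frac_orlicz_sobolev_norm s G u < c \<Longrightarrow> modular G (\<lambda>x. u x / c) \<le> 1"
    and norm_less_imp_frac_modular_le: "frac_orlicz_sobolev_norm s G u < c \<Longrightarrow> frac_modular s G (\<lambda>x. u x / c) \<le> 1"
proof -
  have o: "u \<in> orlicz_space G" using u by (simp add: frac_orlicz_sobolev_def)
  note um = orlicz_space_ex(1)[OF o]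
  obtain b where b: "0 < b" "modular G (\<lambda>x. u x / b) \<le> 1" using orlicz_space_ex(2)[OF o] by auto
  obtain c' where c': "0 < c'" "frac_modular s G (\<lambda>x. c' * u x) < \<infinity>"
    using u by (auto simp: frac_orlicz_sobolev_def)
  have "\<exists>b>0. frac_modular s G (\<lambda>x. u x / b) \<le> 1"
    using um by (intro ex_scale_le_one[of "frac_modular s G" c' u, OF frac_modular_scale c']) auto
  then obtain b' where b': "0 < b'" "frac_modular s G (\<lambda>x. u x / b') \<le> 1" by auto
  have n: "0 \<le> orlicz_norm G u" "0 \<le> frac_seminorm s G u"
    unfolding orlicz_norm_def frac_seminorm_def
    by (rule luxemburg_nonneg[of b "modular G" u, OF b])
      (rule luxemburg_nonneg[of b' "frac_modular s G" u, OF b'])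
  then show "0 \<le> frac_orlicz_sobolev_norm s G u" by (simp add: frac_orlicz_sobolev_norm_def)
  assume c: "frac_orlicz_sobolev_norm s G u < c"
  show "modular G (\<lambda>x. u x / c) \<le> 1"
    by (rule luxemburg_less_imp[of "modular G" b u, OF modular_shrink b])
      (use n c in \<open>auto simp: frac_orlicz_sobolev_norm_def orlicz_norm_def\<close>)
  show "frac_modular s G (\<lambda>x. u x / c) \<le> 1"
    by (rule luxemburg_less_imp[of "frac_modular s G" b' u, OF frac_modular_shrink b'])
      (use n c in \<open>auto simp: frac_orlicz_sobolev_norm_def frac_seminorm_def\<close>)
qed

lemma modular_half_diff:
  assumes u: "u \<in> borel_measurable lebesgue" and v: "v \<in> borel_measurable lebesgue"
  shows "modular G (\<lambda>x. (u x - v x) / 2) \<le> (modular G u + modular G v) / 2"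
proof -
  have "modular G (\<lambda>x. (u x - v x) / 2) \<le> (\<integral>\<^sup>+x. (ennreal (G \<bar>u x\<bar>) + ennreal (G \<bar>v x\<bar>)) / 2 \<partial>lebesgue)"
    unfolding modular_def
  proof (intro nn_integral_mono)
    fix x
    have "ennreal (G \<bar>(u x - v x) / 2\<bar>) \<le> ennreal ((G \<bar>u x\<bar> + G \<bar>v x\<bar>) / 2)"
      by (intro ennreal_leI G_abs_half_diff)
    also have "\<dots> = (ennreal (G \<bar>u x\<bar>) + ennreal (G \<bar>v x\<bar>)) / 2"
      by (simp add: G_nonneg ennreal_plus divide_ennreal[symmetric])
    finally show "ennreal (G \<bar>(u x - v x) / 2\<bar>) \<le> (ennreal (G \<bar>u x\<bar>) + ennreal (G \<bar>v x\<bar>)) / 2" .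
  qed
  also have "\<dots> = (modular G u + modular G v) / 2"
    using modular_measurable[OF u] modular_measurable[OF v]
    by (simp add: modular_def nn_integral_add nn_integral_divide)
  finally show ?thesis .
qed

lemma frac_modular_half_diff:
  fixes u v :: "real^'n \<Rightarrow> real"
  assumes u: "u \<in> borel_measurable lebesgue" and v: "v \<in> borel_measurable lebesgue"
  shows "frac_modular s G (\<lambda>x. (u x - v x) / 2) \<le> (frac_modular s G u + frac_modular s G v) / 2"
proof -
  let ?f = "\<lambda>u (x :: real^'n, y). ennreal (G \<bar>frac_quotient s u x y\<bar> / norm (x - y) ^ CARD('n))"
  have q: "frac_quotient s (\<lambda>x. (u x - v x) / 2) x y = (frac_quotient s u x y - frac_quotient s v x y) / 2" for x y
    by (simp add: frac_quotient_def diff_divide_distrib)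
  have "frac_modular s G (\<lambda>x. (u x - v x) / 2) \<le> (\<integral>\<^sup>+p. (?f u p + ?f v p) / 2 \<partial>lebesgue)"
    unfolding frac_modular_def q
  proof (intro nn_integral_mono, clarify)
    fix x y :: "real^'n"
    let ?a = "frac_quotient s u x y" and ?b = "frac_quotient s v x y" and ?n = "norm (x - y) ^ CARD('n)"
    have "ennreal (G \<bar>(?a - ?b) / 2\<bar> / ?n) \<le> ennreal ((G \<bar>?a\<bar> / ?n + G \<bar>?b\<bar> / ?n) / 2)"
      using divide_right_mono[OF G_abs_half_diff[of ?a ?b], of ?n]
      by (intro ennreal_leI) (simp add: add_divide_distrib)
    also have "\<dots> = (ennreal (G \<bar>?a\<bar> / ?n) + ennreal (G \<bar>?b\<bar> / ?n)) / 2"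
      by (simp add: G_nonneg ennreal_plus divide_ennreal[symmetric])
    finally show "ennreal (G \<bar>(?a - ?b) / 2\<bar> / ?n) \<le> (ennreal (G \<bar>?a\<bar> / ?n) + ennreal (G \<bar>?b\<bar> / ?n)) / 2" .
  qed
  also have "\<dots> = (frac_modular s G u + frac_modular s G v) / 2"
    using frac_modular_measurable[OF u, of s] frac_modular_measurable[OF v, of s]
    unfolding frac_modular_def by (subst nn_integral_divide) (simp_all add: nn_integral_add)
  finally show ?thesis .
qed

end

section \<open>Domination of the target modular and the continuous embedding\<close>

locale orlicz_embedding = young_frac_sobolev G g s dim + P: young \<Psi> \<psi>
  for G g s and dim :: "'n::finite itself" and \<Psi> \<psi> +
  assumes near_zero: "((\<lambda>t. \<Psi> \<bar>t\<bar> / G \<bar>t\<bar>) \<longlongrightarrow> 0) (at 0)"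
    and slower: "\<Psi> \<prec>\<prec> Gs"
begin

text \<open>Three ranges of values: small ones are compared with \<open>G\<close>, large ones with
  \<open>Gs\<close> and hence, by the pointwise Sobolev estimate, with the energy; in between,
  \<Psi> is bounded by a constant on a superlevel set.\<close>

lemma pointwise_bound:
  assumes \<delta>: "0 < \<delta>"
  obtains a B where "0 < a" "0 \<le> B"
    "\<And>u x. u \<in> borel_measurable lebesgue \<Longrightarrow> modular G u \<le> 1 \<Longrightarrow> frac_modular s G u \<le> 1 \<Longrightarrow>
      ennreal (\<Psi> \<bar>u x\<bar>) \<le> ennreal \<delta> * ennreal (G \<bar>u x\<bar>) + ennreal \<delta> * energy s G u (x :: real^'n)
        + ennreal B * indicator {x. a < \<bar>u x\<bar>} x"
proof -
  have "\<forall>\<^sub>F t in at 0. \<Psi> \<bar>t\<bar> / G \<bar>t\<bar> < \<delta>"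
    by (rule order_tendstoD(2)[OF near_zero \<delta>])
  then obtain a where a: "0 < a" "\<And>t. t \<noteq> 0 \<Longrightarrow> \<bar>t\<bar> < a \<Longrightarrow> \<Psi> \<bar>t\<bar> / G \<bar>t\<bar> < \<delta>"
    unfolding eventually_at by (auto simp: dist_real_def)
  have low: "\<Psi> t \<le> \<delta> * G t" if "0 \<le> t" "t \<le> a / 2" for t
  proof (cases "t = 0")
    case False
    then have "\<Psi> t / G t < \<delta>" using a(2)[of t] that a(1) by simp
    then show ?thesis using G_pos[of t] that False by (simp add: pos_divide_less_eq)
  qed (simp add: P.G_zero G_zero)
  \<comment> \<open>The dilation \<open>4 * K\<close> is the one occurring in
    \<open>energy_ge_sobolev_conj\<close>.\<close>
  have "((\<lambda>T. \<Psi> (4 * K * T) / Gs T) \<longlongrightarrow> 0) at_top"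
    using slower K_pos by (simp add: essentially_slower_def)
  then have "\<forall>\<^sub>F T in at_top. \<Psi> (4 * K * T) / Gs T < \<delta> * (V / 2)"
    using \<delta> V_pos by (intro order_tendstoD(2)) auto
  then obtain T0 where T0: "\<And>T. T0 \<le> T \<Longrightarrow> \<Psi> (4 * K * T) / Gs T < \<delta> * (V / 2)"
    by (auto simp: eventually_at_top_linorder)
  \<comment> \<open>The maximum with 1 keeps the argument of \<open>Gs\<close> positive, so that one
    can multiply by its value.\<close>
  define b where "b = 4 * K * max 1 T0"
  have b: "0 < b" using K_pos by (simp add: b_def)
  have high: "\<Psi> t \<le> \<delta> * (V / 2 * Gs (t / (4 * K)))" if "b \<le> t" for t
  proof -
    have T: "max 1 T0 \<le> t / (4 * K)"
    proof -
      have "0 < 4 * K" using K_pos by simp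
      show ?thesis
        using that unfolding b_def pos_le_divide_eq[OF \<open>0 < 4 * K\<close>] by (simp only: mult.commute)
    qed
    have "\<Psi> (4 * K * (t / (4 * K))) / Gs (t / (4 * K)) < \<delta> * (V / 2)"
      using T by (intro T0) simp
    moreover have "0 < Gs (t / (4 * K))" using T by (intro Gs_pos) linarith
    ultimately show ?thesis
      using K_pos by (simp add: pos_divide_less_eq algebra_simps)
  qed
  show ?thesis
  proof
    show "0 < a / 2" "0 \<le> \<Psi> b" using a b by (simp_all add: P.G_nonneg)
    fix u :: "real^'n \<Rightarrow> real" and x :: "real^'n"
    assume u: "u \<in> borel_measurable lebesgue" "modular G u \<le> 1" "frac_modular s G u \<le> 1"
    define t where "t = \<bar>u x\<bar>"
    have t: "0 \<le> t" by (simp add: t_def)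
    let ?R1 = "ennreal \<delta> * ennreal (G t)" and ?R2 = "ennreal \<delta> * energy s G u x"
      and ?R3 = "ennreal (\<Psi> b) * indicator {x. a / 2 < \<bar>u x\<bar>} x"
    have le: "?R1 \<le> ?R1 + ?R2 + ?R3" "?R2 \<le> ?R1 + ?R2 + ?R3" "?R3 \<le> ?R1 + ?R2 + ?R3"
      by (simp_all add: add_increasing add_increasing2)
    consider "t \<le> a / 2" | "a / 2 < t" "t \<le> b" | "b \<le> t" by linarith
    then have "ennreal (\<Psi> t) \<le> ?R1 + ?R2 + ?R3"
    proof cases
      case 1
      then have "ennreal (\<Psi> t) \<le> ennreal (\<delta> * G t)" using low t by (intro ennreal_leI) auto
      also have "\<dots> = ?R1" using \<delta> t by (intro ennreal_mult) (auto simp: G_nonneg)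
      finally show ?thesis using le(1) by (rule order_trans)
    next
      case 2
      then have "ennreal (\<Psi> t) \<le> ?R3" using t by (auto simp: t_def intro!: ennreal_leI P.G_mono)
      then show ?thesis using le(3) by (rule order_trans)
    next
      case 3
      then have "ennreal (\<Psi> t) \<le> ennreal (\<delta> * (V / 2 * Gs (t / (4 * K))))"
        by (intro ennreal_leI high)
      also have "\<dots> = ennreal \<delta> * ennreal (V / 2 * Gs (t / (4 * K)))"
        using \<delta> V_pos K_pos t by (intro ennreal_mult) (auto intro!: Gs_nonneg mult_nonneg_nonneg)
      also have "\<dots> \<le> ?R2"
        unfolding t_def using u by (intro mult_left_mono energy_ge_sobolev_conj) (auto intro: le_less_trans)
      finally show ?thesis using le(2) by (rule order_trans)
    qed
    then show "ennreal (\<Psi> \<bar>u x\<bar>) \<le> ennreal \<delta> * ennreal (G \<bar>u x\<bar>) + ennreal \<delta> * energy s G u x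
        + ennreal (\<Psi> b) * indicator {x. a / 2 < \<bar>u x\<bar>} x"
      by (simp only: t_def)
  qed
qed

text \<open>Integrate the pointwise bound: the modular of \<open>G\<close> and the total energy each
  contribute at most \<delta>, and the measure of one superlevel set remains.\<close>

lemma modular_bound:
  assumes \<delta>: "0 < \<delta>"
  obtains a B where "0 < a" "0 \<le> B"
    "\<And>u :: real^'n \<Rightarrow> real. u \<in> borel_measurable lebesgue \<Longrightarrow> modular G u \<le> 1 \<Longrightarrow> frac_modular s G u \<le> 1 \<Longrightarrow>
      modular \<Psi> u \<le> ennreal (2 * \<delta>) + ennreal B * emeasure lebesgue {x. a < \<bar>u x\<bar>}"
proof -
  obtain a B where a: "0 < a" "0 \<le> B"
    "\<And>u x. u \<in> borel_measurable lebesgue \<Longrightarrow> modular G u \<le> 1 \<Longrightarrow> frac_modular s G u \<le> 1 \<Longrightarrow>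
      ennreal (\<Psi> \<bar>u x\<bar>) \<le> ennreal \<delta> * ennreal (G \<bar>u x\<bar>) + ennreal \<delta> * energy s G u (x :: real^'n)
        + ennreal B * indicator {x. a < \<bar>u x\<bar>} x"
    using pointwise_bound[OF \<delta>] by metis
  show ?thesis
  proof (rule that[OF a(1,2)])
    fix u :: "real^'n \<Rightarrow> real"
    assume u: "u \<in> borel_measurable lebesgue" "modular G u \<le> 1" "frac_modular s G u \<le> 1"
    note [measurable] = modular_measurable[OF u(1)] energy_measurable[OF u(1), of s] level_measurable[OF u(1), of a]
    have "modular \<Psi> u \<le> (\<integral>\<^sup>+x. ennreal \<delta> * ennreal (G \<bar>u x\<bar>) + ennreal \<delta> * energy s G u x
        + ennreal B * indicator {x. a < \<bar>u x\<bar>} x \<partial>lebesgue)"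
      unfolding modular_def[of \<Psi>] by (intro nn_integral_mono a u)
    also have "\<dots> = ennreal \<delta> * modular G u + ennreal \<delta> * frac_modular s G u
        + ennreal B * emeasure lebesgue {x. a < \<bar>u x\<bar>}"
      unfolding modular_def frac_modular_eq[OF u(1)]
      by (simp add: nn_integral_add nn_integral_cmult nn_integral_cmult_indicator level_measurable[OF u(1)]
          del: emeasure_completion)
    also have "\<dots> \<le> ennreal \<delta> * 1 + ennreal \<delta> * 1 + ennreal B * emeasure lebesgue {x. a < \<bar>u x\<bar>}"
      by (intro add_right_mono add_mono mult_left_mono u) auto
    also have "ennreal \<delta> * 1 + ennreal \<delta> * 1 = ennreal (2 * \<delta>)"
      using \<delta> by (simp add: ennreal_plus[symmetric] del: ennreal_plus)
    finally show "modular \<Psi> u \<le> ennreal (2 * \<delta>) + ennreal B * emeasure lebesgue {x. a < \<bar>u x\<bar>}" .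
  qed
qed

text \<open>The case \<delta> = 1, with the superlevel set estimated by Chebyshev.\<close>

lemma modular_bounded:
  obtains L where "1 \<le> L"
    "\<And>u :: real^'n \<Rightarrow> real. u \<in> borel_measurable lebesgue \<Longrightarrow> modular G u \<le> 1 \<Longrightarrow> frac_modular s G u \<le> 1 \<Longrightarrow>
      modular \<Psi> u \<le> ennreal L"
proof -
  obtain a B where a: "0 < a" "0 \<le> B"
    "\<And>u :: real^'n \<Rightarrow> real. u \<in> borel_measurable lebesgue \<Longrightarrow> modular G u \<le> 1 \<Longrightarrow> frac_modular s G u \<le> 1 \<Longrightarrow>
      modular \<Psi> u \<le> ennreal (2 * 1) + ennreal B * emeasure lebesgue {x. a < \<bar>u x\<bar>}"
    using modular_bound[of 1] by auto
  have Ga: "0 < G a" using a by (simp add: G_pos)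
  show ?thesis
  proof (rule that)
    show "1 \<le> 2 + B * (1 / G a)" using a Ga by (simp add: add_increasing2)
    fix u :: "real^'n \<Rightarrow> real"
    assume u: "u \<in> borel_measurable lebesgue" "modular G u \<le> 1" "frac_modular s G u \<le> 1"
    have *: "ennreal (G a) * emeasure lebesgue {x. a < \<bar>u x\<bar>} \<le> 1"
      using emeasure_level_le[OF u(1), of a] u(2) a(1) by (meson less_imp_le order_trans)
    have "emeasure lebesgue {x. a < \<bar>u x\<bar>} = ennreal (1 / G a) * (ennreal (G a) * emeasure lebesgue {x. a < \<bar>u x\<bar>})"
      using Ga by (simp add: mult.assoc[symmetric] ennreal_mult[symmetric] del: emeasure_completion)
    also have "\<dots> \<le> ennreal (1 / G a)"
      using mult_left_mono[OF *, of "ennreal (1 / G a)"] by simp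
    finally have "ennreal B * emeasure lebesgue {x. a < \<bar>u x\<bar>} \<le> ennreal B * ennreal (1 / G a)"
      by (intro mult_left_mono) auto
    then have "modular \<Psi> u \<le> ennreal (2 * 1) + ennreal B * ennreal (1 / G a)"
      using a(3)[OF u] by (meson add_left_mono order_trans)
    also have "\<dots> = ennreal (2 + B * (1 / G a))"
    proof -
      have "0 \<le> 1 / G a" using Ga by simp
      then show ?thesis
        using a(2) by (simp only: ennreal_plus ennreal_mult mult_nonneg_nonneg mult_1_right zero_le_numeral)
    qed
    finally show "modular \<Psi> u \<le> ennreal (2 + B * (1 / G a))" .
  qed
qed

text \<open>For \<open>c\<close> above the norm, both modulars of \<open>u / c\<close> are at most 1
  and the modular of \<Psi> is at most \<open>L\<close>. Convexity trades this for a division by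
  \<open>L\<close>, so \<open>L * c\<close> is admissible for the norm of the target.\<close>

lemma embedding:
  "\<exists>L. \<forall>u :: real^'n \<Rightarrow> real. u \<in> frac_orlicz_sobolev s G \<longrightarrow>
    u \<in> orlicz_space \<Psi> \<and> orlicz_norm \<Psi> u \<le> L * frac_orlicz_sobolev_norm s G u"
proof -
  obtain L where L: "1 \<le> L"
    "\<And>u :: real^'n \<Rightarrow> real. u \<in> borel_measurable lebesgue \<Longrightarrow> modular G u \<le> 1 \<Longrightarrow> frac_modular s G u \<le> 1 \<Longrightarrow>
      modular \<Psi> u \<le> ennreal L"
    using modular_bounded by metis
  have main: "modular \<Psi> (\<lambda>x. u x / (L * c)) \<le> 1" "0 < L * c" "u \<in> borel_measurable lebesgue"
    if u: "u \<in> frac_orlicz_sobolev s G" and c: "frac_orlicz_sobolev_norm s G u < c"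
    for u :: "real^'n \<Rightarrow> real" and c
  proof -
    have c0: "0 < c" using frac_orlicz_sobolev_norm_nonneg[OF u] c by linarith
    show "0 < L * c" using L c0 by simp
    show um: "u \<in> borel_measurable lebesgue"
      using u by (simp add: frac_orlicz_sobolev_def orlicz_space_def)
    have ucm: "(\<lambda>x. u x / c) \<in> borel_measurable lebesgue" using um by measurable
    have "modular \<Psi> (\<lambda>x. 1 / L * (u x / c)) \<le> ennreal (1 / L) * modular \<Psi> (\<lambda>x. u x / c)"
      using L by (intro P.modular_scale[OF ucm]) auto
    also have "\<dots> \<le> ennreal (1 / L) * ennreal L"
      by (intro mult_left_mono L ucm norm_less_imp_modular_le[OF u c] norm_less_imp_frac_modular_le[OF u c]) simp
    also have "\<dots> = 1" using L by (simp add: ennreal_mult[symmetric])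
    finally show "modular \<Psi> (\<lambda>x. u x / (L * c)) \<le> 1" by simp
  qed
  show ?thesis
  proof (intro exI[of _ L] allI impI conjI)
    fix u :: "real^'n \<Rightarrow> real" assume u: "u \<in> frac_orlicz_sobolev s G"
    define c where "c = frac_orlicz_sobolev_norm s G u + 1"
    have c: "frac_orlicz_sobolev_norm s G u < c" by (simp add: c_def)
    have "modular \<Psi> (\<lambda>x. 1 / (L * c) * u x) < \<infinity>"
      using main(1)[OF u c] by (simp add: le_less_trans[OF _ ennreal_one_less_top])
    then show "u \<in> orlicz_space \<Psi>"
      unfolding orlicz_space_def using main(2,3)[OF u c] by (auto intro!: exI[of _ "1 / (L * c)"])
    have le: "orlicz_norm \<Psi> u \<le> L * c'" if "frac_orlicz_sobolev_norm s G u < c'" for c'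
      unfolding orlicz_norm_def by (rule luxemburg_le[of _ "modular \<Psi>" u, OF main(2,1)[OF u that]])
    have "orlicz_norm \<Psi> u / L \<le> c'" if "frac_orlicz_sobolev_norm s G u < c'" for c'
      using le[OF that] L by (simp add: pos_divide_le_eq mult.commute)
    \<comment> \<open>Let \<open>c'\<close> decrease to the norm, which may be 0 and so cannot be
      used as a divisor.\<close>
    then have "orlicz_norm \<Psi> u / L \<le> frac_orlicz_sobolev_norm s G u"
      by (rule dense_ge)
    then show "orlicz_norm \<Psi> u \<le> L * frac_orlicz_sobolev_norm s G u"
      using L by (simp add: pos_divide_le_eq mult.commute)
  qed
qed

section \<open>Convergence in modular and in norm\<close>

text \<open>By \<open>modular_bound\<close> only the sets where two members differ by more than
  \<open>a\<close> matter. Outside a large ball \<open>radial_tail\<close> applies to the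
  difference; inside, one of the two members is more than \<open>a / 2\<close> away from the limit,
  which by dominated convergence happens on small sets only.\<close>

lemma modular_Cauchy:
  fixes p :: "nat \<Rightarrow> real^'n \<Rightarrow> real"
  assumes dim: "2 \<le> CARD('n)"
    and p: "\<And>k. p k \<in> borel_measurable lebesgue"
    and radial: "\<And>k x y. norm x = norm y \<Longrightarrow> p k x = p k y"
    and mod: "\<And>k l. modular G (\<lambda>x. p k x - p l x) \<le> 1"
    and frac: "\<And>k l. frac_modular s G (\<lambda>x. p k x - p l x) \<le> 1"
    and conv: "AE x in lebesgue. convergent (\<lambda>k. p k x)" and \<epsilon>: "0 < \<epsilon>"
  shows "\<exists>n. \<forall>k\<ge>n. \<forall>l\<ge>n. modular \<Psi> (\<lambda>x. p k x - p l x) \<le> ennreal \<epsilon>"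
proof -
  note [measurable] = p
  obtain a B where a: "0 < a" "0 \<le> B"
    "\<And>u :: real^'n \<Rightarrow> real. u \<in> borel_measurable lebesgue \<Longrightarrow> modular G u \<le> 1 \<Longrightarrow> frac_modular s G u \<le> 1 \<Longrightarrow>
      modular \<Psi> u \<le> ennreal (2 * (\<epsilon> / 4)) + ennreal B * emeasure lebesgue {x. a < \<bar>u x\<bar>}"
    using modular_bound[of "\<epsilon> / 4"] \<epsilon> by auto
  \<comment> \<open>Three sets of measure at most \<eta> contribute at most half of \<epsilon> after
    multiplication by \<open>B\<close>; adding 1 covers \<open>B = 0\<close>.\<close>
  define \<eta> where "\<eta> = \<epsilon> / (6 * (B + 1))"
  have \<eta>: "0 < \<eta>" using \<epsilon> a by (simp add: \<eta>_def)
  obtain R where R: "\<And>u :: real^'n \<Rightarrow> real. u \<in> borel_measurable lebesgue \<Longrightarrow>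
    (\<And>x y. norm x = norm y \<Longrightarrow> u x = u y) \<Longrightarrow> modular G u \<le> 1 \<Longrightarrow> frac_modular s G u \<le> 1 \<Longrightarrow>
    emeasure lebesgue ({x. a < \<bar>u x\<bar>} - ball 0 R) \<le> ennreal \<eta>"
    using radial_tail[OF dim s_pos a(1) \<eta>] by metis
  define v where "v x = lim (\<lambda>k. p k x)" for x
  have v [measurable]: "v \<in> borel_measurable lebesgue"
    unfolding v_def by (rule borel_measurable_lim_metric) (rule p)
  define D where "D k = {x. a / 2 < \<bar>p k x - v x\<bar>} \<inter> ball 0 R" for k
  have Dm: "D k \<in> sets lebesgue" for k
  proof -
    have "{x. a / 2 < \<bar>p k x - v x\<bar>} \<in> sets lebesgue"
      by (rule level_measurable) measurable
    then show ?thesis unfolding D_def by auto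
  qed
  have D: "(\<lambda>k. emeasure lebesgue (D k)) \<longlonglongrightarrow> 0"
  proof -
    have "(\<lambda>k. \<integral>\<^sup>+x. indicator (D k) x \<partial>lebesgue) \<longlonglongrightarrow> (\<integral>\<^sup>+x. 0 \<partial>(lebesgue :: (real^'n) measure))"
    proof (rule nn_integral_dominated_convergence[where w = "indicator (ball 0 R)"])
      show "(\<integral>\<^sup>+x. indicator (ball 0 R) x \<partial>(lebesgue :: (real^'n) measure)) < \<infinity>"
        using emeasure_lborel_ball_finite[of "0 :: real^'n" R] by simp
      show "AE x in lebesgue. indicator (D k) x \<le> (indicator (ball 0 R) x :: ennreal)" for k
        by (auto simp: D_def indicator_def)
      show "AE x in lebesgue. (\<lambda>k. indicator (D k) x :: ennreal) \<longlonglongrightarrow> 0"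
        using conv
      proof eventually_elim
        case (elim x)
        then have "(\<lambda>k. p k x) \<longlonglongrightarrow> v x" by (simp add: v_def convergent_LIMSEQ_iff)
        then have "\<forall>\<^sub>F k in sequentially. dist (p k x) (v x) < a / 2"
          using a(1) by (intro tendstoD) auto
        then have "\<forall>\<^sub>F k in sequentially. (indicator (D k) x :: ennreal) = 0"
          by eventually_elim (auto simp: D_def dist_real_def)
        then show ?case by (rule tendsto_eventually)
      qed
      show "indicator (D k) \<in> borel_measurable lebesgue" for k using Dm by simp
      show "indicator (ball 0 R) \<in> borel_measurable (lebesgue :: (real^'n) measure)"
        by (intro borel_measurable_indicator) simp
    qed simp
    then show ?thesis using Dm by (simp del: emeasure_completion)
  qed
  have "\<forall>\<^sub>F k in sequentially. emeasure lebesgue (D k) < ennreal \<eta>"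
    using \<eta> by (intro order_tendstoD(2)[OF D]) auto
  then obtain n where n: "\<And>k. n \<le> k \<Longrightarrow> emeasure lebesgue (D k) < ennreal \<eta>"
    by (auto simp: eventually_sequentially)
  have "modular \<Psi> (\<lambda>x. p k x - p l x) \<le> ennreal \<epsilon>" if kl: "n \<le> k" "n \<le> l" for k l
  proof -
    let ?u = "\<lambda>x. p k x - p l x"
    let ?T = "{x. a < \<bar>?u x\<bar>} - ball 0 R"
    have um: "?u \<in> borel_measurable lebesgue" by measurable
    have Tm: "?T \<in> sets lebesgue" using level_measurable[OF um, of a] by auto
    have "emeasure lebesgue {x. a < \<bar>?u x\<bar>} \<le> emeasure lebesgue (?T \<union> (D k \<union> D l))"
    proof (rule emeasure_mono)
      show "{x. a < \<bar>?u x\<bar>} \<subseteq> ?T \<union> (D k \<union> D l)"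
      proof
        fix x assume "x \<in> {x. a < \<bar>?u x\<bar>}"
        then have "a < \<bar>p k x - p l x\<bar>" by simp
        then have "a / 2 < \<bar>p k x - v x\<bar> \<or> a / 2 < \<bar>p l x - v x\<bar>" by linarith
        then show "x \<in> ?T \<union> (D k \<union> D l)" using \<open>a < _\<close> by (auto simp: D_def)
      qed
      show "?T \<union> (D k \<union> D l) \<in> sets lebesgue" using Tm Dm by auto
    qed
    also have "\<dots> \<le> emeasure lebesgue ?T + emeasure lebesgue (D k \<union> D l)"
      using Tm Dm by (intro emeasure_subadditive) auto
    also have "\<dots> \<le> emeasure lebesgue ?T + (emeasure lebesgue (D k) + emeasure lebesgue (D l))"
      using Dm by (intro add_left_mono emeasure_subadditive) auto
    also have "\<dots> \<le> ennreal \<eta> + (ennreal \<eta> + ennreal \<eta>)"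
    proof (intro add_mono)
      show "emeasure lebesgue ?T \<le> ennreal \<eta>"
      proof (rule R[OF um _ mod frac])
        show "p k x - p l x = p k y - p l y" if "norm x = norm y" for x y
          using radial[OF that, of k] radial[OF that, of l] by simp
      qed
    qed (use n kl in \<open>auto simp: less_imp_le simp del: emeasure_completion\<close>)
    also have "\<dots> = ennreal (3 * \<eta>)"
      using \<eta> by (simp add: ennreal_plus[symmetric] del: ennreal_plus)
    finally have "ennreal B * emeasure lebesgue {x. a < \<bar>?u x\<bar>} \<le> ennreal B * ennreal (3 * \<eta>)"
      by (intro mult_left_mono) auto
    also have "\<dots> = ennreal (B * (3 * \<eta>))"
      using a \<eta> by (intro ennreal_mult[symmetric]) auto
    also have "\<dots> \<le> ennreal (\<epsilon> / 2)"
      using a \<epsilon> by (intro ennreal_leI) (simp add: \<eta>_def field_simps)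
    finally have "modular \<Psi> ?u \<le> ennreal (2 * (\<epsilon> / 4)) + ennreal (\<epsilon> / 2)"
      using a(3)[OF um mod frac] by (meson add_left_mono order_trans)
    also have "\<dots> = ennreal \<epsilon>"
      using \<epsilon> by (simp add: ennreal_plus[symmetric] del: ennreal_plus)
    finally show ?thesis .
  qed
  then show ?thesis by blast
qed

text \<open>After normalization the modulars are at most 1, an almost everywhere convergent
  subsequence exists, and it is Cauchy in modular. Fatou's lemma replaces one member by the limit,
  and the doubling condition upgrades modular to norm convergence.\<close>

lemma compactness:
  fixes u :: "nat \<Rightarrow> real^'n \<Rightarrow> real"
  assumes dim: "2 \<le> CARD('n)" and \<Delta>: "Delta2 \<Psi>"
    and u: "\<And>k. u k \<in> frac_orlicz_sobolev s G" and radial: "\<And>k x y. norm x = norm y \<Longrightarrow> u k x = u k y"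
    and M: "\<And>k. frac_orlicz_sobolev_norm s G (u k) \<le> M"
  shows "\<exists>v\<in>orlicz_space \<Psi>. \<exists>r. strict_mono r \<and> (\<lambda>k. orlicz_norm \<Psi> (u (r k) - v)) \<longlonglongrightarrow> 0"
proof -
  define c where "c = M + 1"
  have c: "frac_orlicz_sobolev_norm s G (u k) < c" for k using M[of k] by (simp add: c_def)
  have c0: "0 < c" by (rule le_less_trans[OF frac_orlicz_sobolev_norm_nonneg[OF u] c])
  have um [measurable]: "u k \<in> borel_measurable lebesgue" for k
    using u by (auto simp: frac_orlicz_sobolev_def orlicz_space_def)
  have ucm [measurable]: "(\<lambda>x. u k x / c) \<in> borel_measurable lebesgue" for k by measurable
  have mod: "modular G (\<lambda>x. u k x / c) \<le> 1" and frac: "frac_modular s G (\<lambda>x. u k x / c) \<le> 1" for k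
    by (rule norm_less_imp_modular_le[OF u c], rule norm_less_imp_frac_modular_le[OF u c])
  obtain r where r: "strict_mono r" "AE x in lebesgue. convergent (\<lambda>k. u (r k) x / c)"
    by (rule AE_convergent_subseq[of s "\<lambda>k x. u k x / c", OF s_pos ucm mod frac])
  \<comment> \<open>The additional factor 2 turns differences of the \<open>p k\<close> into halved
    differences of normalized functions, whose modulars convexity keeps at most 1.\<close>
  define p where "p k x = u (r k) x / (2 * c)" for k x
  have pm [measurable]: "p k \<in> borel_measurable lebesgue" for k
    unfolding p_def by measurable
  have diff: "(\<lambda>x. p k x - p l x) = (\<lambda>x. (u (r k) x / c - u (r l) x / c) / 2)" for k l
    by (simp add: p_def diff_divide_distrib mult.commute)
  have half: "(a + b) / 2 \<le> 1" if "a \<le> 1" "b \<le> 1" for a b :: ennreal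
  proof -
    have "(a + b) / 2 \<le> (1 + 1) / 2" using that by (intro divide_right_mono_ennreal add_mono)
    then show ?thesis by (simp add: one_add_one)
  qed
  have pconv: "AE x in lebesgue. convergent (\<lambda>k. p k x)"
    using r(2)
  proof eventually_elim
    case (elim x)
    then have "convergent (\<lambda>k. (1 / 2) * (u (r k) x / c))"
      by (intro convergent_mult convergent_const)
    then show ?case by (simp add: p_def mult.commute)
  qed
  have Cauchy: "\<exists>n. \<forall>k\<ge>n. \<forall>l\<ge>n. modular \<Psi> (\<lambda>x. p k x - p l x) \<le> ennreal \<epsilon>" if "0 < \<epsilon>" for \<epsilon>
  proof (rule modular_Cauchy[OF dim pm _ _ _ pconv that])
    show "p k x = p k y" if "norm x = norm y" for k x y
      using radial[OF that] by (simp add: p_def)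
    show "modular G (\<lambda>x. p k x - p l x) \<le> 1" for k l
      unfolding diff by (rule order_trans[OF modular_half_diff[OF ucm ucm] half[OF mod mod]])
    show "frac_modular s G (\<lambda>x. p k x - p l x) \<le> 1" for k l
      unfolding diff by (rule order_trans[OF frac_modular_half_diff[OF ucm ucm] half[OF frac frac]])
  qed
  define v where "v x = lim (\<lambda>k. p k x)" for x
  have vm [measurable]: "v \<in> borel_measurable lebesgue"
    unfolding v_def by (rule borel_measurable_lim_metric) (rule pm)
  have Fatou: "modular \<Psi> (\<lambda>x. p k x - v x) \<le> ennreal \<epsilon>"
    if le: "\<And>l. n \<le> l \<Longrightarrow> modular \<Psi> (\<lambda>x. p k x - p l x) \<le> ennreal \<epsilon>" for k n \<epsilon>
  proof -
    have "modular \<Psi> (\<lambda>x. p k x - v x) \<le> (\<integral>\<^sup>+x. liminf (\<lambda>l. ennreal (\<Psi> \<bar>p k x - p l x\<bar>)) \<partial>lebesgue)"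
      unfolding modular_def
    proof (rule nn_integral_mono_AE)
      show "AE x in lebesgue. ennreal (\<Psi> \<bar>p k x - v x\<bar>) \<le> liminf (\<lambda>l. ennreal (\<Psi> \<bar>p k x - p l x\<bar>))"
        using pconv
      proof eventually_elim
        case (elim x)
        then have lim: "(\<lambda>l. p l x) \<longlonglongrightarrow> v x" by (simp add: v_def convergent_LIMSEQ_iff)
        have "(\<lambda>l. \<Psi> \<bar>p k x - p l x\<bar>) \<longlonglongrightarrow> \<Psi> \<bar>p k x - v x\<bar>"
          using P.G_abs_continuous
          by (intro continuous_on_tendsto_compose[of UNIV "\<lambda>t. \<Psi> \<bar>t\<bar>"] tendsto_intros lim) auto
        from lim_imp_Liminf[OF trivial_limit_sequentially tendsto_ennrealI[OF this]]
        show ?case by simp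
      qed
    qed
    also have "\<dots> \<le> liminf (\<lambda>l. modular \<Psi> (\<lambda>x. p k x - p l x))"
      unfolding modular_def by (intro nn_integral_liminf P.modular_measurable) measurable
    also have "\<dots> \<le> liminf (\<lambda>l. ennreal \<epsilon>)"
      by (rule Liminf_mono) (auto simp: eventually_sequentially intro!: exI[of _ n] le)
    also have "\<dots> = ennreal \<epsilon>" by (simp add: Liminf_const)
    finally show ?thesis .
  qed
  have lim_mod: "\<exists>n. \<forall>k\<ge>n. modular \<Psi> (\<lambda>x. p k x - v x) \<le> ennreal \<epsilon>" if "0 < \<epsilon>" for \<epsilon>
  proof -
    obtain n where "\<And>k l. n \<le> k \<Longrightarrow> n \<le> l \<Longrightarrow> modular \<Psi> (\<lambda>x. p k x - p l x) \<le> ennreal \<epsilon>"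
      using Cauchy[OF \<open>0 < \<epsilon>\<close>] by auto
    then show ?thesis by (intro exI[of _ n] allI impI Fatou[of n])
  qed
  \<comment> \<open>Undoing the normalization and dividing by \<open>e\<close> dilates by
    \<open>2 * c / e\<close>, at most \<open>2 ^ j\<close>. Doubling costs the factor
    \<open>D\<close>, so modular at most \<open>1 / D\<close> gives norm at most
    \<open>e\<close>.\<close>
  have norm_le: "0 \<le> orlicz_norm \<Psi> (u (r k) - (\<lambda>x. 2 * c * v x)) \<and> orlicz_norm \<Psi> (u (r k) - (\<lambda>x. 2 * c * v x)) \<le> e"
    if e: "0 < e" and D: "0 < D" "\<And>t. 0 \<le> t \<Longrightarrow> \<Psi> (2 ^ j * t) \<le> D * \<Psi> t" and j: "2 * c / e \<le> 2 ^ j"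
      and k: "modular \<Psi> (\<lambda>x. p k x - v x) \<le> ennreal (1 / D)" for e D j k
  proof -
    have "modular \<Psi> (\<lambda>x. (u (r k) - (\<lambda>x. 2 * c * v x)) x / e)
        \<le> (\<integral>\<^sup>+x. ennreal D * ennreal (\<Psi> \<bar>p k x - v x\<bar>) \<partial>lebesgue)"
      unfolding modular_def
    proof (rule nn_integral_mono)
      fix x
      have "(u (r k) - (\<lambda>x. 2 * c * v x)) x / e = 2 * c / e * (p k x - v x)"
        using c0 e by (simp add: p_def field_simps)
      then have "\<bar>(u (r k) - (\<lambda>x. 2 * c * v x)) x / e\<bar> = 2 * c / e * \<bar>p k x - v x\<bar>"
        using c0 e by (simp add: abs_mult)
      also have "\<dots> \<le> 2 ^ j * \<bar>p k x - v x\<bar>" using j by (intro mult_right_mono) auto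
      finally have "\<Psi> \<bar>(u (r k) - (\<lambda>x. 2 * c * v x)) x / e\<bar> \<le> \<Psi> (2 ^ j * \<bar>p k x - v x\<bar>)"
        by (intro P.G_mono) auto
      also have "\<dots> \<le> D * \<Psi> \<bar>p k x - v x\<bar>" by (intro D) simp
      finally have "ennreal (\<Psi> \<bar>(u (r k) - (\<lambda>x. 2 * c * v x)) x / e\<bar>) \<le> ennreal (D * \<Psi> \<bar>p k x - v x\<bar>)"
        by (rule ennreal_leI)
      also have "\<dots> = ennreal D * ennreal (\<Psi> \<bar>p k x - v x\<bar>)"
        using D by (intro ennreal_mult P.G_nonneg) auto
      finally show "ennreal (\<Psi> \<bar>(u (r k) - (\<lambda>x. 2 * c * v x)) x / e\<bar>) \<le> ennreal D * ennreal (\<Psi> \<bar>p k x - v x\<bar>)" .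
    qed
    also have "\<dots> = ennreal D * modular \<Psi> (\<lambda>x. p k x - v x)"
      unfolding modular_def by (intro nn_integral_cmult P.modular_measurable) measurable
    also have "\<dots> \<le> ennreal D * ennreal (1 / D)" by (intro mult_left_mono k) simp
    also have "\<dots> = 1" using D by (simp add: ennreal_mult[symmetric])
    finally have "modular \<Psi> (\<lambda>x. (u (r k) - (\<lambda>x. 2 * c * v x)) x / e) \<le> 1" .
    from luxemburg_nonneg[of e "modular \<Psi>" "u (r k) - (\<lambda>x. 2 * c * v x)", OF e this]
      luxemburg_le[of e "modular \<Psi>" "u (r k) - (\<lambda>x. 2 * c * v x)", OF e this]
    show ?thesis unfolding orlicz_norm_def ..
  qed
  show ?thesis
  proof (rule bexI[of _ "\<lambda>x. 2 * c * v x"], intro exI[of _ r] conjI)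
    show "strict_mono r" by (rule r)
    show "(\<lambda>k. orlicz_norm \<Psi> (u (r k) - (\<lambda>x. 2 * c * v x))) \<longlonglongrightarrow> 0"
    proof (rule LIMSEQ_I)
      fix e :: real assume e: "0 < e"
      obtain j where j: "2 * c / (e / 2) \<le> 2 ^ j"
        using real_arch_pow[of 2 "2 * c / (e / 2)"] by (auto intro: less_imp_le)
      obtain D where D: "0 < D" "\<And>t. 0 \<le> t \<Longrightarrow> \<Psi> (2 ^ j * t) \<le> D * \<Psi> t"
        using Delta2_power[OF \<Delta>] by metis
      obtain n where n: "\<And>k. n \<le> k \<Longrightarrow> modular \<Psi> (\<lambda>x. p k x - v x) \<le> ennreal (1 / D)"
        using lim_mod[of "1 / D"] D by auto
      have "norm (orlicz_norm \<Psi> (u (r k) - (\<lambda>x. 2 * c * v x)) - 0) < e" if "n \<le> k" for k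
        using norm_le[OF _ D j n[OF that]] e by simp
      then show "\<exists>n. \<forall>k\<ge>n. norm (orlicz_norm \<Psi> (u (r k) - (\<lambda>x. 2 * c * v x)) - 0) < e" by blast
    qed
    show "(\<lambda>x. 2 * c * v x) \<in> orlicz_space \<Psi>"
    proof -
      obtain n where n: "modular \<Psi> (\<lambda>x. p n x - v x) \<le> ennreal 1" using lim_mod[of 1] by auto
      obtain L where L: "\<And>u :: real^'n \<Rightarrow> real. u \<in> borel_measurable lebesgue \<Longrightarrow> modular G u \<le> 1 \<Longrightarrow>
          frac_modular s G u \<le> 1 \<Longrightarrow> modular \<Psi> u \<le> ennreal L"
        using modular_bounded by metis
      have pL: "modular \<Psi> (p n) \<le> ennreal L"
      proof (rule L[OF pm])
        have eq: "p n = (\<lambda>x. (1 / 2) * (u (r n) x / c))" by (simp add: p_def fun_eq_iff)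
        show "modular G (p n) \<le> 1" unfolding eq by (rule order_trans[OF modular_shrink mod]) auto
        show "frac_modular s G (p n) \<le> 1" unfolding eq by (rule order_trans[OF frac_modular_shrink frac]) auto
      qed
      have "(modular \<Psi> (p n) + modular \<Psi> (\<lambda>x. p n x - v x)) / 2 < \<infinity>"
      proof -
        have "modular \<Psi> (p n) \<noteq> top" "modular \<Psi> (\<lambda>x. p n x - v x) \<noteq> top"
          using pL n by (auto simp: top_unique)
        then show ?thesis by (simp add: ennreal_divide_eq_top_iff less_top[symmetric])
      qed
      \<comment> \<open>The limit is written as a difference of \<open>p n\<close> and
        \<open>p n - v\<close>, both of finite modular.\<close>
      then have "modular \<Psi> (\<lambda>x. (p n x - (p n x - v x)) / 2) < \<infinity>"
        by (rule le_less_trans[OF P.modular_half_diff, rotated 2]) measurable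
      then have "modular \<Psi> (\<lambda>x. 1 / (4 * c) * (2 * c * v x)) < \<infinity>" using c0 by simp
      then show ?thesis
        unfolding orlicz_space_def using c0 by (auto intro!: exI[of _ "1 / (4 * c)"])
    qed
  qed
qed

end

theorem theorem1p1:
  fixes s pm pp :: real and g G \<Psi> :: "real \<Rightarrow> real"
  assumes "CARD('n::finite) \<ge> 3"
    and "0 < s" "s < 1"
    and "has_young_density G g"
    and "1 < pm" and "\<And>t. t > 0 \<Longrightarrow> pm \<le> t * g t / G t \<and> t * g t / G t \<le> pp"
    and "sobolev_conj_admissible CARD('n) s G"
    and "young_function \<Psi>" and "Delta2 \<Psi>"
    and "((\<lambda>t. \<Psi> \<bar>t\<bar> / G \<bar>t\<bar>) \<longlongrightarrow> 0) (at 0)"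
    and "\<Psi> \<prec>\<prec> sobolev_conj CARD('n) s G"
  shows "compactly_embedded
           (frac_orlicz_sobolev_rad s G :: (real^'n \<Rightarrow> real) set) (frac_orlicz_sobolev_norm s G)
           (orlicz_space \<Psi>) (orlicz_norm \<Psi>)"
proof -
  obtain \<psi> where \<psi>: "has_young_density \<Psi> \<psi>"
    using assms(8) by (auto simp: young_function_def)
  interpret orlicz_embedding G g s "TYPE('n)" \<Psi> \<psi>
    by unfold_locales (fact assms(2,4,7,10,11) \<psi> | simp)+
  obtain L where L: "\<forall>u :: real^'n \<Rightarrow> real. u \<in> frac_orlicz_sobolev s G \<longrightarrow>
      u \<in> orlicz_space \<Psi> \<and> orlicz_norm \<Psi> u \<le> L * frac_orlicz_sobolev_norm s G u"
    using embedding ..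
  have rad: "u \<in> frac_orlicz_sobolev s G" "norm x = norm y \<Longrightarrow> u x = u y"
    if "u \<in> frac_orlicz_sobolev_rad s G" for u :: "real^'n \<Rightarrow> real" and x y
    using that unfolding frac_orlicz_sobolev_rad_def by (simp, metis (mono_tags, lifting) mem_Collect_eq)
  \<comment> \<open>Inclusion and norm bound are inherited from the full space through
    \<open>embedding\<close>; convergent subsequences come from \<open>compactness\<close>.\<close>
  show ?thesis
    unfolding compactly_embedded_def
  proof (intro conjI exI[of _ L] allI impI subsetI ballI)
    fix u :: "real^'n \<Rightarrow> real"
    assume "u \<in> frac_orlicz_sobolev_rad s G"
    then have u: "u \<in> frac_orlicz_sobolev s G" by (rule rad)
    show "u \<in> orlicz_space \<Psi>" using L u by simp
    show "orlicz_norm \<Psi> u \<le> L * frac_orlicz_sobolev_norm s G u" using L u by simp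
  next
    fix u :: "nat \<Rightarrow> real^'n \<Rightarrow> real"
    assume *: "range u \<subseteq> frac_orlicz_sobolev_rad s G \<and> (\<exists>M. \<forall>k. frac_orlicz_sobolev_norm s G (u k) \<le> M)"
    from conjunct2[OF *] obtain M where M: "\<forall>k. frac_orlicz_sobolev_norm s G (u k) \<le> M" ..
    have u: "u k \<in> frac_orlicz_sobolev_rad s G" for k
      using subsetD[OF conjunct1[OF *] rangeI] .
    have "2 \<le> CARD('n)" using assms(1) by linarith
    then show "\<exists>v\<in>orlicz_space \<Psi>. \<exists>r. strict_mono r \<and> (\<lambda>k. orlicz_norm \<Psi> (u (r k) - v)) \<longlonglongrightarrow> 0"
      by (rule compactness[OF _ assms(9) rad(1)[OF u] rad(2)[OF u] M[rule_format]])
  qed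
qed

end
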